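(* Let $V$ be a model of set theory, $\kappa$ an infinite ordinal, $X\in V$ an infinite set and $\mathscr{L}\in V$ a relational language. Suppose $\mathcal{M}$ is Cohen generic on $X$ over $V$ for some strong Fraïssé class of $\mathscr{L}$-structures that is not highly homogeneous. Then $\mathcal{M}$ is not $\nu$-random generic over $V$ for any invariant measure $\nu\in V$ on $\mathrm{Str}^\kappa_{\mathscr{L}}(X)$. Similarly, if $\mathcal{M}$ is $\nu$-random generic over $V$ for some invariant measure $\nu\in V$ on $\mathrm{Str}^\kappa_{\mathscr{L}}(X)$, then $\mathcal{M}$ is not Cohen generic on $X$ over $V$ for any strong Fraïssé class of $\mathscr{L}$-structures that is not highly homogeneous.
   Context: A model of set theory is a transitive model of ZFC. Structures and measures: $\mathrm{Str}_{\mathscr{L}}(X)$ is the set of $\mathscr{L}$-structures with underlying set $X$. An $\mathscr{L}$-literal is an atomic formula or a (possibly iterated) negation of one. $\sigma_\kappa(\mathrm{Str}_{\mathscr{L}}(X))$ is the smallest family of subsets of $\mathrm{Str}_{\mathscr{L}}(X)$ closed under complements and under unions of size $\le\kappa$ and containing all sets $\{\mathcal{M}:\mathcal{M}\models\varphi(\bar a)\}$ for $\varphi$ a literal and $\bar a$ a tuple from $X$. $\mathrm{Str}^\kappa_{\mathscr{L}}(X)$ is $\mathrm{Str}_{\mathscr{L}}(X)$ with this family of measurable sets. A probability $\kappa$-measure on it is a probability measure $\mu$ with $\mu(\bigcup_{i\in\kappa}A_i)=\sum_{i\in\kappa}\mu(A_i)$ for pairwise disjoint measurable $A_i$. $\mathrm{Sym}(X)$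 acts by $g\mathcal{M}\models R(g(a_0),\dots)$ iff $\mathcal{M}\models R(a_0,\dots)$; "invariant measure" means a probability $\kappa$-measure $\mu$ with $\mu(g[A])=\mu(A)$ for all $g\in\mathrm{Sym}(X)$ and measurable $A$. Codes: the set $\mathbb{B}^\kappa_{\mathscr{L}:X}$ of $\kappa$-Borel codes is the smallest set containing the basic codes $\langle 0,\varphi,\bar a\rangle$ ($\varphi$ a finite conjunction of $\mathscr{L}$-literals, $\bar a$ a tuple from $X$) and closed under formal negation $\neg\gamma$ and formal $\bigvee\Gamma$, $\bigwedge\Gamma$ for $\Gamma=\{\gamma_i\}_{i\in\kappa}$. The interpretation $\mathrm{Int}(\gamma)\subseteq\mathrm{Str}_{\mathscr{L}}(X)$ interprets basic codes as $\{\mathcal{M}:\mathcal{M}\models\varphi(\bar a)\}$ and $\neg,\bigvee,\bigwedge$ as complement, union, intersection. $\mu(\gamma)=\mu(\mathrm{Int}(\gamma))$. Random generics: $\gamma\preceq_\mu\zeta$ means $\mu(\gamma\wedge\neg\zeta)=0$, and $\mathcal{O}^+(\mu)=(\{\gamma\in\mathbb{B}^\kappa_{\mathscr{L}:X}:\mu(\gamma)>0\},\preceq_\mu)$ (smaller is stronger), computed in $V$. For a filter $G$ on $\mathcal{O}^+(\mu)$ generic over $V$, there is a unique structure $\mathcal{M}_G$ with $V[G]\models\bigcap_{g\in G}\mathrm{Int}(g)=\{\mathcal{M}_G\}$; structures of this form are called $\mu$-random generic (over $V$). Cohen generics: a strong Fraïssé class is a class $\mathbf{K}$ of finite $\mathscr{L}$-structures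 closed under isomorphism and substructures (HP), such that any two members embed in a common member (JEP), and with strong amalgamation: for embeddings $i_1:\mathcal{M}_0\to\mathcal{M}_1$, $i_2:\mathcal{M}_0\to\mathcal{M}_2$ in $\mathbf{K}$ there are $\mathcal{M}_3\in\mathbf{K}$ and embeddings $j_1:\mathcal{M}_1\to\mathcal{M}_3$, $j_2:\mathcal{M}_2\to\mathcal{M}_3$ with $j_1 i_1=j_2 i_2$ and $j_1[M_1]\cap j_2[M_2]=j_1i_1[M_0]$. It is highly homogeneous if any two members of the same size are isomorphic. $\mathfrak{C}_X(\mathbf{K})$ is the partial order of members of $\mathbf{K}$ with underlying set a subset of $X$, with $\mathcal{A}\le\mathcal{B}$ ($\mathcal{A}$ stronger) iff $\mathcal{B}$ is a substructure of $\mathcal{A}$. A structure is Cohen generic for $\mathbf{K}$ on $X$ over $V$ ($\mathbf{K}$ in $V$) if it equals $\bigcup G$ for some filter $G$ on $\mathfrak{C}_X(\mathbf{K})$ generic over $V$. *)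

theory Defs
  imports "HOL-Analysis.Infinite_Sum"
begin

section \<open>Models of ZFC\<close>

text \<open>First-order formulas in the language of set theory, with variables named by natural numbers.\<close>

datatype set_formula =
    FMem nat nat
  | FEq nat nat
  | FNot set_formula
  | FAnd set_formula set_formula
  | FAll nat set_formula

text \<open>\<open>fsat E M s \<phi>\<close>: the structure \<open>(M, E)\<close> satisfies \<open>\<phi>\<close> under the assignment \<open>s\<close>.\<close>

primrec fsat :: "('u \<Rightarrow> 'u \<Rightarrow> bool) \<Rightarrow> 'u set \<Rightarrow> (nat \<Rightarrow> 'u) \<Rightarrow> set_formula \<Rightarrow> bool" where
  "fsat E M s (FMem i j) = E (s i) (s j)"
| "fsat E M s (FEq i j) = (s i = s j)"
| "fsat E M s (FNot \<phi>) = (\<not> fsat E M s \<phi>)"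
| "fsat E M s (FAnd \<phi> \<psi>) = (fsat E M s \<phi> \<and> fsat E M s \<psi>)"
| "fsat E M s (FAll i \<phi>) = (\<forall>a\<in>M. fsat E M (s(i := a)) \<phi>)"

text \<open>In the two schemas the variables 0 and 1 are the distinguished ones; the values of \<open>s\<close> at all
  other variables are the parameters. Choice is stated as the existence of a transversal for every
  family of nonempty, pairwise disjoint sets.\<close>

definition ax_extensionality :: "('u \<Rightarrow> 'u \<Rightarrow> bool) \<Rightarrow> 'u set \<Rightarrow> bool" where
  "ax_extensionality E M \<longleftrightarrow>
    (\<forall>x\<in>M. \<forall>y\<in>M. (\<forall>z\<in>M. E z x \<longleftrightarrow> E z y) \<longrightarrow> x = y)"

definition ax_foundation :: "('u \<Rightarrow> 'u \<Rightarrow> bool) \<Rightarrow> 'u set \<Rightarrow> bool" where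
  "ax_foundation E M \<longleftrightarrow>
    (\<forall>x\<in>M. (\<exists>y\<in>M. E y x) \<longrightarrow> (\<exists>y\<in>M. E y x \<and> \<not> (\<exists>z\<in>M. E z x \<and> E z y)))"

definition ax_pairing :: "('u \<Rightarrow> 'u \<Rightarrow> bool) \<Rightarrow> 'u set \<Rightarrow> bool" where
  "ax_pairing E M \<longleftrightarrow>
    (\<forall>x\<in>M. \<forall>y\<in>M. \<exists>p\<in>M. \<forall>z\<in>M. E z p \<longleftrightarrow> z = x \<or> z = y)"

definition ax_union :: "('u \<Rightarrow> 'u \<Rightarrow> bool) \<Rightarrow> 'u set \<Rightarrow> bool" where
  "ax_union E M \<longleftrightarrow>
    (\<forall>x\<in>M. \<exists>u\<in>M. \<forall>z\<in>M. E z u \<longleftrightarrow> (\<exists>y\<in>M. E y x \<and> E z y))"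

definition ax_power_set :: "('u \<Rightarrow> 'u \<Rightarrow> bool) \<Rightarrow> 'u set \<Rightarrow> bool" where
  "ax_power_set E M \<longleftrightarrow>
    (\<forall>x\<in>M. \<exists>p\<in>M. \<forall>z\<in>M. E z p \<longleftrightarrow> (\<forall>w\<in>M. E w z \<longrightarrow> E w x))"

definition ax_infinity :: "('u \<Rightarrow> 'u \<Rightarrow> bool) \<Rightarrow> 'u set \<Rightarrow> bool" where
  "ax_infinity E M \<longleftrightarrow>
    (\<exists>w\<in>M. (\<exists>e\<in>M. E e w \<and> \<not> (\<exists>z\<in>M. E z e)) \<and>
      (\<forall>n\<in>M. E n w \<longrightarrow> (\<exists>m\<in>M. E m w \<and> (\<forall>z\<in>M. E z m \<longleftrightarrow> E z n \<or> z = n))))"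

definition ax_separation :: "('u \<Rightarrow> 'u \<Rightarrow> bool) \<Rightarrow> 'u set \<Rightarrow> bool" where
  "ax_separation E M \<longleftrightarrow>
    (\<forall>\<phi> s. (\<forall>i. s i \<in> M) \<longrightarrow>
      (\<forall>x\<in>M. \<exists>y\<in>M. \<forall>z\<in>M. E z y \<longleftrightarrow> E z x \<and> fsat E M (s(0 := z)) \<phi>))"

definition ax_replacement :: "('u \<Rightarrow> 'u \<Rightarrow> bool) \<Rightarrow> 'u set \<Rightarrow> bool" where
  "ax_replacement E M \<longleftrightarrow>
    (\<forall>\<phi> s. (\<forall>i. s i \<in> M) \<longrightarrow>
      (\<forall>x\<in>M. (\<forall>a\<in>M. E a x \<longrightarrow> (\<exists>!b. b \<in> M \<and> fsat E M (s(0 := a, 1 := b)) \<phi>)) \<longrightarrow>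
        (\<exists>y\<in>M. \<forall>b\<in>M. E b y \<longleftrightarrow> (\<exists>a\<in>M. E a x \<and> fsat E M (s(0 := a, 1 := b)) \<phi>))))"

definition ax_choice :: "('u \<Rightarrow> 'u \<Rightarrow> bool) \<Rightarrow> 'u set \<Rightarrow> bool" where
  "ax_choice E M \<longleftrightarrow>
    (\<forall>x\<in>M. (\<forall>y\<in>M. E y x \<longrightarrow> (\<exists>z\<in>M. E z y)) \<and>
        (\<forall>y\<in>M. \<forall>y'\<in>M. E y x \<and> E y' x \<and> y \<noteq> y' \<longrightarrow> \<not> (\<exists>z\<in>M. E z y \<and> E z y')) \<longrightarrow>
      (\<exists>c\<in>M. \<forall>y\<in>M. E y x \<longrightarrow> (\<exists>!z. z \<in> M \<and> E z y \<and> E z c)))"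

definition ZFC :: "('u \<Rightarrow> 'u \<Rightarrow> bool) \<Rightarrow> 'u set \<Rightarrow> bool" where
  "ZFC E M \<longleftrightarrow> ax_extensionality E M \<and>
     ax_foundation E M \<and>
     ax_pairing E M \<and>
     ax_union E M \<and>
     ax_power_set E M \<and>
     ax_infinity E M \<and>
     ax_separation E M \<and>
     ax_replacement E M \<and>
     ax_choice E M"

text \<open>The ambient universe of sets in which models, generic filters and generic extensions live:
  a type with a well-founded membership relation satisfying ZFC. Since ZFC is first order, this
  allows the universe to be a set model, for instance a generic extension of the model \<open>V\<close> at hand;
  a second-order universe is not required.\<close>

class set_universe =
  fixes mem :: "'a \<Rightarrow> 'a \<Rightarrow> bool"
  assumes wf_mem: "wf {(x, y). mem x y}"
    and zfc_mem: "ZFC mem UNIV"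

definition elts :: "'u::set_universe \<Rightarrow> 'u set" where
  "elts x = {y. mem y x}"

definition model_of_set_theory :: "'u::set_universe set \<Rightarrow> bool" where
  "model_of_set_theory V \<longleftrightarrow> (\<forall>x\<in>V. elts x \<subseteq> V) \<and> ZFC mem V"

text \<open>A class of \<open>V\<close>: definable over \<open>V\<close> with parameters from \<open>V\<close>.\<close>

definition class_of :: "'u::set_universe set \<Rightarrow> 'u set \<Rightarrow> bool" where
  "class_of V K \<longleftrightarrow> (\<exists>\<phi> s. (\<forall>i. s i \<in> V) \<and> K = {x \<in> V. fsat mem V (s(0 := x)) \<phi>})"

section \<open>Basic set theory in the universe\<close>

text \<open>The element with extension \<open>S\<close>; only meaningful if \<open>S\<close> is a set of the universe.\<close>

definition mk :: "'u::set_universe set \<Rightarrow> 'u" where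
  "mk S = (THE x. elts x = S)"

definition opair :: "'u::set_universe \<Rightarrow> 'u \<Rightarrow> 'u" where
  "opair x y = mk {mk {x}, mk {x, y}}"

definition pfst :: "'u::set_universe \<Rightarrow> 'u" where
  "pfst p = (THE x. \<exists>y. p = opair x y)"

definition psnd :: "'u::set_universe \<Rightarrow> 'u" where
  "psnd p = (THE y. \<exists>x. p = opair x y)"

primrec num :: "nat \<Rightarrow> 'u::set_universe" where
  "num 0 = mk {}"
| "num (Suc n) = mk (insert (num n) (elts (num n)))"

definition omega :: "'u::set_universe" where
  "omega = mk (range num)"

primrec tup :: "'u::set_universe list \<Rightarrow> 'u" where
  "tup [] = mk {}"
| "tup (x # xs) = opair x (tup xs)"

definition is_function :: "'u::set_universe \<Rightarrow> 'u \<Rightarrow> bool" where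
  "is_function f A \<longleftrightarrow> elts f \<subseteq> {opair x y | x y. x \<in> elts A} \<and>
     (\<forall>x\<in>elts A. \<exists>!y. opair x y \<in> elts f)"

definition app :: "'u::set_universe \<Rightarrow> 'u \<Rightarrow> 'u" where
  "app f x = (THE y. opair x y \<in> elts f)"

definition is_ordinal :: "'u::set_universe \<Rightarrow> bool" where
  "is_ordinal \<alpha> \<longleftrightarrow> (\<forall>x\<in>elts \<alpha>. elts x \<subseteq> elts \<alpha> \<and> (\<forall>y\<in>elts x. elts y \<subseteq> elts x))"

definition size_le :: "'u::set_universe set \<Rightarrow> 'u \<Rightarrow> 'u \<Rightarrow> bool" where
  "size_le V F \<kappa> \<longleftrightarrow> (\<exists>f\<in>V. is_function f F \<and> app f ` elts F \<subseteq> elts \<kappa> \<and> inj_on (app f) (elts F))"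

section \<open>Relational structures\<close>

text \<open>A relational language is a function assigning to each relation symbol its arity.\<close>

definition relational_language :: "'u::set_universe \<Rightarrow> bool" where
  "relational_language L \<longleftrightarrow> (\<exists>S. is_function L S \<and> app L ` elts S \<subseteq> elts omega)"

definition has_arity :: "'u::set_universe \<Rightarrow> 'u \<Rightarrow> nat \<Rightarrow> bool" where
  "has_arity L R n \<longleftrightarrow> opair R (num n) \<in> elts L"

text \<open>A structure is the pair of its underlying set and the set of all \<open>opair R (tup as)\<close> such that
  \<open>R(as)\<close> holds. Empty structures are allowed.\<close>

definition structures_on :: "'u::set_universe \<Rightarrow> 'u \<Rightarrow> 'u set" where
  "structures_on L X = {opair X I | I.
     elts I \<subseteq> {opair R (tup as) | R as. has_arity L R (length as) \<and> set as \<subseteq> elts X}}"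

definition holds :: "'u::set_universe \<Rightarrow> 'u \<Rightarrow> 'u list \<Rightarrow> bool" where
  "holds M R as \<longleftrightarrow> opair R (tup as) \<in> elts (psnd M)"

text \<open>\<open>Str L X\<close> as computed in the model \<open>W\<close>.\<close>

definition Str :: "'u::set_universe set \<Rightarrow> 'u \<Rightarrow> 'u \<Rightarrow> 'u set" where
  "Str W L X = structures_on L X \<inter> W"

text \<open>The action of a permutation \<open>g\<close> (a set of the universe) of the underlying set.\<close>

definition act :: "'u::set_universe \<Rightarrow> 'u \<Rightarrow> 'u" where
  "act g M = opair (pfst M) (mk {opair R (tup (map (app g) as)) | R as.
     set as \<subseteq> elts (pfst M) \<and> holds M R as})"

datatype 'u literal =
    LRel 'u "nat list"
  | LEq nat nat
  | LNot "'u literal"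

text \<open>Well-formedness of literals with variables among the first \<open>n\<close>.\<close>

primrec wf_literal :: "'u::set_universe \<Rightarrow> nat \<Rightarrow> 'u literal \<Rightarrow> bool" where
  "wf_literal L n (LRel R is) = (has_arity L R (length is) \<and> (\<forall>i\<in>set is. i < n))"
| "wf_literal L n (LEq i j) = (i < n \<and> j < n)"
| "wf_literal L n (LNot l) = wf_literal L n l"

primrec lit_true :: "'u::set_universe \<Rightarrow> 'u list \<Rightarrow> 'u literal \<Rightarrow> bool" where
  "lit_true M as (LRel R is) = holds M R (map (nth as) is)"
| "lit_true M as (LEq i j) = (as ! i = as ! j)"
| "lit_true M as (LNot l) = (\<not> lit_true M as l)"

section \<open>Borel codes\<close>

primrec literal_set :: "'u::set_universe literal \<Rightarrow> 'u" where
  "literal_set (LRel R is) = tup [num 0, R, tup (map num is)]"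
| "literal_set (LEq i j) = tup [num 1, num i, num j]"
| "literal_set (LNot l) = tup [num 2, literal_set l]"

definition code_basic :: "'u::set_universe literal list \<Rightarrow> 'u list \<Rightarrow> 'u" where
  "code_basic ls as = tup [num 0, tup (map literal_set ls), tup as]"

definition code_neg :: "'u::set_universe \<Rightarrow> 'u" where
  "code_neg \<gamma> = tup [num 1, \<gamma>]"

definition code_Or :: "'u::set_universe \<Rightarrow> 'u" where
  "code_Or \<Gamma> = tup [num 2, \<Gamma>]"

definition code_And :: "'u::set_universe \<Rightarrow> 'u" where
  "code_And \<Gamma> = tup [num 3, \<Gamma>]"

text \<open>The \<open>\<kappa>\<close>-Borel codes of \<open>V\<close>. The families \<open>(\<gamma>\<^sub>i)\<close>, \<open>i \<in> \<kappa>\<close>, are required to be in \<open>V\<close>; the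
  least set closed under the rules is then the same whether formed in \<open>V\<close> or outside.\<close>

inductive_set borel_codes :: "'u::set_universe set \<Rightarrow> 'u \<Rightarrow> 'u \<Rightarrow> 'u \<Rightarrow> 'u set"
  for V \<kappa> L X where
  basic: "set as \<subseteq> elts X \<Longrightarrow> \<forall>l\<in>set ls. wf_literal L (length as) l \<Longrightarrow>
     code_basic ls as \<in> borel_codes V \<kappa> L X"
| neg: "\<gamma> \<in> borel_codes V \<kappa> L X \<Longrightarrow> code_neg \<gamma> \<in> borel_codes V \<kappa> L X"
| Or: "f \<in> V \<Longrightarrow> is_function f \<kappa> \<Longrightarrow> \<forall>i\<in>elts \<kappa>. app f i \<in> borel_codes V \<kappa> L X \<Longrightarrow>
     code_Or (mk (app f ` elts \<kappa>)) \<in> borel_codes V \<kappa> L X"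
| And: "f \<in> V \<Longrightarrow> is_function f \<kappa> \<Longrightarrow> \<forall>i\<in>elts \<kappa>. app f i \<in> borel_codes V \<kappa> L X \<Longrightarrow>
     code_And (mk (app f ` elts \<kappa>)) \<in> borel_codes V \<kappa> L X"

text \<open>Interpretation of a code in a given set \<open>S\<close> of structures: \<open>S\<close> is \<open>Str W L X\<close> for the
  interpretation computed in \<open>W\<close>. The recursion is along the transitive closure of membership.\<close>

definition Interp :: "'u::set_universe set \<Rightarrow> 'u \<Rightarrow> 'u set" where
  "Interp S = wfrec ({(x, y). mem x y}\<^sup>+) (\<lambda>I \<gamma>. {M \<in> S.
     (\<exists>ls as. \<gamma> = code_basic ls as \<and> (\<forall>l\<in>set ls. lit_true M as l)) \<or>
     (\<exists>\<delta>. \<gamma> = code_neg \<delta> \<and> M \<notin> I \<delta>) \<or>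
     (\<exists>\<Gamma>. \<gamma> = code_Or \<Gamma> \<and> (\<exists>\<delta>\<in>elts \<Gamma>. M \<in> I \<delta>)) \<or>
     (\<exists>\<Gamma>. \<gamma> = code_And \<Gamma> \<and> (\<forall>\<delta>\<in>elts \<Gamma>. M \<in> I \<delta>))})"

section \<open>Invariant measures\<close>

text \<open>The measurable sets \<open>\<sigma>\<^sub>\<kappa>(Str L X)\<close> of \<open>V\<close>; as for the codes, the families whose unions are
  taken are those in \<open>V\<close>.\<close>

inductive_set measurable_sets :: "'u::set_universe set \<Rightarrow> 'u \<Rightarrow> 'u \<Rightarrow> 'u \<Rightarrow> 'u set"
  for V \<kappa> L X where
  basic: "set as \<subseteq> elts X \<Longrightarrow> wf_literal L (length as) l \<Longrightarrow>
     mk {M \<in> Str V L X. lit_true M as l} \<in> measurable_sets V \<kappa> L X"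
| complement: "A \<in> measurable_sets V \<kappa> L X \<Longrightarrow>
     mk (Str V L X - elts A) \<in> measurable_sets V \<kappa> L X"
| union: "F \<in> V \<Longrightarrow> size_le V F \<kappa> \<Longrightarrow> \<forall>A\<in>elts F. A \<in> measurable_sets V \<kappa> L X \<Longrightarrow>
     mk (\<Union>A\<in>elts F. elts A) \<in> measurable_sets V \<kappa> L X"

text \<open>The set \<open>c\<close> of the universe represents the nonnegative real \<open>r\<close>, as the lower cut
  \<open>{(m, n). m / n < r}\<close>. The reals of \<open>V\<close> are those represented by elements of \<open>V\<close>.\<close>

definition represents_real :: "'u::set_universe \<Rightarrow> real \<Rightarrow> bool" where
  "represents_real c r \<longleftrightarrow> 0 \<le> r \<and>
     elts c = {opair (num m) (num n) | m n. real m < real n * r}"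

definition meas :: "'u::set_universe \<Rightarrow> 'u \<Rightarrow> real" where
  "meas \<mu> A = (THE r. represents_real (app \<mu> A) r)"

text \<open>Additivity for disjoint families in \<open>V\<close> indexed by \<open>I\<close>. Sums of nonnegative reals are suprema of
  finite partial sums, so the sum computed in \<open>V\<close> is the sum computed outside.\<close>

definition additive_over ::
  "'u::set_universe set \<Rightarrow> 'u set \<Rightarrow> 'u \<Rightarrow> 'u \<Rightarrow> bool" where
  "additive_over V \<Sigma> I \<mu> \<longleftrightarrow>
    (\<forall>f\<in>V. is_function f I \<and> app f ` elts I \<subseteq> \<Sigma> \<and>
        (\<forall>i\<in>elts I. \<forall>j\<in>elts I. i \<noteq> j \<longrightarrow> elts (app f i) \<inter> elts (app f j) = {}) \<longrightarrow>
      ((\<lambda>i. meas \<mu> (app f i)) has_sum meas \<mu> (mk (\<Union>i\<in>elts I. elts (app f i)))) (elts I))"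

definition probability_measure ::
  "'u::set_universe set \<Rightarrow> 'u \<Rightarrow> 'u \<Rightarrow> 'u \<Rightarrow> 'u \<Rightarrow> bool" where
  "probability_measure V \<kappa> L X \<mu> \<longleftrightarrow>
    (\<exists>\<Sigma>. elts \<Sigma> = measurable_sets V \<kappa> L X \<and> is_function \<mu> \<Sigma> \<and>
      (\<forall>A\<in>elts \<Sigma>. \<exists>r. represents_real (app \<mu> A) r)) \<and>
    meas \<mu> (mk {}) = 0 \<and>
    meas \<mu> (mk (Str V L X)) = 1 \<and>
    additive_over V (measurable_sets V \<kappa> L X) omega \<mu> \<and>
    additive_over V (measurable_sets V \<kappa> L X) \<kappa> \<mu>"

definition invariant_measure ::
  "'u::set_universe set \<Rightarrow> 'u \<Rightarrow> 'u \<Rightarrow> 'u \<Rightarrow> 'u \<Rightarrow> bool" where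
  "invariant_measure V \<kappa> L X \<mu> \<longleftrightarrow> probability_measure V \<kappa> L X \<mu> \<and>
    (\<forall>g\<in>V. is_function g X \<and> bij_betw (app g) (elts X) (elts X) \<longrightarrow>
      (\<forall>A\<in>measurable_sets V \<kappa> L X. meas \<mu> (mk (act g ` elts A)) = meas \<mu> A))"

text \<open>The measure of a code, computed in \<open>V\<close>.\<close>

definition code_meas ::
  "'u::set_universe set \<Rightarrow> 'u \<Rightarrow> 'u \<Rightarrow> 'u \<Rightarrow> 'u \<Rightarrow> real" where
  "code_meas V L X \<mu> \<gamma> = meas \<mu> (mk (Interp (Str V L X) \<gamma>))"

section \<open>Generic filters and generic extensions\<close>

text \<open>\<open>le p q\<close> means that \<open>p\<close> is stronger than \<open>q\<close>. The filter is a set \<open>G\<close> of the universe, in general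
  not in \<open>V\<close>; the dense sets to be met are those in \<open>V\<close>.\<close>

definition filter_on :: "'u::set_universe set \<Rightarrow> ('u \<Rightarrow> 'u \<Rightarrow> bool) \<Rightarrow> 'u set \<Rightarrow> bool" where
  "filter_on P le G \<longleftrightarrow> G \<subseteq> P \<and> G \<noteq> {} \<and>
    (\<forall>p\<in>G. \<forall>q\<in>P. le p q \<longrightarrow> q \<in> G) \<and>
    (\<forall>p\<in>G. \<forall>q\<in>G. \<exists>r\<in>G. le r p \<and> le r q)"

definition dense_in :: "'u::set_universe set \<Rightarrow> ('u \<Rightarrow> 'u \<Rightarrow> bool) \<Rightarrow> 'u set \<Rightarrow> bool" where
  "dense_in P le D \<longleftrightarrow> D \<subseteq> P \<and> (\<forall>p\<in>P. \<exists>d\<in>D. le d p)"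

definition generic_filter ::
  "'u::set_universe set \<Rightarrow> 'u set \<Rightarrow> ('u \<Rightarrow> 'u \<Rightarrow> bool) \<Rightarrow> 'u \<Rightarrow> bool" where
  "generic_filter V P le G \<longleftrightarrow> filter_on P le (elts G) \<and>
    (\<forall>D\<in>V. dense_in P le (elts D) \<longrightarrow> elts G \<inter> elts D \<noteq> {})"

text \<open>The value of a name: \<open>val G \<tau> = {val G \<sigma> | (\<sigma>, p) \<in> \<tau>, p \<in> G}\<close>.\<close>

definition val :: "'u::set_universe \<Rightarrow> 'u \<Rightarrow> 'u" where
  "val G = wfrec ({(x, y). mem x y}\<^sup>+)
     (\<lambda>v \<tau>. mk {v \<sigma> | \<sigma> p. p \<in> elts G \<and> opair \<sigma> p \<in> elts \<tau>})"

definition generic_extension :: "'u::set_universe set \<Rightarrow> 'u \<Rightarrow> 'u set" where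
  "generic_extension V G = val G ` V"

section \<open>Random generic structures\<close>

definition random_conditions ::
  "'u::set_universe set \<Rightarrow> 'u \<Rightarrow> 'u \<Rightarrow> 'u \<Rightarrow> 'u \<Rightarrow> 'u set" where
  "random_conditions V \<kappa> L X \<mu> = {\<gamma> \<in> borel_codes V \<kappa> L X. code_meas V L X \<mu> \<gamma> > 0}"

definition random_le ::
  "'u::set_universe set \<Rightarrow> 'u \<Rightarrow> 'u \<Rightarrow> 'u \<Rightarrow> 'u \<Rightarrow> 'u \<Rightarrow> bool" where
  "random_le V L X \<mu> \<gamma> \<zeta> \<longleftrightarrow> code_meas V L X \<mu> (code_And (mk {\<gamma>, code_neg \<zeta>})) = 0"

definition random_generic ::
  "'u::set_universe set \<Rightarrow> 'u \<Rightarrow> 'u \<Rightarrow> 'u \<Rightarrow> 'u \<Rightarrow> 'u \<Rightarrow> bool" where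
  "random_generic V \<kappa> L X \<mu> M \<longleftrightarrow>
    (\<exists>G. generic_filter V (random_conditions V \<kappa> L X \<mu>) (random_le V L X \<mu>) G \<and>
      (\<Inter>\<gamma>\<in>elts G. Interp (Str (generic_extension V G) L X) \<gamma>) = {M})"

section \<open>Cohen generic structures\<close>

text \<open>The maps below are between finite structures of \<open>V\<close> and hence, restricted to the underlying set,
  belong to \<open>V\<close>, so that they need not be coded as sets.\<close>

definition finite_structures :: "'u::set_universe set \<Rightarrow> 'u \<Rightarrow> 'u set" where
  "finite_structures V L = {M \<in> V. M \<in> structures_on L (pfst M) \<and> finite (elts (pfst M))}"

definition embedding :: "('u::set_universe \<Rightarrow> 'u) \<Rightarrow> 'u \<Rightarrow> 'u \<Rightarrow> bool" where
  "embedding h M N \<longleftrightarrow> inj_on h (elts (pfst M)) \<and> h ` elts (pfst M) \<subseteq> elts (pfst N) \<and>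
    (\<forall>R as. set as \<subseteq> elts (pfst M) \<longrightarrow> (holds M R as \<longleftrightarrow> holds N R (map h as)))"

definition isomorphic :: "'u::set_universe \<Rightarrow> 'u \<Rightarrow> bool" where
  "isomorphic M N \<longleftrightarrow> (\<exists>h. embedding h M N \<and> h ` elts (pfst M) = elts (pfst N))"

definition substructure :: "'u::set_universe \<Rightarrow> 'u \<Rightarrow> bool" where
  "substructure M N \<longleftrightarrow> elts (pfst M) \<subseteq> elts (pfst N) \<and> embedding id M N"

definition strong_Fraisse_class :: "'u::set_universe set \<Rightarrow> 'u \<Rightarrow> 'u set \<Rightarrow> bool" where
  "strong_Fraisse_class V L K \<longleftrightarrow> class_of V K \<and> K \<subseteq> finite_structures V L \<and>
    (\<forall>M\<in>K. \<forall>N\<in>finite_structures V L. isomorphic M N \<longrightarrow> N \<in> K) \<and>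
    (\<forall>M\<in>K. \<forall>N\<in>finite_structures V L. substructure N M \<longrightarrow> N \<in> K) \<and>
    (\<forall>M1\<in>K. \<forall>M2\<in>K. \<exists>N\<in>K. (\<exists>j1. embedding j1 M1 N) \<and> (\<exists>j2. embedding j2 M2 N)) \<and>
    (\<forall>M0\<in>K. \<forall>M1\<in>K. \<forall>M2\<in>K. \<forall>i1 i2. embedding i1 M0 M1 \<and> embedding i2 M0 M2 \<longrightarrow>
      (\<exists>M3\<in>K. \<exists>j1 j2. embedding j1 M1 M3 \<and> embedding j2 M2 M3 \<and>
        (\<forall>x\<in>elts (pfst M0). j1 (i1 x) = j2 (i2 x)) \<and>
        j1 ` elts (pfst M1) \<inter> j2 ` elts (pfst M2) = j1 ` i1 ` elts (pfst M0)))"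

definition highly_homogeneous :: "'u::set_universe set \<Rightarrow> bool" where
  "highly_homogeneous K \<longleftrightarrow>
    (\<forall>M\<in>K. \<forall>N\<in>K. card (elts (pfst M)) = card (elts (pfst N)) \<longrightarrow> isomorphic M N)"

definition cohen_conditions :: "'u::set_universe set \<Rightarrow> 'u \<Rightarrow> 'u set" where
  "cohen_conditions K X = {A \<in> K. elts (pfst A) \<subseteq> elts X}"

definition cohen_le :: "'u::set_universe \<Rightarrow> 'u \<Rightarrow> bool" where
  "cohen_le A B \<longleftrightarrow> substructure B A"

definition union_structure :: "'u::set_universe set \<Rightarrow> 'u" where
  "union_structure G = opair (mk (\<Union>A\<in>G. elts (pfst A))) (mk (\<Union>A\<in>G. elts (psnd A)))"

definition cohen_generic :: "'u::set_universe set \<Rightarrow> 'u set \<Rightarrow> 'u \<Rightarrow> 'u \<Rightarrow> bool" where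
  "cohen_generic V K X M \<longleftrightarrow>
    (\<exists>G. generic_filter V (cohen_conditions K X) cohen_le G \<and> M = union_structure (elts G))"

end

theory Submission
  imports Defs
begin

text \<open>Since the class is not highly homogeneous, some atomic formula \<open>R\<close> holds of an injective tuple in one
  member \<open>A\<close> and fails for the corresponding tuple in another member \<open>B\<close>. Fix in \<open>V\<close> a sequence of
  pairwise disjoint tuples of \<open>X\<close>, and let \<open>E\<^sub>i\<close> be the event that \<open>R\<close> holds of the \<open>i\<close>-th tuple. Under an
  invariant measure these events are exchangeable, hence almost surely either all of them hold, or
  only finitely many of suitably long blocks \<open>[k, g k]\<close> consist of events that hold. So every
  set of positive measure contains, up to a null set, a further one of positive measure on which either
  all \<open>E\<^sub>i\<close> hold, or no block of some sequence of blocks in \<open>V\<close> holds entirely. By genericity a random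
  generic structure lies in such a set. A Cohen generic structure lies in none of them, because any
  condition can be extended, by strong amalgamation over the empty structure, by copies of \<open>A\<close> or \<open>B\<close>
  at tuples that it does not mention.

  The dense sets used must belong to \<open>V\<close>. This rests on recursion, collection and choice inside \<open>V\<close>, and
  on every measurable set having a code in a class of codes definable over \<open>V\<close>.\<close>

section \<open>Sets of the universe\<close>

text \<open>No representation theorem for exchangeable sequences is invoked. Invariance enters only
  through the fact that the measure of the intersection of a block depends on the length of the
  block alone. As blocks grow, this measure decreases to that of the event \<open>E\<close> that all
  \<open>E_i\<close> hold, and \<open>E\<close> is contained in the intersection of every block. So
  the excess of the block \<open>[k, g k]\<close> over \<open>E\<close> can be kept below
  \<open>1 / (j * 2 ^ k)\<close>, and a Borel-Cantelli sum leaves positive measure off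
  \<open>E\<close> where no block holds entirely. The bulk of the development is forced by
  genericity: a filter has to meet only those dense sets that are elements of \<open>V\<close>,
  whereas codes, measurable sets and real measures appear here as HOL objects outside
  \<open>V\<close>. Hence a calculus of operations definable over \<open>V\<close>, in which
  measures are compared through rational cuts and one code is chosen for each measurable
  set.\<close>

lemma elts_inject: "elts x = elts y \<longleftrightarrow> x = (y::'u::set_universe)"
proof
  assume e: "elts x = elts y"
  have "ax_extensionality mem (UNIV::'u set)" using zfc_mem[where 'a='u] by (simp add: ZFC_def)
  moreover have "\<forall>z. mem z x \<longleftrightarrow> mem z y" using e unfolding elts_def by blast
  ultimately show "x = y" unfolding ax_extensionality_def by blast
qed simp

lemma mk_elts [simp]: "mk (elts x) = x"
  unfolding mk_def by (simp add: elts_inject)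

lemma mem_elts: "mem x y \<longleftrightarrow> x \<in> elts y"
  by (simp add: elts_def)

section \<open>Definability over a transitive model\<close>

primrec rename :: "(nat \<Rightarrow> nat) \<Rightarrow> set_formula \<Rightarrow> set_formula" where
  "rename f (FMem i j) = FMem (f i) (f j)"
| "rename f (FEq i j) = FEq (f i) (f j)"
| "rename f (FNot \<phi>) = FNot (rename f \<phi>)"
| "rename f (FAnd \<phi> \<psi>) = FAnd (rename f \<phi>) (rename f \<psi>)"
| "rename f (FAll i \<phi>) = FAll (f i) (rename f \<phi>)"

text \<open>Bound variables are renamed along with free ones; injectivity of \<open>f\<close>
  prevents capture, since updating at \<open>f i\<close> then changes \<open>s \<circ> f\<close> at
  \<open>i\<close> only.\<close>

lemma fsat_rename:
  assumes "inj f"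
  shows "fsat E M s (rename f \<phi>) = fsat E M (s \<circ> f) \<phi>"
proof (induction \<phi> arbitrary: s)
  case (FAll i \<phi>)
  have "(s(f i := a)) \<circ> f = (s \<circ> f)(i := a)" for a
    using assms by (auto simp: fun_eq_iff inj_eq)
  then show ?case by (simp only: rename.simps fsat.simps FAll)
qed auto

text \<open>Even places carry the arguments, odd places the parameters. Parameter sequences of
  several formulas can thus be merged without counting free variables.\<close>

definition interleave :: "(nat \<Rightarrow> 'u) \<Rightarrow> (nat \<Rightarrow> 'u) \<Rightarrow> nat \<Rightarrow> 'u" where
  "interleave s c i = (if even i then s (i div 2) else c (i div 2))"

lemma interleave_simps [simp]:
  "interleave s c (2 * i) = s i"
  "interleave s c (Suc (2 * i)) = c i"
  by (simp_all add: interleave_def)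

lemma interleave_eqI:
  assumes "\<And>i. f (2 * i) = s i" "\<And>i. f (Suc (2 * i)) = c i"
  shows "f = interleave s c"
proof
  fix n show "f n = interleave s c n"
    using assms by (cases "even n") (auto elim!: evenE oddE)
qed

lemma inj_interleave:
  assumes "inj a" "inj b" "\<And>i j. a i \<noteq> b j" shows "inj (interleave a b)"
proof (rule injI)
  fix x y assume "interleave a b x = interleave a b y"
  then show "x = y"
    using assms(3) assms(3)[symmetric] injD[OF assms(1)] injD[OF assms(2)]
    by (cases "even x"; cases "even y") (fastforce elim!: evenE oddE)+
qed

definition swap01 :: "nat \<Rightarrow> nat" where
  "swap01 i = (if i = 0 then Suc 0 else if i = Suc 0 then 0 else i)"

definition rot012 :: "nat \<Rightarrow> nat" where
  "rot012 i = (if i = 0 then Suc 0 else if i = Suc 0 then 2 else if i = 2 then 0 else i)"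

text \<open>Frees index 1, which is needed when one more variable is bound between the element at
  index 0 and the remaining environment, as in \<open>T_mk\<close>.\<close>

definition skip1 :: "nat \<Rightarrow> nat" where
  "skip1 i = (if i = 0 then 0 else Suc i)"

lemma inj_reindex: "inj swap01" "inj rot012" "inj skip1"
  by (auto simp: inj_def swap01_def rot012_def skip1_def split: if_splits)

lemma reindex_simps [simp]:
  "swap01 0 = Suc 0" "swap01 (Suc 0) = 0" "swap01 (Suc (Suc i)) = Suc (Suc i)"
  "rot012 0 = Suc 0" "rot012 (Suc 0) = 2" "rot012 2 = 0" "rot012 (Suc (Suc 0)) = 0" "rot012 (Suc (Suc (Suc i))) = Suc (Suc (Suc i))"
  "skip1 0 = 0" "skip1 (Suc i) = Suc (Suc i)"
  by (auto simp: swap01_def rot012_def skip1_def)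

lemma inj_case_nat_Suc:
  assumes "inj g" shows "inj (\<lambda>i. case i of 0 \<Rightarrow> 0 | Suc i \<Rightarrow> Suc (g i))"
proof (rule injI)
  fix x y :: nat assume "(case x of 0 \<Rightarrow> 0 | Suc i \<Rightarrow> Suc (g i)) = (case y of 0 \<Rightarrow> 0 | Suc i \<Rightarrow> Suc (g i))"
  then show "x = y" using injD[OF assms] by (cases x; cases y) simp_all
qed

locale transitive_model =
  fixes V :: "'u::set_universe set"
  assumes model: "model_of_set_theory V"
begin

lemma trans: "x \<in> V \<Longrightarrow> y \<in> elts x \<Longrightarrow> y \<in> V"
  using model unfolding model_of_set_theory_def by blast

lemma zfc: "ZFC mem V"
  using model unfolding model_of_set_theory_def by blast

abbreviation env :: "(nat \<Rightarrow> 'u) \<Rightarrow> bool" where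
  "env s \<equiv> \<forall>i. s i \<in> V"

lemma env_case_nat: "a \<in> V \<Longrightarrow> env s \<Longrightarrow> env (case_nat a s)"
  by (auto split: nat.split)

text \<open>Predicates and operations are functions of an environment that assigns values to de Bruijn indices,
  so that the quantifier rules below can be applied by resolution; \<open>interleave\<close> adds infinitely many
  parameters.\<close>

definition definable :: "((nat \<Rightarrow> 'u) \<Rightarrow> bool) \<Rightarrow> bool" where
  "definable P \<longleftrightarrow> (\<exists>\<phi> c. env c \<and> (\<forall>s. env s \<longrightarrow> (P s \<longleftrightarrow> fsat mem V (interleave s c) \<phi>)))"

definition definable_op :: "((nat \<Rightarrow> 'u) \<Rightarrow> 'u) \<Rightarrow> bool" where
  "definable_op t \<longleftrightarrow> (\<forall>s. env s \<longrightarrow> t s \<in> V) \<and> definable (\<lambda>s. s 0 = t (\<lambda>i. s (Suc i)))"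

lemma D_cong: "(\<And>s. env s \<Longrightarrow> P s = Q s) \<Longrightarrow> definable P \<longleftrightarrow> definable Q"
  unfolding definable_def by simp

lemma nonempty: "\<exists>x. x \<in> V"
  using zfc unfolding ZFC_def ax_infinity_def by blast

lemma D_base:
  "definable (\<lambda>s. mem (s i) (s j))" "definable (\<lambda>s. s i = s j)"
proof -
  obtain c where c: "c \<in> V" using nonempty by blast
  show "definable (\<lambda>s. mem (s i) (s j))" unfolding definable_def
    by (rule exI[of _ "FMem (2*i) (2*j)"], rule exI[of _ "\<lambda>_. c"]) (simp add: c)
  show "definable (\<lambda>s. s i = s j)" unfolding definable_def
    by (rule exI[of _ "FEq (2*i) (2*j)"], rule exI[of _ "\<lambda>_. c"]) (simp add: c)
qed

lemma D_not: "definable P \<Longrightarrow> definable (\<lambda>s. \<not> P s)"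
  unfolding definable_def by (elim exE conjE, rule_tac x = "FNot \<phi>" in exI, rule_tac x = c in exI) simp

lemma env_interleave: "env s \<Longrightarrow> env c \<Longrightarrow> env (interleave s c)"
  by (simp add: interleave_def)

lemma D_conj:
  assumes "definable P" "definable Q" shows "definable (\<lambda>s. P s \<and> Q s)"
proof -
  obtain \<phi> c where P: "env c" "\<forall>s. env s \<longrightarrow> (P s \<longleftrightarrow> fsat mem V (interleave s c) \<phi>)"
    using assms unfolding definable_def by blast
  obtain \<psi> d where Q: "env d" "\<forall>s. env s \<longrightarrow> (Q s \<longleftrightarrow> fsat mem V (interleave s d) \<psi>)"
    using assms unfolding definable_def by blast
  \<comment> \<open>The merged sequence \<open>?e\<close> keeps the parameters of
    \<open>\<phi>\<close> at its even and those of \<open>\<psi>\<close> at its odd places;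
    \<open>f\<close> and \<open>g\<close> redirect each formula to its own half while the arguments
    stay where they are.\<close>
  define f g where "f = interleave (\<lambda>i. 2 * i) (\<lambda>i. Suc (2 * (2 * i)))"
    and "g = interleave (\<lambda>i. 2 * i) (\<lambda>i. Suc (2 * Suc (2 * i)))"
  have inj: "inj f" "inj g"
    unfolding f_def g_def by (rule inj_interleave; simp add: inj_def; presburger)+
  let ?e = "interleave c d"
  have f: "interleave s ?e \<circ> f = interleave s c" and g: "interleave s ?e \<circ> g = interleave s d" for s
    by (rule interleave_eqI; simp only: comp_apply f_def g_def interleave_simps)+
  show ?thesis unfolding definable_def
    by (rule exI[of _ "FAnd (rename f \<phi>) (rename g \<psi>)"], rule exI[of _ ?e])
      (simp add: fsat_rename inj f g P Q env_interleave)
qed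

lemma D_rename:
  assumes "definable P" "inj g" shows "definable (\<lambda>s. P (\<lambda>i. s (g i)))"
proof -
  obtain \<phi> c where P: "env c" "\<forall>s. env s \<longrightarrow> (P s \<longleftrightarrow> fsat mem V (interleave s c) \<phi>)"
    using assms unfolding definable_def by blast
  define f where "f = interleave (\<lambda>i. 2 * g i) (\<lambda>i. Suc (2 * i))"
  have inj: "inj f" using assms(2)
    unfolding f_def by (intro inj_interleave) (auto simp: inj_def double_not_eq_Suc_double)
  have f: "interleave s c \<circ> f = interleave (\<lambda>i. s (g i)) c" for s
    by (rule interleave_eqI; simp only: comp_apply f_def interleave_simps)+
  show ?thesis unfolding definable_def
    by (rule exI[of _ "rename f \<phi>"], rule exI[of _ c])
      (simp add: fsat_rename inj f P)
qed

lemma D_shift: "definable P \<Longrightarrow> definable (\<lambda>s. P (\<lambda>i. s (Suc i)))"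
  by (rule D_rename) auto

lemma D_all:
  assumes "definable (\<lambda>s. P (\<lambda>i. s (Suc i)) (s 0))" shows "definable (\<lambda>s. \<forall>a\<in>V. P s a)"
proof -
  obtain \<phi> c where P: "env c"
    "\<forall>s. env s \<longrightarrow> (P (\<lambda>i. s (Suc i)) (s 0) \<longleftrightarrow> fsat mem V (interleave s c) \<phi>)"
    using assms unfolding definable_def by blast
  \<comment> \<open>The quantified variable is placed at 1, the first parameter place;
    \<open>e\<close> vacates that place by shifting all parameters by one.\<close>
  define f where "f = interleave (case_nat 1 (\<lambda>i. 2 * i)) (\<lambda>i. Suc (2 * Suc i))"
  have inj: "inj f"
    unfolding f_def by (intro inj_interleave)
      (auto simp: inj_def split: nat.splits, presburger)
  define e where "e = case_nat (c 0) c"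
  have f: "(interleave s e)(Suc 0 := a) \<circ> f = interleave (case_nat a s) c" for s a
  proof (rule interleave_eqI)
    fix i show "((interleave s e)(Suc 0 := a) \<circ> f) (2 * i) = case_nat a s i"
      unfolding f_def comp_apply interleave_simps
      by (cases i) (simp_all del: mult_Suc_right add: interleave_def)
    show "((interleave s e)(Suc 0 := a) \<circ> f) (Suc (2 * i)) = c i"
      unfolding f_def comp_apply interleave_simps by (simp add: e_def del: mult_Suc_right)
  qed
  have e: "env e" using P(1) by (auto simp: e_def split: nat.split)
  have *: "P s a \<longleftrightarrow> fsat mem V (interleave (case_nat a s) c) \<phi>" if "env s" "a \<in> V" for s a
    using P(2)[rule_format, of "case_nat a s"] env_case_nat[OF that(2,1)] by simp
  have "fsat mem V (interleave s e) (FAll (Suc 0) (rename f \<phi>)) \<longleftrightarrow>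
      (\<forall>a\<in>V. fsat mem V (interleave (case_nat a s) c) \<phi>)" for s
    by (simp only: fsat.simps fsat_rename[OF inj] f)
  then show ?thesis unfolding definable_def using e * by blast
qed

lemma D_disj: assumes "definable P" "definable Q" shows "definable (\<lambda>s. P s \<or> Q s)"
  using D_not[OF D_conj[OF D_not[OF assms(1)] D_not[OF assms(2)]]] by simp

lemma D_imp: assumes "definable P" "definable Q" shows "definable (\<lambda>s. P s \<longrightarrow> Q s)"
  using D_disj[OF D_not[OF assms(1)] assms(2)] by (simp only: imp_conv_disj)

lemma D_iff: assumes "definable P" "definable Q" shows "definable (\<lambda>s. P s \<longleftrightarrow> Q s)"
  by (rule D_cong[THEN iffD1, OF _ D_conj[OF D_imp[OF assms] D_imp[OF assms(2,1)]]]) blast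

lemma D_ex:
  assumes "definable (\<lambda>s. P (\<lambda>i. s (Suc i)) (s 0))" shows "definable (\<lambda>s. \<exists>a\<in>V. P s a)"
  using D_not[OF D_all[of "\<lambda>s a. \<not> P s a"]] D_not[OF assms] by simp

lemma D_const: "definable (\<lambda>s. b)"
proof -
  have *: "definable (\<lambda>s. s 0 = s 0)" by (rule D_base)
  show ?thesis using * D_not[OF *] by (cases b) auto
qed

text \<open>The term is replaced by a variable quantified over \<open>V\<close> and tied to the term
  by its graph.\<close>

lemma D_subst:
  assumes "definable (\<lambda>s. P (\<lambda>i. s (Suc i)) (s 0))" "definable_op t"
  shows "definable (\<lambda>s. P s (t s))"
proof -
  have "definable (\<lambda>s. \<exists>a\<in>V. a = t s \<and> P s a)"
    using assms(2) unfolding definable_op_def by (intro D_ex D_conj assms) auto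
  then show ?thesis
    by (rule D_cong[THEN iffD1, rotated]) (use assms(2) in \<open>auto simp: definable_op_def\<close>)
qed

lemma T_var: "definable_op (\<lambda>s. s k)"
  unfolding definable_op_def by (auto intro: D_base)

lemma T_const: "c \<in> V \<Longrightarrow> definable_op (\<lambda>s. c)"
proof -
  assume c: "c \<in> V"
  have "definable (\<lambda>s. s 0 = c)" unfolding definable_def
    by (rule exI[of _ "FEq 0 1"], rule exI[of _ "\<lambda>_. c"]) (simp add: c interleave_def)
  then show ?thesis using c unfolding definable_op_def by auto
qed

lemma T_in: "definable_op t \<Longrightarrow> env s \<Longrightarrow> t s \<in> V"
  unfolding definable_op_def by auto

lemma T_graph: "definable_op t \<Longrightarrow> definable (\<lambda>s. s 0 = t (\<lambda>i. s (Suc i)))"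
  unfolding definable_op_def by auto

lemma T_rename:
  assumes "definable_op t" "inj g" shows "definable_op (\<lambda>s. t (\<lambda>i. s (g i)))"
proof -
  have "inj (\<lambda>i. case i of 0 \<Rightarrow> 0 | Suc i \<Rightarrow> Suc (g i))"
    by (rule inj_case_nat_Suc) (rule assms)
  from D_rename[OF T_graph[OF assms(1)] this]
  have "definable (\<lambda>s. s 0 = t (\<lambda>i. s (Suc (g i))))" by simp
  moreover have "t (\<lambda>i. s (g i)) \<in> V" if "env s" for s
    using T_in[OF assms(1), of "\<lambda>i. s (g i)"] that by simp
  ultimately show ?thesis unfolding definable_op_def by simp
qed

lemma T_shift: "definable_op t \<Longrightarrow> definable_op (\<lambda>s. t (\<lambda>i. s (Suc i)))"
  by (rule T_rename) auto

lemma T_subst: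
  assumes "definable_op (\<lambda>s. f (\<lambda>i. s (Suc i)) (s 0))" "definable_op t"
  shows "definable_op (\<lambda>s. f s (t s))"
proof -
  have 1: "f s (t s) \<in> V" if "env s" for s
    using T_in[OF assms(1) env_case_nat[OF T_in[OF assms(2) that] that]] by simp
  from D_rename[OF T_graph[OF assms(1)] inj_reindex(1)]
  have "definable (\<lambda>s. s (Suc 0) = f (\<lambda>i. s (Suc (Suc i))) (s 0))" by simp
  then have "definable (\<lambda>s. s 0 = f (\<lambda>i. s (Suc i)) (t (\<lambda>i. s (Suc i))))"
    by (rule D_subst[where P = "\<lambda>s a. s 0 = f (\<lambda>i. s (Suc i)) a", OF _ T_shift[OF assms(2)]])
  then show ?thesis using 1 unfolding definable_op_def by simp
qed

lemma D_op1: "definable (\<lambda>s. P (s 0)) \<Longrightarrow> definable_op t \<Longrightarrow> definable (\<lambda>s. P (t s))"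
  by (rule D_subst[where P = "\<lambda>s. P"])

lemma D_op2:
  assumes "definable (\<lambda>s. P (s 0) (s 1))" "definable_op t" "definable_op u" shows "definable (\<lambda>s. P (t s) (u s))"
proof -
  have *: "definable (\<lambda>s. P (s (Suc 0)) (s 0))"
    using D_rename[OF assms(1) inj_reindex(1)] by simp
  have "definable (\<lambda>s. P (s 0) (u (\<lambda>i. s (Suc i))))"
    by (rule D_subst[where P = "\<lambda>s. P (s 0)", OF _ T_shift[OF assms(3)]]) (rule *)
  then show ?thesis by (rule D_subst[where P = "\<lambda>s a. P a (u s)", OF _ assms(2)])
qed

lemma T_op1: "definable_op (\<lambda>s. f (s 0)) \<Longrightarrow> definable_op t \<Longrightarrow> definable_op (\<lambda>s. f (t s))"
  by (rule T_subst[where f = "\<lambda>s. f"])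

lemma T_op2:
  assumes "definable_op (\<lambda>s. f (s 0) (s 1))" "definable_op t" "definable_op u" shows "definable_op (\<lambda>s. f (t s) (u s))"
proof -
  have *: "definable_op (\<lambda>s. f (s (Suc 0)) (s 0))"
    using T_rename[OF assms(1) inj_reindex(1)] by simp
  have "definable_op (\<lambda>s. f (s 0) (u (\<lambda>i. s (Suc i))))"
    by (rule T_subst[where f = "\<lambda>s. f (s 0)", OF _ T_shift[OF assms(3)]]) (rule *)
  then show ?thesis by (rule T_subst[where f = "\<lambda>s a. f a (u s)", OF _ assms(2)])
qed

lemma T_op3:
  assumes "definable_op (\<lambda>s. f (s 0) (s 1) (s 2))" "definable_op t" "definable_op u" "definable_op v" shows "definable_op (\<lambda>s. f (t s) (u s) (v s))"
proof -
  have *: "definable_op (\<lambda>s. f (s (Suc 0)) (s 2) (s 0))"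
    using T_rename[OF assms(1) inj_reindex(2)] by simp
  have "definable_op (\<lambda>s. f (s 0) (s 1) (v (\<lambda>i. s (Suc (Suc i)))))"
    by (rule T_subst[where f = "\<lambda>s. f (s 0) (s 1)", OF _ T_shift[OF T_shift[OF assms(4)]]])
      (use * in \<open>simp add: numeral_2_eq_2\<close>)
  from T_rename[OF this inj_reindex(1)]
  have *: "definable_op (\<lambda>s. f (s (Suc 0)) (s 0) (v (\<lambda>i. s (Suc (Suc i)))))" by simp
  have "definable_op (\<lambda>s. f (s 0) (u (\<lambda>i. s (Suc i))) (v (\<lambda>i. s (Suc i))))"
    by (rule T_subst[where f = "\<lambda>s a. f (s 0) a (v (\<lambda>i. s (Suc i)))", OF _ T_shift[OF assms(3)]]) (rule *)
  then show ?thesis by (rule T_subst[where f = "\<lambda>s a. f a (u s) (v s)", OF _ assms(2)])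
qed

lemma D_mem: "definable_op t \<Longrightarrow> definable_op u \<Longrightarrow> definable (\<lambda>s. t s \<in> elts (u s))"
  using D_op2[of mem t u] D_base(1)[of 0 1] by (simp add: mem_elts)

lemma D_eq: "definable_op t \<Longrightarrow> definable_op u \<Longrightarrow> definable (\<lambda>s. t s = u s)"
  using D_op2[of "(=)" t u] D_base(2)[of 0 1] by simp

lemma D_ball:
  assumes "definable_op t" "definable (\<lambda>s. P (\<lambda>i. s (Suc i)) (s 0))"
  shows "definable (\<lambda>s. \<forall>a\<in>elts (t s). P s a)"
proof -
  have "definable (\<lambda>s. \<forall>a\<in>V. a \<in> elts (t s) \<longrightarrow> P s a)"
    by (intro D_all D_imp D_mem T_var T_shift assms)
  then show ?thesis
    by (rule D_cong[THEN iffD1, rotated]) (use trans T_in[OF assms(1)] in blast)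
qed

lemma D_bex:
  assumes "definable_op t" "definable (\<lambda>s. P (\<lambda>i. s (Suc i)) (s 0))"
  shows "definable (\<lambda>s. \<exists>a\<in>elts (t s). P s a)"
  using D_not[OF D_ball[OF assms(1), of "\<lambda>s a. \<not> P s a"]] D_not[OF assms(2)] by simp

lemma T_If: "definable P \<Longrightarrow> definable_op t \<Longrightarrow> definable_op u \<Longrightarrow> definable_op (\<lambda>s. if P s then t s else u s)"
proof -
  assume a: "definable P" "definable_op t" "definable_op u"
  have "definable (\<lambda>s. (P (\<lambda>i. s (Suc i)) \<and> s 0 = t (\<lambda>i. s (Suc i))) \<or> (\<not> P (\<lambda>i. s (Suc i)) \<and> s 0 = u (\<lambda>i. s (Suc i))))"
    by (intro D_disj D_conj D_not D_eq T_var T_shift D_shift a)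
  then have "definable (\<lambda>s. s 0 = (if P (\<lambda>i. s (Suc i)) then t (\<lambda>i. s (Suc i)) else u (\<lambda>i. s (Suc i))))"
    by (rule D_cong[THEN iffD1, rotated]) auto
  then show ?thesis using a unfolding definable_op_def by auto
qed

section \<open>Closure of \<open>V\<close> under separation, replacement, pairing, union and power
  set\<close>

definition inV :: "'u set \<Rightarrow> bool" where
  "inV S \<longleftrightarrow> (\<exists>x\<in>V. elts x = S)"

lemma inV_D: "inV S \<Longrightarrow> mk S \<in> V" "inV S \<Longrightarrow> elts (mk S) = S"
  unfolding inV_def by auto

lemma inV_elts [simp]: "x \<in> V \<Longrightarrow> inV (elts x)"
  unfolding inV_def by auto

text \<open>Once the extension is known to be in \<open>V\<close>, the graph of the comprehension
  term is the statement that precisely the \<open>z\<close> with \<open>P\<close> are elements;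
  transitivity of \<open>V\<close> makes quantification over \<open>V\<close> enough.\<close>

lemma T_mk:
  assumes "\<And>s. env s \<Longrightarrow> inV {z. P s z}" "definable (\<lambda>s. P (\<lambda>i. s (Suc i)) (s 0))"
  shows "definable_op (\<lambda>s. mk {z. P s z})"
proof -
  from D_rename[OF assms(2) inj_reindex(3)]
  have "definable (\<lambda>s. P (\<lambda>i. s (Suc (Suc i))) (s 0))" by simp
  then have "definable (\<lambda>s. \<forall>z\<in>V. z \<in> elts (s 0) \<longleftrightarrow> P (\<lambda>i. s (Suc i)) z)"
    by (intro D_all D_iff D_mem T_var)
  then have "definable (\<lambda>s. s 0 = mk {z. P (\<lambda>i. s (Suc i)) z})"
  proof (rule D_cong[THEN iffD1, rotated])
    fix s assume s: "env s"
    then have i: "inV {z. P (\<lambda>i. s (Suc i)) z}" by (intro assms) auto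
    have sub: "{z. P (\<lambda>i. s (Suc i)) z} \<subseteq> V"
      using i trans unfolding inV_def by auto
    have "(\<forall>z\<in>V. z \<in> elts (s 0) \<longleftrightarrow> P (\<lambda>i. s (Suc i)) z) \<longleftrightarrow> elts (s 0) = {z. P (\<lambda>i. s (Suc i)) z}"
      using sub s trans[of "s 0"] by blast
    also have "\<dots> \<longleftrightarrow> s 0 = mk {z. P (\<lambda>i. s (Suc i)) z}"
      using inV_D[OF i] by (metis elts_inject)
    finally show "(\<forall>z\<in>V. z \<in> elts (s 0) \<longleftrightarrow> P (\<lambda>i. s (Suc i)) z) = (s 0 = mk {z. P (\<lambda>i. s (Suc i)) z})" .
  qed
  then show ?thesis unfolding definable_op_def using inV_D(1)[OF assms(1)] by auto
qed

lemma inV_separation: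
  assumes "definable (\<lambda>s. P (\<lambda>i. s (Suc i)) (s 0))" "env s" "x \<in> V"
  shows "inV {z \<in> elts x. P s z}"
proof -
  obtain \<phi> c where P: "env c"
    "\<forall>s. env s \<longrightarrow> (P (\<lambda>i. s (Suc i)) (s 0) \<longleftrightarrow> fsat mem V (interleave s c) \<phi>)"
    using assms unfolding definable_def by blast
  \<comment> \<open>The separation schema reads the separated element at variable 0. The environment
    is shifted to make room for it; \<open>x\<close> is a placeholder that gets overwritten.\<close>
  let ?e = "interleave (case_nat x s) c"
  have e: "?e(0 := z) = interleave (case_nat z s) c" for z
    by (auto simp: fun_eq_iff interleave_def split: nat.splits)
  have "env ?e" by (intro env_interleave env_case_nat assms P)
  then obtain y where y: "y \<in> V" "\<forall>z\<in>V. mem z y \<longleftrightarrow> mem z x \<and> fsat mem V (?e(0 := z)) \<phi>"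
    using zfc assms(3) unfolding ZFC_def ax_separation_def by blast
  have "P s z \<longleftrightarrow> fsat mem V (?e(0 := z)) \<phi>" if "z \<in> V" for z
    using P(2)[rule_format, of "case_nat z s"] env_case_nat[OF that assms(2)] unfolding e by simp
  then have "elts y = {z \<in> elts x. P s z}"
    using y assms(3) trans unfolding mem_elts by blast
  then show ?thesis using y(1) unfolding inV_def by blast
qed

lemma inV_replacement:
  assumes "definable_op (\<lambda>s. f (\<lambda>i. s (Suc i)) (s 0))" "env s" "x \<in> V"
  shows "inV (f s ` elts x)"
proof -
  obtain \<phi> c where P: "env c"
    "\<forall>s. env s \<longrightarrow> (s 0 = f (\<lambda>i. s (Suc (Suc i))) (s 1) \<longleftrightarrow> fsat mem V (interleave s c) \<phi>)"
    using T_graph[OF assms(1)] unfolding definable_def by auto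
  \<comment> \<open>The replacement schema wants the argument at 0 and the value at 1, while the
    graph formula has the value at place 0 and the argument at place 2. Everything else moves up by
    one.\<close>
  define g :: "nat \<Rightarrow> nat" where "g k = (if k = 0 then 1 else if k = 2 then 0 else Suc k)" for k
  have inj: "inj g" by (auto simp: inj_def g_def split: if_splits)
  define s' where "s' k = interleave (case_nat x (case_nat x s)) c (k - 1)" for k
  have e: "s'(0 := a, 1 := b) \<circ> g = interleave (case_nat b (case_nat a s)) c" for a b
  proof
    fix k show "(s'(0 := a, 1 := b) \<circ> g) k = interleave (case_nat b (case_nat a s)) c k"
    proof (cases "k = 0 \<or> k = 2")
      case False
      then have "even k \<Longrightarrow> \<exists>j. k div 2 = Suc (Suc j)" by presburger
      then show ?thesis using False by (auto simp: g_def s'_def interleave_def)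
    qed (auto simp: g_def interleave_def)
  qed
  have fV: "f s a \<in> V" if "a \<in> V" for a
    using T_in[OF assms(1) env_case_nat[OF that assms(2)]] by simp
  have P2: "b = f s a \<longleftrightarrow> fsat mem V (s'(0 := a, 1 := b)) (rename g \<phi>)" if "a \<in> V" "b \<in> V" for a b
    using P(2)[rule_format, of "case_nat b (case_nat a s)"] env_case_nat[OF that(2) env_case_nat[OF that(1) assms(2)]]
    by (simp only: fsat_rename inj e) simp
  have "env (interleave (case_nat x (case_nat x s)) c)"
    by (intro env_interleave env_case_nat assms P)
  then have "env s'" unfolding s'_def by blast
  moreover have "\<forall>a\<in>V. mem a x \<longrightarrow> (\<exists>!b. b \<in> V \<and> fsat mem V (s'(0 := a, 1 := b)) (rename g \<phi>))"
    using P2 fV by metis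
  ultimately obtain y where y: "y \<in> V"
    "\<forall>b\<in>V. mem b y \<longleftrightarrow> (\<exists>a\<in>V. mem a x \<and> fsat mem V (s'(0 := a, 1 := b)) (rename g \<phi>))"
    using zfc assms(3) unfolding ZFC_def ax_replacement_def by blast
  have "elts y = f s ` elts x"
    using y assms(3) trans P2 fV unfolding mem_elts by blast
  then show ?thesis using y(1) unfolding inV_def by blast
qed

lemma T_separation:
  assumes "definable_op a" "definable (\<lambda>s. P (\<lambda>i. s (Suc i)) (s 0))"
  shows "definable_op (\<lambda>s. mk {z \<in> elts (a s). P s z})"
proof (rule T_mk)
  show "inV {z. z \<in> elts (a s) \<and> P s z}" if "env s" for s
    by (rule inV_separation) (use that assms T_in in auto)
qed (intro D_conj D_mem T_var T_shift assms)

lemma T_replacement: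
  assumes "definable_op a" "definable_op (\<lambda>s. f (\<lambda>i. s (Suc i)) (s 0))"
  shows "definable_op (\<lambda>s. mk (f s ` elts (a s)))"
proof -
  have "definable_op (\<lambda>s. mk {z. z \<in> f s ` elts (a s)})"
  proof (rule T_mk)
    show "inV {z. z \<in> f s ` elts (a s)}" if "env s" for s
      using inV_replacement[OF assms(2) that T_in[OF assms(1) that]] by simp
    from T_rename[OF assms(2) inj_reindex(3)]
    have "definable (\<lambda>s. \<exists>x\<in>elts (a (\<lambda>i. s (Suc i))). s 0 = f (\<lambda>i. s (Suc i)) x)"
      by (intro D_bex D_eq T_var T_shift assms) simp
    then show "definable (\<lambda>s. s 0 \<in> f (\<lambda>i. s (Suc i)) ` elts (a (\<lambda>i. s (Suc i))))"
      by (simp add: image_iff)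
  qed
  then show ?thesis by simp
qed

lemma inV_pair: assumes "x \<in> V" "y \<in> V" shows "inV {x, y}"
proof -
  have "ax_pairing mem V" using zfc by (simp add: ZFC_def)
  then obtain p where "p \<in> V" "\<forall>z\<in>V. mem z p \<longleftrightarrow> z = x \<or> z = y"
    using assms unfolding ax_pairing_def by blast
  then have "elts p = {x, y}" using trans assms unfolding mem_elts by blast
  then show ?thesis using \<open>p \<in> V\<close> unfolding inV_def by blast
qed

lemma inV_Union: assumes "x \<in> V" shows "inV (\<Union>y\<in>elts x. elts y)"
proof -
  have "ax_union mem V" using zfc by (simp add: ZFC_def)
  then obtain p where "p \<in> V" "\<forall>z\<in>V. mem z p \<longleftrightarrow> (\<exists>y\<in>V. mem y x \<and> mem z y)"
    using assms unfolding ax_union_def by blast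
  then have "elts p = (\<Union>y\<in>elts x. elts y)" using trans assms unfolding mem_elts by blast
  then show ?thesis using \<open>p \<in> V\<close> unfolding inV_def by blast
qed

lemma inV_Pow: assumes "x \<in> V" shows "inV {y \<in> V. elts y \<subseteq> elts x}"
proof -
  have "ax_power_set mem V" using zfc by (simp add: ZFC_def)
  then obtain p where "p \<in> V" "\<forall>z\<in>V. mem z p \<longleftrightarrow> (\<forall>w\<in>V. mem w z \<longrightarrow> mem w x)"
    using assms unfolding ax_power_set_def by blast
  then have "elts p = {y \<in> V. elts y \<subseteq> elts x}" using trans assms unfolding mem_elts by blast
  then show ?thesis using \<open>p \<in> V\<close> unfolding inV_def by blast
qed

lemma inV_empty: "inV {}"
proof -
  obtain x where "x \<in> V" using nonempty by blast
  have "inV {z \<in> elts x. False}"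
    by (rule inV_separation[of "\<lambda>s z. False" "\<lambda>_. x"]) (auto intro: D_const \<open>x \<in> V\<close>)
  then show ?thesis by simp
qed

lemma inV_insert: assumes "x \<in> V" "inV S" shows "inV (insert x S)"
proof -
  obtain y where y: "y \<in> V" "elts y = S" using assms unfolding inV_def by blast
  obtain z where z: "z \<in> V" "elts z = {x, x}" using inV_pair[of x x] assms unfolding inV_def by blast
  obtain w where w: "w \<in> V" "elts w = {z, y}" using inV_pair[of z y] y z unfolding inV_def by blast
  have "inV (\<Union>y\<in>elts w. elts y)" by (rule inV_Union) (rule w)
  then show ?thesis using y z w by simp
qed

lemma inV_finite: "finite S \<Longrightarrow> S \<subseteq> V \<Longrightarrow> inV S"
  by (induction S rule: finite_induct) (auto intro: inV_empty inV_insert)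

end

text \<open>The universe is a model of itself, so every closure fact proved for \<open>V\<close>
  also shows that \<open>mk\<close> behaves well on sets that are not in \<open>V\<close>.\<close>

lemma model_UNIV: "transitive_model (UNIV :: 'u::set_universe set)"
  by unfold_locales (simp add: model_of_set_theory_def zfc_mem)

lemma elts_mk_finite: "finite S \<Longrightarrow> elts (mk S) = S"
  using transitive_model.inV_D(2)[OF model_UNIV transitive_model.inV_finite[OF model_UNIV]] by blast

named_theorems defin

context transitive_model
begin

lemmas [defin] = D_all D_ex D_ball D_bex D_conj D_disj D_imp D_iff D_not D_mem D_eq T_var

text \<open>Definition by unique existence. For partial operations \<open>Q\<close> carries an extra
  clause that fixes a default value, so that the term is total.\<close>

lemma T_the:
  assumes "\<And>s. env s \<Longrightarrow> t s \<in> V"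
    and "\<And>s a. env s \<Longrightarrow> a \<in> V \<Longrightarrow> Q s a \<longleftrightarrow> a = t s"
    and "definable (\<lambda>s. Q (\<lambda>i. s (Suc i)) (s 0))"
  shows "definable_op t"
proof -
  have "definable (\<lambda>s. s 0 = t (\<lambda>i. s (Suc i)))"
  proof (rule D_cong[THEN iffD1, OF _ assms(3)])
    show "Q (\<lambda>i. s (Suc i)) (s 0) \<longleftrightarrow> s 0 = t (\<lambda>i. s (Suc i))" if "env s" for s
      using assms(2)[of "\<lambda>i. s (Suc i)" "s 0"] that by simp
  qed
  then show ?thesis unfolding definable_op_def using assms(1) by simp
qed

lemma T_cong: assumes "\<And>s. env s \<Longrightarrow> t s = u s" shows "definable_op t \<longleftrightarrow> definable_op u"
proof -
  have "definable (\<lambda>s. s 0 = t (\<lambda>i. s (Suc i))) \<longleftrightarrow> definable (\<lambda>s. s 0 = u (\<lambda>i. s (Suc i)))"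
    by (rule D_cong) (simp add: assms)
  then show ?thesis unfolding definable_op_def using assms by simp
qed

lemma D_subset: "definable_op t \<Longrightarrow> definable_op u \<Longrightarrow> definable (\<lambda>s. elts (t s) \<subseteq> elts (u s))"
  unfolding subset_iff Ball_def[symmetric]
  by (intro defin T_shift)

end

lemma pair_Collect: "{x, y} = {z. z = x \<or> z = y}"
  by auto

section \<open>Set operations\<close>

definition upair :: "'u::set_universe \<Rightarrow> 'u \<Rightarrow> 'u" where "upair x y = mk {x, y}"

definition union2 :: "'u::set_universe \<Rightarrow> 'u \<Rightarrow> 'u" where "union2 x y = mk (elts x \<union> elts y)"

definition diff2 :: "'u::set_universe \<Rightarrow> 'u \<Rightarrow> 'u" where "diff2 x y = mk (elts x - elts y)"

definition Union1 :: "'u::set_universe \<Rightarrow> 'u" where "Union1 x = mk (\<Union>y\<in>elts x. elts y)"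

definition succ :: "'u::set_universe \<Rightarrow> 'u" where "succ x = mk (insert x (elts x))"

lemma (in transitive_model)
  assumes "x \<in> V" "y \<in> V"
  shows inV_union2: "inV (elts x \<union> elts y)" and inV_diff2: "inV (elts x - elts y)"
proof -
  have "inV (\<Union>z\<in>elts (mk {x, y}). elts z)"
    by (rule inV_Union) (use inV_pair[OF assms] inV_D in blast)
  then show "inV (elts x \<union> elts y)" using inV_D(2)[OF inV_pair[OF assms]] by simp
  have "inV {z \<in> elts x. z \<notin> elts y}"
    using inV_separation[of "\<lambda>s z. z \<notin> elts (s 0)" "\<lambda>_. y" x, OF D_not[OF D_mem[OF T_var T_var]]] assms
    by simp
  then show "inV (elts x - elts y)" by (simp add: set_diff_eq)
qed

lemma elts_ops [simp]:
  "elts (upair x y) = {x, y}" "elts (union2 x y) = elts x \<union> elts y"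
  "elts (diff2 x y) = elts x - elts y" "elts (Union1 x) = (\<Union>y\<in>elts x. elts y)"
  "elts (succ x) = insert x (elts x)"
proof -
  interpret U: transitive_model "UNIV :: 'u::set_universe set" by (rule model_UNIV)
  show "elts (upair x y) = {x, y}" "elts (union2 x y) = elts x \<union> elts y"
  "elts (diff2 x y) = elts x - elts y" "elts (Union1 x) = (\<Union>y\<in>elts x. elts y)"
  "elts (succ x) = insert x (elts x)"
    unfolding upair_def union2_def diff2_def Union1_def succ_def
    by (intro U.inV_D U.inV_pair U.inV_union2 U.inV_diff2 U.inV_Union U.inV_insert U.inV_elts UNIV_I)+
qed

lemma elts_empty [simp]: "elts (mk {}) = {}"
  by (rule elts_mk_finite) simp

lemma elts_sing [simp]: "elts (mk {x}) = {x}"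
  by (rule elts_mk_finite) simp

lemma elts_pair [simp]: "elts (mk {x, y}) = {x, y}"
  by (rule elts_mk_finite) simp

lemma mk_inject_finite: "finite A \<Longrightarrow> finite B \<Longrightarrow> mk A = mk B \<longleftrightarrow> A = B"
  by (metis elts_mk_finite)

lemma opair_inject [simp]: "opair x y = opair x' y' \<longleftrightarrow> x = x' \<and> y = y'"
  by (auto simp: opair_def mk_inject_finite doubleton_eq_iff)

lemma elts_opair: "elts (opair x y) = {mk {x}, mk {x, y}}"
  by (simp add: opair_def)

lemma opair_nonempty [simp]: "opair x y \<noteq> mk {}" "mk {} \<noteq> opair x y"
  by (auto simp: opair_def mk_inject_finite)

lemma pfst_opair [simp]: "pfst (opair x y) = x" and psnd_opair [simp]: "psnd (opair x y) = y"
  by (auto simp: pfst_def psnd_def)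

declare num.simps(2) [simp del]

lemma num_Suc: "num (Suc n) = succ (num n)"
  by (simp add: succ_def num.simps(2))

lemma elts_num: "elts (num n) = num ` {..<n}"
  by (induction n) (auto simp: num_Suc lessThan_Suc)

lemma wf_tc: "wf ({(x, y). mem x (y::'u::set_universe)}\<^sup>+)"
  by (rule wf_trancl) (rule wf_mem)

lemma mem_irrefl [simp]: "x \<notin> elts x"
  using wf_mem by (auto simp: elts_def elim: wf_irrefl)

lemma num_inject [simp]: "num m = (num n :: 'u::set_universe) \<longleftrightarrow> m = n"
proof -
  have "num m \<noteq> (num n :: 'u)" if "m < n" for m n
  proof
    assume "num m = (num n :: 'u)"
    then have "num m \<in> elts (num m :: 'u)" using elts_num[of n, where 'a='u] that by (metis imageI lessThan_iff)
    then show False by simp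
  qed
  then show ?thesis by (metis linorder_neqE_nat)
qed

lemma num_mem_num [simp]: "num m \<in> elts (num n) \<longleftrightarrow> m < n"
  by (auto simp: elts_num)

lemma Union1_num [simp]: "Union1 (num (Suc n)) = num n"
proof (subst elts_inject[symmetric], intro set_eqI iffI)
  fix x :: 'a assume "x \<in> elts (num n)"
  then show "x \<in> elts (Union1 (num (Suc n)))" by (auto simp: elts_num)
qed (auto simp: elts_num intro: less_trans)

lemma tup_inject [simp]: "tup xs = tup ys \<longleftrightarrow> xs = ys"
proof (induction xs arbitrary: ys)
  case Nil then show ?case by (cases ys) auto
next
  case (Cons x xs) then show ?case by (cases ys) auto
qed

definition tc :: "'u::set_universe \<Rightarrow> 'u set" where
  "tc x = {y. (y, x) \<in> {(x, y). mem x y}\<^sup>+}"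

lemma tc_unfold: "tc x = elts x \<union> (\<Union>y\<in>elts x. tc y)"
  unfolding tc_def elts_def by (auto elim: tranclE intro: trancl_into_trancl)

lemma tc_trans: "y \<in> tc x \<Longrightarrow> z \<in> tc y \<Longrightarrow> z \<in> tc x"
  unfolding tc_def by auto

lemma elts_tc: "y \<in> elts x \<Longrightarrow> y \<in> tc x"
  by (subst tc_unfold) auto

lemma tc_induct [case_names tc]:
  assumes "\<And>x. (\<And>y. y \<in> tc x \<Longrightarrow> P y) \<Longrightarrow> P x" shows "P x"
  using wf_tc by (rule wf_induct_rule) (rule assms, simp add: tc_def)

lemma mem_induct [case_names mem]:
  assumes "\<And>x. (\<And>y. y \<in> elts x \<Longrightarrow> P y) \<Longrightarrow> P x" shows "P x"
  using wf_mem by (rule wf_induct_rule) (rule assms, simp add: elts_def)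

lemma tc_opair: "x \<in> tc (opair x y)" "y \<in> tc (opair x y)"
proof -
  have "mk {x, y} \<in> tc (opair x y)" by (rule elts_tc) (simp add: elts_opair)
  moreover have "x \<in> tc (mk {x, y})" "y \<in> tc (mk {x, y})" by (rule elts_tc; simp)+
  ultimately show "x \<in> tc (opair x y)" "y \<in> tc (opair x y)" using tc_trans by blast+
qed

text \<open>Total versions of the projections and of application, with value \<open>0\<close> where the originals are
  underspecified.\<close>

definition fst0 :: "'u::set_universe \<Rightarrow> 'u" where
  "fst0 p = (if \<exists>x y. p = opair x y then pfst p else num 0)"

definition snd0 :: "'u::set_universe \<Rightarrow> 'u" where
  "snd0 p = (if \<exists>x y. p = opair x y then psnd p else num 0)"

definition app0 :: "'u::set_universe \<Rightarrow> 'u \<Rightarrow> 'u" where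
  "app0 f x = (if \<exists>!y. opair x y \<in> elts f then app f x else num 0)"

lemma fst0_opair [simp]: "fst0 (opair x y) = x" and snd0_opair [simp]: "snd0 (opair x y) = y"
  by (auto simp: fst0_def snd0_def)

lemma app0_eq: "opair x y \<in> elts f \<Longrightarrow> (\<And>z. opair x z \<in> elts f \<Longrightarrow> z = y) \<Longrightarrow> app0 f x = y"
  unfolding app0_def app_def by (subst if_P) (blast, rule the_equality, blast+)

lemma app_app0: "is_function f A \<Longrightarrow> x \<in> elts A \<Longrightarrow> app f x = app0 f x"
  unfolding is_function_def app0_def by auto

lemma is_function_app:
  assumes "is_function f A" "x \<in> elts A" shows "opair x y \<in> elts f \<longleftrightarrow> y = app f x"
proof -
  have "\<exists>!y. opair x y \<in> elts f" using assms by (simp add: is_function_def)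
  then obtain z where z: "opair x z \<in> elts f" "\<And>y. opair x y \<in> elts f \<Longrightarrow> y = z" by blast
  then have "app f x = z" unfolding app_def by (rule the_equality)
  then show ?thesis using z by blast
qed

lemma elts_function: "is_function f A \<Longrightarrow> elts f = (\<lambda>x. opair x (app f x)) ` elts A"
proof -
  assume f: "is_function f A"
  have "elts f \<subseteq> {opair x y | x y. x \<in> elts A}" using f by (simp add: is_function_def)
  then show ?thesis using is_function_app[OF f] by auto
qed

definition lam :: "'u::set_universe \<Rightarrow> ('u \<Rightarrow> 'u) \<Rightarrow> 'u" where
  "lam a f = mk ((\<lambda>x. opair x (f x)) ` elts a)"

context transitive_model
begin

lemma opair_mem_D: assumes "opair x y \<in> V" shows "x \<in> V" "y \<in> V"
proof -
  have "mk {x, y} \<in> V" using assms trans[of "opair x y" "mk {x, y}"] by (simp add: elts_opair)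
  then show "x \<in> V" "y \<in> V" using trans[of "mk {x, y}"] by simp_all
qed

lemma T_upair [defin]: "definable_op t \<Longrightarrow> definable_op u \<Longrightarrow> definable_op (\<lambda>s. upair (t s) (u s))"
proof (rule T_op2[where f = upair])
  have "definable_op (\<lambda>s. mk {z. z = s 0 \<or> z = s 1})"
  proof (rule T_mk)
    show "inV {z. z = s 0 \<or> z = s 1}" if "env s" for s
      using inV_pair[of "s 0" "s 1"] that by (simp add: pair_Collect)
  qed (intro defin)
  then show "definable_op (\<lambda>s. upair (s 0) (s 1))" by (simp add: upair_def pair_Collect)
qed

lemma T_opair [defin]: "definable_op t \<Longrightarrow> definable_op u \<Longrightarrow> definable_op (\<lambda>s. opair (t s) (u s))"
proof (rule T_op2[where f = opair])
  have "definable_op (\<lambda>s. upair (upair (s 0) (s 0)) (upair (s 0) (s 1)))" by (intro defin)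
  then show "definable_op (\<lambda>s. opair (s 0) (s 1))" by (simp add: upair_def opair_def)
qed

lemma opair_V [simp]: "opair x y \<in> V \<longleftrightarrow> x \<in> V \<and> y \<in> V"
proof
  show "x \<in> V \<and> y \<in> V" if "opair x y \<in> V" using opair_mem_D[OF that] by simp
  show "opair x y \<in> V" if "x \<in> V \<and> y \<in> V"
    using T_in[OF T_opair[OF T_const T_const], of x y "\<lambda>_. x"] that by simp
qed

lemma T_union2 [defin]: "definable_op t \<Longrightarrow> definable_op u \<Longrightarrow> definable_op (\<lambda>s. union2 (t s) (u s))"
proof (rule T_op2[where f = union2])
  have "definable_op (\<lambda>s. mk {z. z \<in> elts (s 0) \<or> z \<in> elts (s 1)})"
  proof (rule T_mk)
    show "inV {z. z \<in> elts (s 0) \<or> z \<in> elts (s 1)}" if "env s" for s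
      using inV_union2[of "s 0" "s 1"] that by (simp add: Un_def)
  qed (intro defin)
  then show "definable_op (\<lambda>s. union2 (s 0) (s 1))" by (simp add: union2_def Un_def)
qed

lemma T_diff2 [defin]: "definable_op t \<Longrightarrow> definable_op u \<Longrightarrow> definable_op (\<lambda>s. diff2 (t s) (u s))"
proof (rule T_op2[where f = diff2])
  have "definable_op (\<lambda>s. mk {z. z \<in> elts (s 0) \<and> z \<notin> elts (s 1)})"
  proof (rule T_mk)
    show "inV {z. z \<in> elts (s 0) \<and> z \<notin> elts (s 1)}" if "env s" for s
      using inV_diff2[of "s 0" "s 1"] that by (simp add: set_diff_eq)
  qed (intro defin)
  then show "definable_op (\<lambda>s. diff2 (s 0) (s 1))" by (simp add: diff2_def set_diff_eq)
qed

lemma T_Union1 [defin]: "definable_op t \<Longrightarrow> definable_op (\<lambda>s. Union1 (t s))"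
proof (rule T_op1[where f = Union1])
  have "definable_op (\<lambda>s. mk {z. \<exists>y\<in>elts (s 0). z \<in> elts y})"
  proof (rule T_mk)
    show "inV {z. \<exists>y\<in>elts (s 0). z \<in> elts y}" if "env s" for s
      using inV_Union[of "s 0"] that by (simp add: UNION_eq)
  qed (intro defin)
  then show "definable_op (\<lambda>s. Union1 (s 0))" by (simp add: Union1_def UNION_eq)
qed

lemma T_succ [defin]: "definable_op t \<Longrightarrow> definable_op (\<lambda>s. succ (t s))"
proof -
  have "succ x = union2 x (upair x x)" for x :: 'u by (simp add: elts_inject[symmetric])
  then show "definable_op t \<Longrightarrow> ?thesis" by (simp only:) (intro defin)
qed

lemma T_mk_empty [defin]: "definable_op (\<lambda>s. mk {})"
  by (rule T_const) (rule inV_D(1)[OF inV_empty])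

lemma mk_empty_V [simp]: "mk {} \<in> V"
  by (rule inV_D(1)[OF inV_empty])

lemma num_V [simp]: "num n \<in> V"
  by (induction n) (simp_all add: num.simps(2) inV_D(1)[OF inV_insert])

lemma T_num [defin]: "definable_op (\<lambda>s. num n)"
  by (rule T_const) simp

lemma T_fst0 [defin]: "definable_op t \<Longrightarrow> definable_op (\<lambda>s. fst0 (t s))"
proof (rule T_op1[where f = fst0],
    rule T_the[where Q = "\<lambda>s a. (\<exists>y\<in>V. s 0 = opair a y) \<or> (\<not> (\<exists>x\<in>V. \<exists>y\<in>V. s 0 = opair x y) \<and> a = num 0)"])
  fix s a assume s: "env s" "a \<in> V"
  show "((\<exists>y\<in>V. s 0 = opair a y) \<or> (\<not> (\<exists>x\<in>V. \<exists>y\<in>V. s 0 = opair x y) \<and> a = num 0)) = (a = fst0 (s 0))"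
    using s(1)[rule_format, of 0] unfolding fst0_def by (cases "\<exists>x y. s 0 = opair x y") auto
qed (metis fst0_def opair_V num_V pfst_opair, intro defin, assumption)

lemma T_snd0 [defin]: "definable_op t \<Longrightarrow> definable_op (\<lambda>s. snd0 (t s))"
proof (rule T_op1[where f = snd0],
    rule T_the[where Q = "\<lambda>s a. (\<exists>x\<in>V. s 0 = opair x a) \<or> (\<not> (\<exists>x\<in>V. \<exists>y\<in>V. s 0 = opair x y) \<and> a = num 0)"])
  fix s a assume s: "env s" "a \<in> V"
  show "((\<exists>x\<in>V. s 0 = opair x a) \<or> (\<not> (\<exists>x\<in>V. \<exists>y\<in>V. s 0 = opair x y) \<and> a = num 0)) = (a = snd0 (s 0))"
    using s(1)[rule_format, of 0] unfolding snd0_def by (cases "\<exists>x y. s 0 = opair x y") auto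
qed (metis snd0_def opair_V num_V psnd_opair, intro defin, assumption)

lemma T_app0 [defin]: "definable_op t \<Longrightarrow> definable_op u \<Longrightarrow> definable_op (\<lambda>s. app0 (t s) (u s))"
proof (rule T_op2[where f = app0], rule T_the[where Q = "\<lambda>s a.
    (opair (s 1) a \<in> elts (s 0) \<and> (\<forall>z\<in>V. opair (s 1) z \<in> elts (s 0) \<longrightarrow> z = a)) \<or>
    (\<not> (\<exists>y\<in>V. opair (s 1) y \<in> elts (s 0) \<and> (\<forall>z\<in>V. opair (s 1) z \<in> elts (s 0) \<longrightarrow> z = y)) \<and> a = num 0)"])
  let ?Q = "\<lambda>f x a. opair x a \<in> elts f \<and> (\<forall>z\<in>V. opair x z \<in> elts f \<longrightarrow> z = a)"
  fix s assume s: "env s"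
  have V: "opair x y \<in> elts (s 0) \<Longrightarrow> x \<in> V \<and> y \<in> V" for x y
    using trans[of "s 0" "opair x y"] s by simp
  show "app0 (s 0) (s 1) \<in> V"
  proof (cases "\<exists>!y. opair (s 1) y \<in> elts (s 0)")
    case True
    then obtain y where y: "opair (s 1) y \<in> elts (s 0)" "\<And>z. opair (s 1) z \<in> elts (s 0) \<Longrightarrow> z = y" by blast
    from app0_eq[OF y] V[OF y(1)] show ?thesis by simp
  qed (simp add: app0_def)
  fix a assume "a \<in> V"
  show "?Q (s 0) (s 1) a \<or> (\<not> (\<exists>y\<in>V. ?Q (s 0) (s 1) y) \<and> a = num 0) \<longleftrightarrow> a = app0 (s 0) (s 1)"
  proof (cases "\<exists>!y. opair (s 1) y \<in> elts (s 0)")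
    case True
    then obtain y where y: "opair (s 1) y \<in> elts (s 0)" "\<And>z. opair (s 1) z \<in> elts (s 0) \<Longrightarrow> z = y" by blast
    from app0_eq[OF this] show ?thesis using y V by metis
  next
    case False
    then have "\<not> ?Q (s 0) (s 1) y" for y using V by blast
    then show ?thesis using False by (auto simp: app0_def)
  qed
qed (intro defin, assumption+)

lemma inV_image: "definable_op (\<lambda>s. f (s 0)) \<Longrightarrow> a \<in> V \<Longrightarrow> inV (f ` elts a)"
  by (rule inV_replacement[of "\<lambda>_. f" "\<lambda>_. a"]) auto

lemma inV_sep: "definable (\<lambda>s. P (s 0)) \<Longrightarrow> a \<in> V \<Longrightarrow> inV {z \<in> elts a. P z}"
  by (rule inV_separation[of "\<lambda>_. P" "\<lambda>_. a"]) auto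

lemma T_Image [defin]:
  "definable_op a \<Longrightarrow> definable_op (\<lambda>s. f (\<lambda>i. s (Suc i)) (s 0)) \<Longrightarrow> definable_op (\<lambda>s. mk ((\<lambda>z. f s z) ` elts (a s)))"
  by (rule T_replacement)

lemma T_Sep [defin]:
  "definable_op a \<Longrightarrow> definable (\<lambda>s. P (\<lambda>i. s (Suc i)) (s 0)) \<Longrightarrow> definable_op (\<lambda>s. mk {z \<in> elts (a s). P s z})"
  by (rule T_separation)

lemmas [defin] = T_If D_subset

lemma lam:
  assumes "definable_op (\<lambda>s. f (s 0))" "a \<in> V"
  shows "lam a f \<in> V" "elts (lam a f) = (\<lambda>x. opair x (f x)) ` elts a" "is_function (lam a f) a"
    "x \<in> elts a \<Longrightarrow> app (lam a f) x = f x" "x \<in> elts a \<Longrightarrow> app0 (lam a f) x = f x"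
proof -
  have *: "inV ((\<lambda>x. opair x (f x)) ` elts a)"
    by (rule inV_image) (intro defin assms)+
  show "lam a f \<in> V" and e: "elts (lam a f) = (\<lambda>x. opair x (f x)) ` elts a"
    unfolding lam_def using inV_D[OF *] by auto
  show f: "is_function (lam a f) a" unfolding is_function_def e by auto
  assume "x \<in> elts a"
  then show "app (lam a f) x = f x" "app0 (lam a f) x = f x"
    using is_function_app[OF f, of x "f x"] app_app0[OF f] e by auto
qed

end

section \<open>Transitive closures and recursion in a model\<close>

context transitive_model
begin

text \<open>First-order description of the transitive closure: the least transitive set including
  \<open>x\<close>, where minimality is tested against elements of \<open>V\<close> only.\<close>

definition tc_in :: "'u \<Rightarrow> 'u \<Rightarrow> bool" where
  "tc_in x a \<longleftrightarrow> elts x \<subseteq> elts a \<and> (\<forall>y\<in>elts a. elts y \<subseteq> elts a) \<and>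
     (\<forall>t\<in>V. elts x \<subseteq> elts t \<and> (\<forall>y\<in>elts t. elts y \<subseteq> elts t) \<longrightarrow> elts a \<subseteq> elts t)"

lemma tc_subset: assumes "elts x \<subseteq> elts t" "\<And>y. y \<in> elts t \<Longrightarrow> elts y \<subseteq> elts t" shows "tc x \<subseteq> elts t"
proof -
  have "y \<in> elts t \<Longrightarrow> tc y \<subseteq> elts t" for y
  proof (induction y rule: mem_induct)
    case (mem y) then show ?case using assms(2)[of y] by (subst tc_unfold) auto
  qed
  then show ?thesis using assms(1) by (subst tc_unfold) auto
qed

lemma tc_in_eq: assumes "b \<in> V" "elts b = tc x" "a \<in> V" shows "tc_in x a \<longleftrightarrow> a = b"
proof -
  have b: "elts x \<subseteq> elts b" "\<forall>y\<in>elts b. elts y \<subseteq> elts b"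
    using assms(2) elts_tc tc_trans by blast+
  have "tc_in x b" unfolding tc_in_def using b tc_subset[of x] assms(2) by blast
  moreover have "a = b" if "tc_in x a"
  proof -
    have "elts a \<subseteq> elts b" using that b assms(1) unfolding tc_in_def by blast
    moreover have "elts b \<subseteq> elts a" using that tc_subset[of x a] assms(2) unfolding tc_in_def by blast
    ultimately show ?thesis by (simp add: elts_inject[symmetric])
  qed
  ultimately show ?thesis by blast
qed

text \<open>Replacement requires a total operation before \<open>inV_tc\<close> is available, hence
  the default \<open>num 0\<close> where no transitive closure has been found in
  \<open>V\<close>.\<close>

lemma T_tc_aux: "definable_op (\<lambda>s. if \<exists>a\<in>V. tc_in (s 0) a then (THE a. a \<in> V \<and> tc_in (s 0) a) else num 0)"
proof (rule T_the[where Q = "\<lambda>s a. tc_in (s 0) a \<or> (\<not> (\<exists>a\<in>V. tc_in (s 0) a) \<and> a = num 0)"])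
  show "definable (\<lambda>s. tc_in (s (Suc 0)) (s 0) \<or> (\<not> (\<exists>a\<in>V. tc_in (s (Suc 0)) a) \<and> s 0 = num 0))"
    unfolding tc_in_def by (intro defin)
  have u: "a = b" if "tc_in x a" "tc_in x b" "a \<in> V" "b \<in> V" for x a b
    using that unfolding tc_in_def by (metis elts_inject order_antisym)
  have the: "(THE a. a \<in> V \<and> tc_in x a) = a" if "tc_in x a" "a \<in> V" for x a
    using that u by blast
  fix s assume s: "env s"
  show "(if \<exists>a\<in>V. tc_in (s 0) a then (THE a. a \<in> V \<and> tc_in (s 0) a) else num 0) \<in> V"
    using the by auto
  show "(tc_in (s 0) b \<or> (\<not> (\<exists>a\<in>V. tc_in (s 0) a) \<and> b = num 0)) =
    (b = (if \<exists>a\<in>V. tc_in (s 0) a then (THE a. a \<in> V \<and> tc_in (s 0) a) else num 0))" if "b \<in> V" for b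
    using the that by auto
qed

text \<open>By induction on membership: replacement collects the closures of the elements of
  \<open>x\<close>, and their union together with \<open>x\<close> is the closure of
  \<open>x\<close>.\<close>

lemma inV_tc: "x \<in> V \<Longrightarrow> inV (tc x)"
proof (induction x rule: mem_induct)
  case (mem x)
  define f where "f x = (if \<exists>a\<in>V. tc_in x a then (THE a. a \<in> V \<and> tc_in x a) else num 0)" for x
  have f: "elts (f y) = tc y" if y: "y \<in> elts x" for y
  proof -
    have i: "inV (tc y)" using mem y trans by blast
    have "tc_in y a \<longleftrightarrow> a = mk (tc y)" if "a \<in> V" for a
      using tc_in_eq[of "mk (tc y)"] inV_D[OF i] that by blast
    then have "f y = mk (tc y)" using inV_D(1)[OF i] by (auto simp: f_def intro!: the_equality)
    then show ?thesis using inV_D(2)[OF i] by simp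
  qed
  have "inV (f ` elts x)" 
    unfolding f_def by (rule inV_image[OF T_tc_aux]) (rule mem)
  then obtain r where r: "r \<in> V" "elts r = f ` elts x" unfolding inV_def by blast
  have "elts (union2 x (Union1 r)) = tc x"
    using f r by (subst tc_unfold) simp
  moreover have "union2 x (Union1 r) \<in> V"
    unfolding union2_def Union1_def
    using r mem(2) by (intro inV_D inV_union2 inV_Union)
  ultimately show ?case unfolding inV_def by blast
qed

lemma T_tc [defin]: "definable_op t \<Longrightarrow> definable_op (\<lambda>s. mk (tc (t s)))"
proof (rule T_op1[where f = "\<lambda>x. mk (tc x)"], rule T_the[where Q = "\<lambda>s. tc_in (s 0)"])
  show "definable (\<lambda>s. tc_in (s (Suc 0)) (s 0))" unfolding tc_in_def by (intro defin)
  show "mk (tc (s 0)) \<in> V" if "env s" for s using inV_D(1)[OF inV_tc] that by blast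
  show "tc_in (s 0) a \<longleftrightarrow> a = mk (tc (s 0))" if "env s" "a \<in> V" for s a
    using inV_D[OF inV_tc, of "s 0"] tc_in_eq that by blast
qed

end

section \<open>Recursion along the transitive closure\<close>

definition memo :: "'u::set_universe \<Rightarrow> ('u \<Rightarrow> 'u) \<Rightarrow> 'u" where
  "memo x f = mk {opair y (f y) | y. y \<in> tc x}"

text \<open>The step \<open>G\<close> gets the earlier values as a set of the universe rather than
  as a HOL function. This allows \<open>G\<close> to be a definable operation, with \<open>p\<close>
  as parameter of the recursion.\<close>

definition recF :: "('u::set_universe \<Rightarrow> 'u \<Rightarrow> 'u \<Rightarrow> 'u) \<Rightarrow> 'u \<Rightarrow> 'u \<Rightarrow> 'u" where
  "recF G p = wfrec ({(x, y). mem x y}\<^sup>+) (\<lambda>f x. G p x (memo x f))"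

lemma recF: "recF G p x = G p x (memo x (recF G p))"
proof -
  have "memo x (cut (recF G p) ({(x, y). mem x y}\<^sup>+) x) = memo x (recF G p)"
    unfolding memo_def by (rule arg_cong[of _ _ mk]) (auto simp: tc_def cut_def)
  then show ?thesis
    unfolding recF_def by (subst wfrec[OF wf_tc]) (simp add: recF_def)
qed

context transitive_model
begin

context
  fixes G :: "'u \<Rightarrow> 'u \<Rightarrow> 'u \<Rightarrow> 'u"
  assumes G: "definable_op (\<lambda>s. G (s 0) (s 1) (s 2))"
begin

text \<open>An approximation to \<open>recF G p\<close> whose domain is transitively closed.\<close>

definition rec_cert :: "'u \<Rightarrow> 'u \<Rightarrow> bool" where
  "rec_cert p h \<longleftrightarrow> (\<forall>e\<in>elts h. \<exists>x\<in>V. \<exists>v\<in>V. e = opair x v \<and> (\<forall>y\<in>elts (mk (tc x)). \<exists>w\<in>V. opair y w \<in> elts h) \<and>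
     v = G p x (mk {e \<in> elts h. fst0 e \<in> elts (mk (tc x))}))"

text \<open>By induction, the part of \<open>h\<close> lying over \<open>tc x\<close> coincides with
  \<open>memo x (recF G p)\<close>, so the value that \<open>h\<close> records at \<open>x\<close>
  is the true one.\<close>

lemma rec_cert_eq:
  assumes h: "rec_cert p h" and "opair x v \<in> elts h" shows "v = recF G p x"
  using assms(2)
proof (induction x arbitrary: v rule: tc_induct)
  case (tc x)
  have *: "(\<forall>y\<in>elts (mk (tc x)). \<exists>w\<in>V. opair y w \<in> elts h)"
    "v = G p x (mk {e \<in> elts h. fst0 e \<in> elts (mk (tc x))})" and x: "x \<in> V"
    using h tc(2) unfolding rec_cert_def by fastforce+
  have e: "elts (mk (tc x)) = tc x" using inV_D(2)[OF inV_tc[OF x]] .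
  have "{e \<in> elts h. fst0 e \<in> tc x} = {opair y (recF G p y) | y. y \<in> tc x}"
  proof (intro set_eqI iffI)
    fix e assume "e \<in> {e \<in> elts h. fst0 e \<in> tc x}"
    moreover from this obtain y w where "e = opair y w" using h unfolding rec_cert_def by blast
    ultimately show "e \<in> {opair y (recF G p y) | y. y \<in> tc x}" using tc(1) by auto
  next
    fix e assume "e \<in> {opair y (recF G p y) | y. y \<in> tc x}"
    then obtain y where y: "e = opair y (recF G p y)" "y \<in> tc x" by blast
    with * e obtain w where "opair y w \<in> elts h" by auto
    then show "e \<in> {e \<in> elts h. fst0 e \<in> tc x}" using y tc(1) by auto
  qed
  then show ?case using *(2) e recF[of G p x] by (simp add: memo_def)
qed

definition rec_val :: "'u \<Rightarrow> 'u \<Rightarrow> 'u \<Rightarrow> bool" where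
  "rec_val p x v \<longleftrightarrow> (\<exists>h\<in>V. rec_cert p h \<and> opair x v \<in> elts h)"

lemma D_rec_val: "definable (\<lambda>s. rec_val (s i) (s j) (s k))"
  unfolding rec_val_def rec_cert_def
  by (intro defin T_op3[OF G])

text \<open>As in \<open>T_tc_aux\<close>, a default makes the operation total while it is still
  open whether \<open>recF\<close> has its values in \<open>V\<close>; \<open>rec_val\<close> uses
  it in an application of replacement.\<close>

lemma T_rec_aux: "definable_op (\<lambda>s. if \<exists>v\<in>V. rec_val (s 0) (s 1) v then recF G (s 0) (s 1) else num 0)"
proof (rule T_the[where Q = "\<lambda>s b. rec_val (s 0) (s 1) b \<or> (\<not> (\<exists>a\<in>V. rec_val (s 0) (s 1) a) \<and> b = num 0)"])
  have u: "v = recF G p x" if "rec_val p x v" for p x v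
    using that rec_cert_eq unfolding rec_val_def by blast
  fix s assume s: "env s"
  show "(if \<exists>v\<in>V. rec_val (s 0) (s 1) v then recF G (s 0) (s 1) else num 0) \<in> V"
    using u by auto
  show "(rec_val (s 0) (s 1) b \<or> (\<not> (\<exists>a\<in>V. rec_val (s 0) (s 1) a) \<and> b = num 0)) =
    (b = (if \<exists>v\<in>V. rec_val (s 0) (s 1) v then recF G (s 0) (s 1) else num 0))" if "b \<in> V" for b
    using u that by auto
qed (intro defin D_rec_val)

text \<open>The induction hypothesis supplies the values over \<open>tc x\<close>; replacement makes
  them into an element of \<open>V\<close>, and closure of \<open>V\<close> under \<open>G\<close>
  then gives the value at \<open>x\<close>.\<close>

lemma rec_val: assumes "p \<in> V" shows "x \<in> V \<Longrightarrow> recF G p x \<in> V \<and> rec_val p x (recF G p x)"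
proof (induction x rule: tc_induct)
  case (tc x)
  let ?F = "recF G p"
  have e: "elts (mk (tc z)) = tc z" if "z \<in> V" for z using inV_D(2)[OF inV_tc[OF that]] .
  have tV: "y \<in> V" if "y \<in> tc x" for y
    using trans[OF inV_D(1)[OF inV_tc[OF tc(2)]]] e[OF tc(2)] that by blast
  let ?f = "\<lambda>y. if \<exists>v\<in>V. rec_val p y v then ?F y else num 0"
  have Tf: "definable_op (\<lambda>s. ?f (s 0))"
    using T_op2[OF T_rec_aux T_const[OF assms] T_var] .
  have f: "?f y = ?F y" if "y \<in> tc x" for y using tc(1)[OF that] tV[OF that] by auto
  have "inV ((\<lambda>y. opair y (?f y)) ` elts (mk (tc x)))"
    by (rule inV_image) (intro defin Tf inV_D inV_tc tc)+
  moreover have "(\<lambda>y. opair y (?f y)) ` elts (mk (tc x)) = {opair y (?F y) | y. y \<in> tc x}"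
    using f e[OF tc(2)] by (simp only:) (rule set_eqI, auto simp: image_iff)
  ultimately have m: "inV {opair y (?F y) | y. y \<in> tc x}" by simp
  have memo: "memo x ?F \<in> V" "elts (memo x ?F) = {opair y (?F y) | y. y \<in> tc x}"
    unfolding memo_def using inV_D[OF m] by auto
  have Fx: "?F x \<in> V"
    using T_in[OF T_op3[OF G T_const[OF assms] T_const[OF tc(2)] T_const[OF memo(1)]], of "\<lambda>_. p"] assms
    by (subst recF) simp
  \<comment> \<open>The approximation for \<open>x\<close>: all values over the transitive closure
    of \<open>x\<close>, and the value at \<open>x\<close> itself.\<close>
  define h where "h = mk (insert (opair x (?F x)) (elts (memo x ?F)))"
  have h: "h \<in> V" "elts h = insert (opair x (?F x)) {opair y (?F y) | y. y \<in> tc x}"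
    using inV_D[OF inV_insert[OF _ inV_elts[OF memo(1)], of "opair x (?F x)"]] Fx tc(2)
    unfolding h_def memo(2)[symmetric] by simp_all
  have "rec_cert p h" unfolding rec_cert_def
  proof
    fix e assume "e \<in> elts h"
    then obtain y where y: "y = x \<or> y \<in> tc x" "e = opair y (?F y)" using h by auto
    then have yV: "y \<in> V" "?F y \<in> V" using tV tc Fx by auto
    have sub: "tc y \<subseteq> tc x" using y tc_trans by blast
    \<comment> \<open>By well-foundedness the pair added for \<open>x\<close> is not seen when
      \<open>h\<close> is restricted to \<open>tc y\<close>.\<close>
    have "x \<notin> tc y" using sub y wf_tc[THEN wf_not_sym] wf_irrefl[OF wf_tc, of x] unfolding tc_def by blast
    then have "{e \<in> elts h. fst0 e \<in> tc y} = {opair z (?F z) | z. z \<in> tc y}"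
      using h(2) sub by auto
    then have "?F y = G p y (mk {e \<in> elts h. fst0 e \<in> elts (mk (tc y))})"
      using e[OF yV(1)] recF[of G p y] by (simp add: memo_def)
    moreover have "\<forall>z\<in>elts (mk (tc y)). \<exists>w\<in>V. opair z w \<in> elts h"
      using e[OF yV(1)] sub tc(1) tV h(2) by blast
    ultimately show "\<exists>x\<in>V. \<exists>v\<in>V. e = opair x v \<and> (\<forall>y\<in>elts (mk (tc x)). \<exists>w\<in>V. opair y w \<in> elts h) \<and>
     v = G p x (mk {e \<in> elts h. fst0 e \<in> elts (mk (tc x))})"
      using y(2) yV by blast
  qed
  then show ?case using Fx h unfolding rec_val_def by auto
qed

lemma T_recF: "definable_op t \<Longrightarrow> definable_op u \<Longrightarrow> definable_op (\<lambda>s. recF G (t s) (u s))"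
proof (rule T_op2[where f = "recF G"])
  show "definable_op (\<lambda>s. recF G (s 0) (s 1))"
  proof (rule T_cong[THEN iffD1, OF _ T_rec_aux])
    fix s assume "env s"
    then have "recF G (s 0) (s 1) \<in> V \<and> rec_val (s 0) (s 1) (recF G (s 0) (s 1))"
      by (intro rec_val) auto
    then show "(if \<exists>v\<in>V. rec_val (s 0) (s 1) v then recF G (s 0) (s 1) else num 0) = recF G (s 0) (s 1)"
      by auto
  qed
qed

lemma memo_recF:
  assumes "p \<in> V" "x \<in> V" "y \<in> tc x" shows "app0 (memo x (recF G p)) y = recF G p y"
proof -
  have "inV ((\<lambda>y. opair y (recF G p y)) ` elts (mk (tc x)))"
    by (rule inV_image) (intro defin T_recF T_const assms inV_D inV_tc)+
  moreover have "(\<lambda>y. opair y (recF G p y)) ` elts (mk (tc x)) = {opair y (recF G p y) | y. y \<in> tc x}"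
    using inV_D(2)[OF inV_tc[OF assms(2)]] by auto
  ultimately have "elts (memo x (recF G p)) = {opair y (recF G p y) | y. y \<in> tc x}"
    unfolding memo_def by (simp add: inV_D)
  then show ?thesis using assms(3) by (intro app0_eq) auto
qed

end

end

section \<open>Natural numbers and tuples in a model\<close>

text \<open>Recursion on numerals, where \<open>Union1\<close> plays the predecessor
  (\<open>Union1_num\<close>). The companion \<open>lrec\<close> recurses on coded tuples, splitting
  off the head by \<open>fst0\<close> and the tail by \<open>snd0\<close>.\<close>

definition nrec :: "('u::set_universe \<Rightarrow> 'u) \<Rightarrow> ('u \<Rightarrow> 'u \<Rightarrow> 'u \<Rightarrow> 'u) \<Rightarrow> 'u \<Rightarrow> 'u \<Rightarrow> 'u" where
  "nrec A B = recF (\<lambda>p x h. if x = mk {} then A p else B p (Union1 x) (app0 h (Union1 x)))"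

definition lrec :: "('u::set_universe \<Rightarrow> 'u) \<Rightarrow> ('u \<Rightarrow> 'u \<Rightarrow> 'u \<Rightarrow> 'u) \<Rightarrow> 'u \<Rightarrow> 'u \<Rightarrow> 'u" where
  "lrec A B = recF (\<lambda>p x h. if x = mk {} then A p else B p (fst0 x) (app0 h (snd0 x)))"

context transitive_model
begin

lemma num_Suc_nonempty [simp]: "num (Suc n) \<noteq> mk {}"
  using num_inject[of "Suc n" 0] by simp

context
  fixes A :: "'u \<Rightarrow> 'u" and B :: "'u \<Rightarrow> 'u \<Rightarrow> 'u \<Rightarrow> 'u"
  assumes A: "definable_op (\<lambda>s. A (s 0))" and B: "definable_op (\<lambda>s. B (s 0) (s 1) (s 2))"
begin

lemma nrec_graph: "definable_op (\<lambda>s. if s 1 = mk {} then A (s 0) else B (s 0) (Union1 (s 1)) (app0 (s 2) (Union1 (s 1))))"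
  by (intro defin T_op1[OF A] T_op3[OF B])

lemma T_nrec: "definable_op t \<Longrightarrow> definable_op u \<Longrightarrow> definable_op (\<lambda>s. nrec A B (t s) (u s))"
  unfolding nrec_def by (rule T_recF[OF nrec_graph])

lemma nrec_0: "nrec A B p (mk {}) = A p"
  unfolding nrec_def by (subst recF) simp

lemma nrec_Suc: "p \<in> V \<Longrightarrow> nrec A B p (num (Suc n)) = B p (num n) (nrec A B p (num n))"
  unfolding nrec_def
  by (subst recF) (simp add: memo_recF[OF nrec_graph] elts_tc)

lemma lrec_graph: "definable_op (\<lambda>s. if s 1 = mk {} then A (s 0) else B (s 0) (fst0 (s 1)) (app0 (s 2) (snd0 (s 1))))"
  by (intro defin T_op1[OF A] T_op3[OF B])

lemma T_lrec: "definable_op t \<Longrightarrow> definable_op u \<Longrightarrow> definable_op (\<lambda>s. lrec A B (t s) (u s))"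
  unfolding lrec_def by (rule T_recF[OF lrec_graph])

lemma lrec_Nil: "lrec A B p (mk {}) = A p"
  unfolding lrec_def by (subst recF) simp

lemma lrec_Cons: "p \<in> V \<Longrightarrow> x \<in> V \<Longrightarrow> t \<in> V \<Longrightarrow> lrec A B p (opair x t) = B p x (lrec A B p t)"
  unfolding lrec_def
  by (subst recF) (simp add: memo_recF[OF lrec_graph] tc_opair)

end

text \<open>The axiom of infinity provides some inductive set only. Let \<open>N\<close> be the part
  of it common to all inductive sets of \<open>V\<close>; a membership-minimal element of
  \<open>N\<close> that is not a numeral could be removed, contradicting the minimality of
  \<open>N\<close>.\<close>

lemma inV_omega: "inV (range num)"
proof -
  have "ax_infinity mem V" using zfc by (simp add: ZFC_def)
  then obtain w where w: "w \<in> V" "\<exists>e\<in>V. e \<in> elts w \<and> \<not> (\<exists>z\<in>V. z \<in> elts e)"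
    "\<forall>n\<in>V. n \<in> elts w \<longrightarrow> (\<exists>m\<in>V. m \<in> elts w \<and> (\<forall>z\<in>V. z \<in> elts m \<longleftrightarrow> z \<in> elts n \<or> z = n))"
    unfolding ax_infinity_def mem_elts by blast
  from w(2) obtain e where e: "e \<in> V" "e \<in> elts w" "\<not> (\<exists>z\<in>V. z \<in> elts e)" by blast
  then have "elts e = elts (mk {})" using trans by auto
  then have "e = mk {}" using elts_inject[of e "mk {}"] by simp
  then have w0: "mk {} \<in> elts w" using e by simp
  have wS: "succ n \<in> elts w" if n: "n \<in> elts w" for n
  proof -
    have nV: "n \<in> V" using trans w(1) n by blast
    then obtain m where m: "m \<in> V" "m \<in> elts w" "\<forall>z\<in>V. z \<in> elts m \<longleftrightarrow> z \<in> elts n \<or> z = n"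
      using w(3) n by blast
    have "elts m = elts (succ n)" using m(3) trans[OF m(1)] trans[OF nV] nV by (simp, blast)
    then show ?thesis using m(2) elts_inject[of m "succ n"] by simp
  qed
  define Ind where "Ind I \<longleftrightarrow> mk {} \<in> elts I \<and> (\<forall>n\<in>elts I. succ n \<in> elts I)" for I :: 'u
  have num_Ind: "num n \<in> elts I" if "Ind I" for n I
    using that unfolding Ind_def by (induction n) (auto simp: num_Suc)
  have DI: "definable (\<lambda>s. Ind (s i))" for i unfolding Ind_def by (intro defin T_mk_empty T_succ)
  have "inV {z \<in> elts w. \<forall>I\<in>V. Ind I \<longrightarrow> z \<in> elts I}"
    by (rule inV_sep) (intro defin DI w)+
  then obtain N where N: "N \<in> V" "elts N = {z \<in> elts w. \<forall>I\<in>V. Ind I \<longrightarrow> z \<in> elts I}"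
    unfolding inV_def by blast
  have IndN: "Ind N"
    unfolding Ind_def N(2) using w0 wS by (auto simp: Ind_def)
  have "z \<in> range num" if "z \<in> elts N" for z
    using that
  proof (induction z rule: mem_induct)
    case (mem z)
    show ?case
    proof (rule ccontr)
      assume z: "z \<notin> range num"
      \<comment> \<open>If \<open>z\<close> were the successor of some \<open>n\<close> in
        \<open>N\<close>, the induction hypothesis would make \<open>n\<close>, and hence
        \<open>z\<close>, a numeral. So \<open>N\<close> without \<open>z\<close> is still
        inductive.\<close>
      have "Ind (diff2 N (upair z z))"
        unfolding Ind_def
      proof (intro conjI ballI)
        have "z \<noteq> mk {}" using z by (metis num.simps(1) rangeI)
        then show "mk {} \<in> elts (diff2 N (upair z z))" using IndN by (auto simp: Ind_def)
        fix n assume n: "n \<in> elts (diff2 N (upair z z))"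
        have "succ n \<noteq> z"
        proof
          assume e: "succ n = z"
          then have "n \<in> elts z" by (auto simp flip: e)
          then obtain k where "n = num k" using mem(1) n by auto
          then show False using e z num_Suc[of k] by (metis rangeI)
        qed
        then show "succ n \<in> elts (diff2 N (upair z z))" using IndN n by (auto simp: Ind_def)
      qed
      moreover have "diff2 N (upair z z) \<in> V"
        using T_in[OF T_diff2[OF T_const T_upair[OF T_const T_const]], of N z z "\<lambda>_. N"] N(1) trans[OF N(1) mem(2)]
        by simp
      ultimately show False using mem(2) N(2) by auto
    qed
  qed
  then have "elts N = range num" using num_Ind[OF IndN] by blast
  then show ?thesis using N(1) unfolding inV_def by blast
qed

lemma omega_V [simp]: "omega \<in> V"
  unfolding omega_def by (rule inV_D(1)[OF inV_omega])

end

lemma elts_omega [simp]: "elts omega = range num"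
  unfolding omega_def
  using transitive_model.inV_D(2)[OF model_UNIV transitive_model.inV_omega[OF model_UNIV]] .

lemma num_omega: "num n \<in> elts omega"
  by simp

section \<open>Products and operations on coded tuples\<close>

definition prodset :: "'u::set_universe \<Rightarrow> 'u \<Rightarrow> 'u" where
  "prodset a b = Union1 (mk ((\<lambda>x. mk ((\<lambda>y. opair x y) ` elts b)) ` elts a))"

context transitive_model
begin

lemma T_prodset [defin]: "definable_op t \<Longrightarrow> definable_op u \<Longrightarrow> definable_op (\<lambda>s. prodset (t s) (u s))"
  by (rule T_op2[where f = prodset]) (unfold prodset_def, intro defin, assumption)

lemma elts_image:
  "definable_op (\<lambda>s. f (s 0)) \<Longrightarrow> a \<in> V \<Longrightarrow> elts (mk (f ` elts a)) = f ` elts a"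
  by (rule inV_D(2)[OF inV_image])

lemma image_V: "definable_op (\<lambda>s. f (s 0)) \<Longrightarrow> a \<in> V \<Longrightarrow> mk (f ` elts a) \<in> V"
  by (rule inV_D(1)[OF inV_image])

end

lemma elts_prodset [simp]: "elts (prodset a b) = {opair x y | x y. x \<in> elts a \<and> y \<in> elts b}"
proof -
  interpret U: transitive_model "UNIV :: 'a set" by (rule model_UNIV)
  have 1: "elts (mk ((\<lambda>y. opair x y) ` elts b)) = (\<lambda>y. opair x y) ` elts b" for x
    by (rule U.elts_image) (intro U.T_opair U.T_var U.T_const UNIV_I)+
  have "elts (mk ((\<lambda>x. mk ((\<lambda>y. opair x y) ` elts b)) ` elts a)) = (\<lambda>x. mk ((\<lambda>y. opair x y) ` elts b)) ` elts a"
    by (rule U.elts_image) (intro U.T_opair U.T_var U.T_const U.T_Image UNIV_I)+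
  then show ?thesis unfolding prodset_def by (auto simp: 1)
qed

definition tuples :: "'u::set_universe \<Rightarrow> 'u \<Rightarrow> 'u" where
  "tuples = nrec (\<lambda>p. upair (mk {}) (mk {})) (\<lambda>p n r. prodset p r)"

definition map_tup :: "'u::set_universe \<Rightarrow> 'u \<Rightarrow> 'u" where
  "map_tup = lrec (\<lambda>p. mk {}) (\<lambda>p x r. opair (app0 p x) r)"

text \<open>Iterates the tail operation; the first component of the result is the entry at the given
  position (\<open>fst0_drop_tup\<close>).\<close>

definition drop_tup :: "'u::set_universe \<Rightarrow> 'u \<Rightarrow> 'u" where
  "drop_tup = nrec (\<lambda>p. p) (\<lambda>p n r. snd0 r)"

text \<open>The coded form of \<open>map (nth as) is\<close>; the recursion runs along the coded
  list of positions, the tuple being the parameter.\<close>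

definition sel_tup :: "'u::set_universe \<Rightarrow> 'u \<Rightarrow> 'u" where
  "sel_tup = lrec (\<lambda>p. mk {}) (\<lambda>p i r. opair (fst0 (drop_tup p i)) r)"

context transitive_model
begin

lemma tup_V [simp]: "tup xs \<in> V \<longleftrightarrow> set xs \<subseteq> V"
  by (induction xs) auto

lemma T_tuples [defin]: "definable_op t \<Longrightarrow> definable_op u \<Longrightarrow> definable_op (\<lambda>s. tuples (t s) (u s))"
  unfolding tuples_def by (rule T_nrec) (intro defin | assumption)+

lemma T_map_tup [defin]: "definable_op t \<Longrightarrow> definable_op u \<Longrightarrow> definable_op (\<lambda>s. map_tup (t s) (u s))"
  unfolding map_tup_def by (rule T_lrec) (intro defin | assumption)+

lemma T_drop_tup [defin]: "definable_op t \<Longrightarrow> definable_op u \<Longrightarrow> definable_op (\<lambda>s. drop_tup (t s) (u s))"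
  unfolding drop_tup_def by (rule T_nrec) (intro defin | assumption)+

lemma T_sel_tup [defin]: "definable_op t \<Longrightarrow> definable_op u \<Longrightarrow> definable_op (\<lambda>s. sel_tup (t s) (u s))"
  unfolding sel_tup_def by (rule T_lrec) (intro defin | assumption)+

lemma elts_tuples: "Y \<in> V \<Longrightarrow> elts (tuples Y (num n)) = {tup as | as. length as = n \<and> set as \<subseteq> elts Y}"
proof (induction n)
  case 0
  have "tuples Y (num 0) = upair (mk {}) (mk {})"
    unfolding tuples_def num.simps(1) by (rule nrec_0) (intro defin)+
  then show ?case by auto
next
  case (Suc n)
  have "tuples Y (num (Suc n)) = prodset Y (tuples Y (num n))"
    unfolding tuples_def by (rule nrec_Suc) (intro defin Suc)+
  then have "elts (tuples Y (num (Suc n))) = {opair x (tup as) | x as. x \<in> elts Y \<and> length as = n \<and> set as \<subseteq> elts Y}"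
    using Suc by auto
  also have "\<dots> = {tup as | as. length as = Suc n \<and> set as \<subseteq> elts Y}"
    by (auto simp: length_Suc_conv) (metis tup.simps(2) length_Cons list.simps(15) insert_subset)
  finally show ?case .
qed

lemma map_tup: "g \<in> V \<Longrightarrow> set as \<subseteq> V \<Longrightarrow> map_tup g (tup as) = tup (map (app0 g) as)"
proof (induction as)
  case Nil
  show ?case unfolding map_tup_def tup.simps list.map by (rule lrec_Nil) (intro defin)+
next
  case (Cons a as)
  have "map_tup g (tup (a # as)) = opair (app0 g a) (map_tup g (tup as))"
    unfolding map_tup_def tup.simps by (rule lrec_Cons) (use Cons in \<open>auto intro!: defin\<close>)
  then show ?case using Cons by simp
qed

lemma drop_tup: "set as \<subseteq> V \<Longrightarrow> i \<le> length as \<Longrightarrow> drop_tup (tup as) (num i) = tup (drop i as)"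
proof (induction i)
  case 0
  show ?case unfolding drop_tup_def num.simps(1) drop_0 by (rule nrec_0) (intro defin)+
next
  case (Suc i)
  have "drop_tup (tup as) (num (Suc i)) = snd0 (drop_tup (tup as) (num i))"
    unfolding drop_tup_def by (rule nrec_Suc) (use Suc in \<open>auto intro!: defin\<close>)
  also have "\<dots> = tup (drop (Suc i) as)"
    using Suc by (subst Suc.IH) (simp_all flip: Cons_nth_drop_Suc)
  finally show ?case .
qed

lemma fst0_drop_tup: "set as \<subseteq> V \<Longrightarrow> i < length as \<Longrightarrow> fst0 (drop_tup (tup as) (num i)) = as ! i"
  by (simp add: drop_tup flip: Cons_nth_drop_Suc)

lemma sel_tup:
  "set as \<subseteq> V \<Longrightarrow> \<forall>i\<in>set is. i < length as \<Longrightarrow> sel_tup (tup as) (tup (map num is)) = tup (map (nth as) is)"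
proof (induction "is")
  case Nil
  show ?case unfolding sel_tup_def tup.simps list.map by (rule lrec_Nil) (intro defin)+
next
  case (Cons i "is")
  have "sel_tup (tup as) (tup (map num (i # is))) = opair (fst0 (drop_tup (tup as) (num i))) (sel_tup (tup as) (tup (map num is)))"
    unfolding sel_tup_def tup.simps list.map by (rule lrec_Cons) (use Cons in \<open>auto intro!: defin\<close>)
  then show ?case using Cons by (simp add: fst0_drop_tup)
qed

end

section \<open>Collection and choice\<close>

context transitive_model
begin

definition pow :: "'u \<Rightarrow> 'u" where "pow a = mk {y \<in> V. elts y \<subseteq> elts a}"

lemma T_pow [defin]: "definable_op t \<Longrightarrow> definable_op (\<lambda>s. pow (t s))"
proof (rule T_op1[where f = pow])
  have "definable_op (\<lambda>s. mk {y. y \<in> V \<and> elts y \<subseteq> elts (s 0)})"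
  proof (rule T_mk)
    show "inV {y. y \<in> V \<and> elts y \<subseteq> elts (s 0)}" if "env s" for s using inV_Pow that by simp
    have "definable (\<lambda>s. elts (s 0) \<subseteq> elts (s 1))" by (intro defin)
    then show "definable (\<lambda>s. s 0 \<in> V \<and> elts (s 0) \<subseteq> elts (s (Suc 0)))"
      by (rule D_cong[THEN iffD1, rotated]) simp
  qed
  then show "definable_op (\<lambda>s. pow (s 0))" by (simp add: pow_def)
qed

lemma elts_pow: "a \<in> V \<Longrightarrow> elts (pow a) = {y \<in> V. elts y \<subseteq> elts a}"
  unfolding pow_def by (rule inV_D(2)[OF inV_Pow])

text \<open>\<open>stage x\<close> is the level of the cumulative hierarchy of \<open>V\<close> indexed by the rank of \<open>x\<close>; least stages
  turn replacement into collection.\<close>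

definition stage :: "'u \<Rightarrow> 'u" where
  "stage = recF (\<lambda>p x h. Union1 (mk ((\<lambda>y. pow (app0 h y)) ` elts x))) (mk {})"

lemma stage_graph: "definable_op (\<lambda>s. Union1 (mk ((\<lambda>y. pow (app0 (s 2) y)) ` elts (s 1))))"
  by (intro defin)

lemma T_stage [defin]: "definable_op t \<Longrightarrow> definable_op (\<lambda>s. stage (t s))"
  unfolding stage_def by (rule T_recF[OF stage_graph]) (intro defin)

lemma stage_V [simp]: "x \<in> V \<Longrightarrow> stage x \<in> V"
  using T_in[OF T_stage[OF T_const], of x "\<lambda>_. x"] by simp

lemma elts_stage: assumes "x \<in> V" shows "elts (stage x) = (\<Union>y\<in>elts x. {z \<in> V. elts z \<subseteq> elts (stage y)})"
proof -
  have "(\<lambda>y. pow (app0 (memo x (recF (\<lambda>p x h. Union1 (mk ((\<lambda>y. pow (app0 h y)) ` elts x))) (mk {}))) y)) ` elts x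
     = (\<lambda>y. pow (stage y)) ` elts x"
    unfolding stage_def by (rule image_cong) (auto simp: memo_recF[OF stage_graph] assms elts_tc)
  then have "stage x = Union1 (mk ((\<lambda>y. pow (stage y)) ` elts x))"
    unfolding stage_def by (subst recF) simp
  also have "elts \<dots> = (\<Union>y\<in>elts x. elts (pow (stage y)))"
    using elts_image[of "\<lambda>y. pow (stage y)" x] assms by (simp add: T_pow T_stage T_var)
  also have "\<dots> = (\<Union>y\<in>elts x. {z \<in> V. elts z \<subseteq> elts (stage y)})"
    by (intro SUP_cong refl elts_pow stage_V) (use trans assms in blast)
  finally show ?thesis .
qed

lemma subset_stage: "x \<in> V \<Longrightarrow> elts x \<subseteq> elts (stage x)"
proof (induction x rule: mem_induct)
  case (mem x)
  then show ?case unfolding elts_stage[OF mem(2)] using trans[OF mem(2)] by blast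
qed

text \<open>Stages are comparable. If some \<open>y \<in> x\<close> contributes a set outside
  \<open>stage z\<close>, then \<open>stage y\<close> is included in no \<open>stage w\<close> with
  \<open>w \<in> z\<close>; the induction hypothesis at \<open>y\<close> then places
  \<open>stage z\<close> inside \<open>stage y\<close>.\<close>

lemma stage_linear:
  "x \<in> V \<Longrightarrow> z \<in> V \<Longrightarrow> elts (stage x) \<subseteq> elts (stage z) \<or> (\<forall>w\<in>V. elts w \<subseteq> elts (stage z) \<longrightarrow> w \<in> elts (stage x))"
proof (induction x arbitrary: z rule: mem_induct)
  case (mem x)
  show ?case
  proof (cases "elts (stage x) \<subseteq> elts (stage z)")
    case False
    then obtain y where y: "y \<in> elts x" "\<not> {w \<in> V. elts w \<subseteq> elts (stage y)} \<subseteq> elts (stage z)"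
      unfolding elts_stage[OF mem(2)] by blast
    have yV: "y \<in> V" using trans mem y by blast
    have "{u \<in> V. elts u \<subseteq> elts (stage w)} \<subseteq> elts (stage y)" if w: "w \<in> elts z" for w
    proof -
      have wV: "w \<in> V" using trans mem w by blast
      have "\<not> elts (stage y) \<subseteq> elts (stage w)"
        using y(2) w unfolding elts_stage[OF mem(3)] by blast
      then show ?thesis using mem(1)[OF y(1) yV wV] by blast
    qed
    then have "elts (stage z) \<subseteq> elts (stage y)" unfolding elts_stage[OF mem(3)] by blast
    then show ?thesis using y(1) unfolding elts_stage[OF mem(2)] by blast
  qed simp
qed

text \<open>Uniqueness turns the chosen value into a definable one.\<close>

lemma definable_partial_function:
  assumes Q: "definable (\<lambda>s. Q (s 0) (s 1))"
    and uniq: "\<And>x c c'. x \<in> V \<Longrightarrow> c \<in> V \<Longrightarrow> c' \<in> V \<Longrightarrow> Q x c \<Longrightarrow> Q x c' \<Longrightarrow> c = c'"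
  shows "\<exists>f. definable_op (\<lambda>s. f (s 0)) \<and> (\<forall>x\<in>V. (\<exists>c\<in>V. Q x c) \<longrightarrow> Q x (f x))"
proof -
  define f where "f x = (if \<exists>c\<in>V. Q x c then SOME c. c \<in> V \<and> Q x c else num 0)" for x
  have f: "f x \<in> V \<and> Q x (f x)" if "\<exists>c\<in>V. Q x c" for x
    using that someI_ex[of "\<lambda>c. c \<in> V \<and> Q x c"] unfolding f_def by auto
  have "definable_op (\<lambda>s. f (s 0))"
  proof (rule T_the[where Q = "\<lambda>s a. Q (s 0) a \<or> (\<not> (\<exists>c\<in>V. Q (s 0) c) \<and> a = num 0)"])
    show "definable (\<lambda>s. Q (s (Suc 0)) (s 0) \<or> (\<not> (\<exists>c\<in>V. Q (s (Suc 0)) c) \<and> s 0 = num 0))"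
      by (intro defin D_op2[OF Q])
    fix s assume s: "env s"
    show "f (s 0) \<in> V" using f unfolding f_def by auto
    show "(Q (s 0) a \<or> (\<not> (\<exists>c\<in>V. Q (s 0) c) \<and> a = num 0)) = (a = f (s 0))" if "a \<in> V" for a
    proof (cases "\<exists>c\<in>V. Q (s 0) c")
      case True
      then show ?thesis using f[OF True] uniq[of "s 0" a "f (s 0)"] s that by blast
    next
      case False
      then show ?thesis using that by (auto simp: f_def)
    qed
  qed
  then show ?thesis using f by blast
qed

lemma collection:
  assumes R: "definable (\<lambda>s. R (s 0) (s 1))" and a: "a \<in> V" and ex: "\<And>x. x \<in> elts a \<Longrightarrow> \<exists>y\<in>V. R x y"
  shows "\<exists>C\<in>V. \<forall>x\<in>elts a. \<exists>y\<in>elts C. R x y"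
proof -
  \<comment> \<open>Scott's trick: witnesses for \<open>x\<close> need not be unique, but the least
    stage occurring among them is.\<close>
  define Q where "Q x c \<longleftrightarrow> (\<exists>y\<in>V. R x y \<and> c = stage y) \<and> (\<forall>y\<in>V. R x y \<longrightarrow> elts c \<subseteq> elts (stage y))" for x c
  have "definable (\<lambda>s. Q (s 0) (s 1))"
    unfolding Q_def by (intro defin D_op2[OF R])
  moreover have "c = c'" if "Q x c" "Q x c'" for x c c'
  proof -
    have "elts c = elts c'" using that unfolding Q_def by blast
    then show ?thesis by (simp add: elts_inject)
  qed
  ultimately obtain f where f: "definable_op (\<lambda>s. f (s 0))" "\<And>x. x \<in> V \<Longrightarrow> \<exists>c\<in>V. Q x c \<Longrightarrow> Q x (f x)"
    using definable_partial_function[of Q] by metis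
  have Q: "\<exists>c\<in>V. Q x c" if x: "x \<in> elts a" for x
  proof -
    define S where "S = {stage y | y. y \<in> V \<and> R x y}"
    obtain c0 where "c0 \<in> S" using ex[OF x] unfolding S_def by blast
    \<comment> \<open>A membership-minimal stage is also least under inclusion: by
      \<open>stage_linear\<close> a stage not including it would be one of its elements.\<close>
    from wfE_min[OF wf_mem this] obtain c where c: "c \<in> S" "\<And>d. (d, c) \<in> {(x, y). mem x y} \<Longrightarrow> d \<notin> S"
      by blast
    then obtain y where y: "y \<in> V" "R x y" "c = stage y" unfolding S_def by blast
    have "elts c \<subseteq> elts (stage z)" if z: "z \<in> V" "R x z" for z
    proof (rule ccontr)
      assume "\<not> elts c \<subseteq> elts (stage z)"
      then have "stage z \<in> elts c" using stage_linear[OF y(1) z(1)] y(3) z(1) by auto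
      then show False using c(2)[of "stage z"] z unfolding S_def by (auto simp: mem_elts)
    qed
    then have "Q x c" unfolding Q_def using y by blast
    then show ?thesis using y by auto
  qed
  \<comment> \<open>A witness is a subset, not necessarily an element, of its stage; hence the power
    sets.\<close>
  define C where "C = Union1 (mk ((\<lambda>x. pow (f x)) ` elts a))"
  have T1: "definable_op (\<lambda>s. pow (f (s 0)))" by (intro defin f)
  have eC: "elts C = (\<Union>x\<in>elts a. elts (pow (f x)))"
    unfolding C_def elts_ops elts_image[OF T1 a] by simp
  have "C \<in> V"
    unfolding C_def Union1_def by (intro inV_D(1)[OF inV_Union] image_V T1 a)
  moreover have "\<exists>y\<in>elts C. R x y" if x: "x \<in> elts a" for x
  proof -
    have xV: "x \<in> V" using trans a x by blast
    have "Q x (f x)" using f(2)[OF xV] Q[OF x] .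
    then obtain y where y: "y \<in> V" "R x y" "f x = stage y" unfolding Q_def by blast
    have "y \<in> elts (pow (f x))" using y elts_pow[of "stage y"] subset_stage by simp
    then show ?thesis using eC x y by blast
  qed
  ultimately show ?thesis by blast
qed

lemma choice:
  assumes R: "definable (\<lambda>s. R (s 0) (s 1))" and a: "a \<in> V" and ex: "\<And>x. x \<in> elts a \<Longrightarrow> \<exists>y\<in>V. R x y"
  shows "\<exists>f\<in>V. is_function f a \<and> (\<forall>x\<in>elts a. app f x \<in> V \<and> R x (app f x))"
proof -
  obtain C where C: "C \<in> V" "\<And>x. x \<in> elts a \<Longrightarrow> \<exists>y\<in>elts C. R x y"
    using collection[OF assms] by blast
  \<comment> \<open>Tagging witnesses with \<open>x\<close> makes the family disjoint, as the
    transversal form of choice requires. The transversal, cut down to the union of the family, is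
    then already the graph of a choice function.\<close>
  define g where "g x = mk {z \<in> elts (mk ((\<lambda>y. opair x y) ` elts C)). R x (snd0 z)}" for x
  have Tg: "definable_op (\<lambda>s. g (s 0))" unfolding g_def by (intro defin D_op2[OF R] T_const C)
  have eg: "elts (g x) = {opair x y | y. y \<in> elts C \<and> R x y}" if xV: "x \<in> V" for x
  proof -
    have definable_op: "definable_op (\<lambda>s. opair x (s 0))" by (intro defin T_const xV)
    have "inV {z \<in> elts (mk ((\<lambda>y. opair x y) ` elts C)). R x (snd0 z)}"
      by (rule inV_sep) (intro defin D_op2[OF R] T_const xV image_V definable_op C)+
    from inV_D(2)[OF this] show ?thesis unfolding g_def using elts_image[OF definable_op C(1)] by auto
  qed
  define fam where "fam = mk (g ` elts a)"
  have fam: "fam \<in> V" "elts fam = g ` elts a"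
    unfolding fam_def using image_V[OF Tg a] elts_image[OF Tg a] by auto
  have aV: "x \<in> V" if "x \<in> elts a" for x using trans a that by blast
  have gV: "g x \<in> V" if "x \<in> elts a" for x using fam trans that by blast
  have "\<forall>y\<in>V. y \<in> elts fam \<longrightarrow> (\<exists>z\<in>V. z \<in> elts y)"
  proof (intro ballI impI)
    fix y assume "y \<in> elts fam"
    then obtain x where x: "x \<in> elts a" "y = g x" using fam(2) by blast
    then obtain w where "w \<in> elts C" "R x w" using C(2) by blast
    then show "\<exists>z\<in>V. z \<in> elts y"
      using eg[OF aV[OF x(1)]] x trans[OF C(1)] aV by (intro bexI[of _ "opair x w"]) auto
  qed
  moreover have "\<forall>y\<in>V. \<forall>y'\<in>V. y \<in> elts fam \<and> y' \<in> elts fam \<and> y \<noteq> y' \<longrightarrow> \<not> (\<exists>z\<in>V. z \<in> elts y \<and> z \<in> elts y')"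
    unfolding fam(2) using eg aV by auto
  moreover have "ax_choice mem V" using zfc by (simp add: ZFC_def)
  ultimately obtain c where c: "c \<in> V" "\<forall>y\<in>V. y \<in> elts fam \<longrightarrow> (\<exists>!z. z \<in> V \<and> z \<in> elts y \<and> z \<in> elts c)"
    using fam(1) unfolding ax_choice_def mem_elts by blast
  have "inV {z \<in> elts (Union1 fam). z \<in> elts c}"
    by (rule inV_sep) (intro defin T_const c inV_D(1)[OF inV_Union[OF fam(1)], folded Union1_def])+
  then obtain f where f: "f \<in> V" "elts f = {z \<in> elts (Union1 fam). z \<in> elts c}" unfolding inV_def by blast
  have sel: "\<exists>!y. opair x y \<in> elts f" and selR: "opair x y \<in> elts f \<Longrightarrow> y \<in> V \<and> R x y" if x: "x \<in> elts a" for x y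
  proof -
    have "\<exists>!z. z \<in> V \<and> z \<in> elts (g x) \<and> z \<in> elts c" using c(2) gV[OF x] x fam(2) by blast
    moreover have fx: "opair x y \<in> elts f \<longleftrightarrow> opair x y \<in> elts (g x) \<and> opair x y \<in> elts c" for y
      unfolding f(2) using x fam(2) eg aV by auto
    moreover have "z \<in> elts (g x) \<Longrightarrow> \<exists>y. z = opair x y \<and> y \<in> V \<and> R x y" for z
      using eg[OF aV[OF x]] trans C(1) by auto
    ultimately show "\<exists>!y. opair x y \<in> elts f" by (metis (no_types, lifting) opair_V aV x opair_inject)
    show "opair x y \<in> elts f \<Longrightarrow> y \<in> V \<and> R x y"
      using fx eg[OF aV[OF x]] trans C(1) by auto
  qed
  have isf: "is_function f a"
    unfolding is_function_def using sel f(2) fam(2) eg aV by auto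
  moreover have "app f x \<in> V \<and> R x (app f x)" if "x \<in> elts a" for x
    using is_function_app[OF isf that, of "app f x"] selR[OF that] by simp
  ultimately show ?thesis using f(1) by blast
qed

end

section \<open>Interpretation of codes in a model\<close>

text \<open>Truth of a coded literal as an operation definable over \<open>V\<close>:
  \<open>p\<close> pairs the structure with the coded tuple, the tags 2, 1, 0 stand for negation,
  equality and relation, and \<open>num 1\<close> means true.\<close>

definition lit_val :: "'u::set_universe \<Rightarrow> 'u \<Rightarrow> 'u" where
  "lit_val = recF (\<lambda>p c h.
    if fst0 c = num 2 then (if app0 h (fst0 (snd0 c)) = num 1 then num 0 else num 1)
    else if fst0 c = num 1 then
      (if fst0 (drop_tup (snd0 p) (fst0 (snd0 c))) = fst0 (drop_tup (snd0 p) (fst0 (snd0 (snd0 c)))) then num 1 else num 0)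
    else if opair (fst0 (snd0 c)) (sel_tup (snd0 p) (fst0 (snd0 (snd0 c)))) \<in> elts (snd0 (fst0 p)) then num 1 else num 0)"

definition lits_val :: "'u::set_universe \<Rightarrow> 'u \<Rightarrow> 'u" where
  "lits_val = lrec (\<lambda>p. num 1) (\<lambda>p c r. if lit_val p c = num 1 then r else num 0)"

text \<open>The counterpart of \<open>Interp\<close> with values that are sets of the universe, and
  therefore available to definitions over \<open>V\<close>. The parameter is the set of structures;
  the tags are those of the codes.\<close>

definition interp :: "'u::set_universe \<Rightarrow> 'u \<Rightarrow> 'u" where
  "interp = recF (\<lambda>p g h.
    if fst0 g = num 0 then mk {M \<in> elts p. lits_val (opair M (fst0 (snd0 (snd0 g)))) (fst0 (snd0 g)) = num 1}
    else if fst0 g = num 1 then diff2 p (app0 h (fst0 (snd0 g)))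
    else if fst0 g = num 2 then mk {M \<in> elts p. \<exists>d\<in>elts (fst0 (snd0 g)). M \<in> elts (app0 h d)}
    else mk {M \<in> elts p. \<forall>d\<in>elts (fst0 (snd0 g)). M \<in> elts (app0 h d)})"

context transitive_model
begin

lemma lit_val_graph: "definable_op (\<lambda>s. if fst0 (s 1) = num 2 then (if app0 (s 2) (fst0 (snd0 (s 1))) = num 1 then num 0 else num 1)
    else if fst0 (s 1) = num 1 then
      (if fst0 (drop_tup (snd0 (s 0)) (fst0 (snd0 (s 1)))) = fst0 (drop_tup (snd0 (s 0)) (fst0 (snd0 (snd0 (s 1))))) then num 1 else num 0)
    else if opair (fst0 (snd0 (s 1))) (sel_tup (snd0 (s 0)) (fst0 (snd0 (snd0 (s 1))))) \<in> elts (snd0 (fst0 (s 0))) then num 1 else num 0)"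
  by (intro defin)

lemma T_lit_val [defin]: "definable_op t \<Longrightarrow> definable_op u \<Longrightarrow> definable_op (\<lambda>s. lit_val (t s) (u s))"
  unfolding lit_val_def by (rule T_recF[OF lit_val_graph])

lemma T_lits_val [defin]: "definable_op t \<Longrightarrow> definable_op u \<Longrightarrow> definable_op (\<lambda>s. lits_val (t s) (u s))"
  unfolding lits_val_def by (rule T_lrec) (intro defin | assumption)+

lemma interp_graph: "definable_op (\<lambda>s. if fst0 (s 1) = num 0 then mk {M \<in> elts (s 0). lits_val (opair M (fst0 (snd0 (snd0 (s 1))))) (fst0 (snd0 (s 1))) = num 1}
    else if fst0 (s 1) = num 1 then diff2 (s 0) (app0 (s 2) (fst0 (snd0 (s 1))))
    else if fst0 (s 1) = num 2 then mk {M \<in> elts (s 0). \<exists>d\<in>elts (fst0 (snd0 (s 1))). M \<in> elts (app0 (s 2) d)}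
    else mk {M \<in> elts (s 0). \<forall>d\<in>elts (fst0 (snd0 (s 1))). M \<in> elts (app0 (s 2) d)})"
  by (intro defin)

lemma T_interp [defin]: "definable_op t \<Longrightarrow> definable_op u \<Longrightarrow> definable_op (\<lambda>s. interp (t s) (u s))"
  unfolding interp_def by (rule T_recF[OF interp_graph])

end

section \<open>Codes and measurable sets\<close>

lemma literal_set_inject [simp]: "literal_set l = literal_set l' \<longleftrightarrow> l = l'"
proof (induction l arbitrary: l')
  case (LRel R "is")
  have "inj (num :: nat \<Rightarrow> 'a)" by (simp add: inj_def)
  then show ?case by (cases l') (auto simp: inj_map_eq_map simp del: num.simps)
next
  case (LEq i j) then show ?case by (cases l') (auto simp del: num.simps)
next
  case (LNot l) then show ?case by (cases l') (auto simp del: num.simps)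
qed

lemma code_inject [simp]:
  "code_basic ls as = code_basic ls' as' \<longleftrightarrow> ls = ls' \<and> as = as'"
  "code_neg \<gamma> = code_neg \<gamma>' \<longleftrightarrow> \<gamma> = \<gamma>'"
  "code_Or \<gamma> = code_Or \<gamma>' \<longleftrightarrow> \<gamma> = \<gamma>'"
  "code_And \<gamma> = code_And \<gamma>' \<longleftrightarrow> \<gamma> = \<gamma>'"
proof -
  have "inj (literal_set :: 'a literal \<Rightarrow> 'a)" by (simp add: inj_def)
  then show "code_basic ls as = code_basic ls' as' \<longleftrightarrow> ls = ls' \<and> as = (as' :: 'a list)"
    by (simp add: code_basic_def inj_map_eq_map)
qed (simp_all add: code_neg_def code_Or_def code_And_def)

lemma code_distinct [simp]:
  "code_basic ls as \<noteq> code_neg \<gamma>" "code_basic ls as \<noteq> code_Or \<gamma>" "code_basic ls as \<noteq> code_And \<gamma>"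
  "code_neg \<gamma> \<noteq> code_basic ls as" "code_neg \<gamma> \<noteq> code_Or \<gamma>'" "code_neg \<gamma> \<noteq> code_And \<gamma>'"
  "code_Or \<gamma> \<noteq> code_basic ls as" "code_Or \<gamma> \<noteq> code_neg \<gamma>'" "code_Or \<gamma> \<noteq> code_And \<gamma>'"
  "code_And \<gamma> \<noteq> code_basic ls as" "code_And \<gamma> \<noteq> code_neg \<gamma>'" "code_And \<gamma> \<noteq> code_Or \<gamma>'"
  by (simp_all add: code_basic_def code_neg_def code_Or_def code_And_def del: num.simps)

lemma tc_tup2: "x \<in> tc (tup [y, x])"
  using tc_trans[OF tc_opair(2) tc_opair(1)] by simp

lemma code_tc:
  "\<delta> \<in> tc (code_neg \<delta>)" "\<Gamma> \<in> tc (code_Or \<Gamma>)" "\<Gamma> \<in> tc (code_And \<Gamma>)"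
  unfolding code_neg_def code_Or_def code_And_def by (rule tc_tup2)+

lemma code_tc_elts:
  "\<delta> \<in> elts \<Gamma> \<Longrightarrow> \<delta> \<in> tc (code_Or \<Gamma>)" "\<delta> \<in> elts \<Gamma> \<Longrightarrow> \<delta> \<in> tc (code_And \<Gamma>)"
  using code_tc(2,3) tc_trans elts_tc by blast+

text \<open>The components of a code lie in its transitive closure, so cutting the recursion off
  there changes nothing.\<close>

lemma Interp_unfold: "Interp S \<gamma> = {M \<in> S.
     (\<exists>ls as. \<gamma> = code_basic ls as \<and> (\<forall>l\<in>set ls. lit_true M as l)) \<or>
     (\<exists>\<delta>. \<gamma> = code_neg \<delta> \<and> M \<notin> Interp S \<delta>) \<or>
     (\<exists>\<Gamma>. \<gamma> = code_Or \<Gamma> \<and> (\<exists>\<delta>\<in>elts \<Gamma>. M \<in> Interp S \<delta>)) \<or>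
     (\<exists>\<Gamma>. \<gamma> = code_And \<Gamma> \<and> (\<forall>\<delta>\<in>elts \<Gamma>. M \<in> Interp S \<delta>))}"
proof -
  let ?F = "\<lambda>I \<gamma>. {M \<in> S.
     (\<exists>ls as. \<gamma> = code_basic ls as \<and> (\<forall>l\<in>set ls. lit_true M as l)) \<or>
     (\<exists>\<delta>. \<gamma> = code_neg \<delta> \<and> M \<notin> I \<delta>) \<or>
     (\<exists>\<Gamma>. \<gamma> = code_Or \<Gamma> \<and> (\<exists>\<delta>\<in>elts \<Gamma>. M \<in> I \<delta>)) \<or>
     (\<exists>\<Gamma>. \<gamma> = code_And \<Gamma> \<and> (\<forall>\<delta>\<in>elts \<Gamma>. M \<in> I \<delta>))}"
  define I where "I = cut (Interp S) ({(x, y). mem x y}\<^sup>+) \<gamma>"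
  have cut: "I \<delta> = Interp S \<delta>" if "\<delta> \<in> tc \<gamma>" for \<delta>
    using that by (simp add: tc_def cut_def I_def)
  have cuts: "\<gamma> = code_neg \<delta> \<Longrightarrow> I \<delta> = Interp S \<delta>"
    "\<gamma> = code_Or \<Gamma> \<Longrightarrow> \<delta> \<in> elts \<Gamma> \<Longrightarrow> I \<delta> = Interp S \<delta>"
    "\<gamma> = code_And \<Gamma> \<Longrightarrow> \<delta> \<in> elts \<Gamma> \<Longrightarrow> I \<delta> = Interp S \<delta>" for \<delta> \<Gamma>
    by (rule cut, simp add: code_tc code_tc_elts)+
  have "Interp S \<gamma> = ?F I \<gamma>"
    unfolding Interp_def I_def by (subst wfrec[OF wf_tc]) (rule refl)
  also have "\<dots> = ?F (Interp S) \<gamma>"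
    using cuts by (intro Collect_cong) (auto; blast)
  finally show ?thesis .
qed

lemma Interp_simps [simp]:
  "Interp S (code_basic ls as) = {M \<in> S. \<forall>l\<in>set ls. lit_true M as l}"
  "Interp S (code_neg \<delta>) = S - Interp S \<delta>"
  "Interp S (code_Or \<Gamma>) = {M \<in> S. \<exists>\<delta>\<in>elts \<Gamma>. M \<in> Interp S \<delta>}"
  "Interp S (code_And \<Gamma>) = {M \<in> S. \<forall>\<delta>\<in>elts \<Gamma>. M \<in> Interp S \<delta>}"
  by (subst Interp_unfold, fastforce)+

context transitive_model
begin

lemma code_V [simp]:
  "code_neg \<delta> \<in> V \<longleftrightarrow> \<delta> \<in> V" "code_Or \<Gamma> \<in> V \<longleftrightarrow> \<Gamma> \<in> V" "code_And \<Gamma> \<in> V \<longleftrightarrow> \<Gamma> \<in> V"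
  by (simp_all add: code_neg_def code_Or_def code_And_def del: num.simps)

lemma T_code_neg [defin]: "definable_op t \<Longrightarrow> definable_op (\<lambda>s. code_neg (t s))"
  unfolding code_neg_def tup.simps by (intro defin)

lemma T_code_Or [defin]: "definable_op t \<Longrightarrow> definable_op (\<lambda>s. code_Or (t s))"
  unfolding code_Or_def tup.simps by (intro defin)

lemma T_code_And [defin]: "definable_op t \<Longrightarrow> definable_op (\<lambda>s. code_And (t s))"
  unfolding code_And_def tup.simps by (intro defin)

lemma literal_set_V: "L \<in> V \<Longrightarrow> wf_literal L n l \<Longrightarrow> literal_set l \<in> V"
proof (induction l)
  case (LRel R "is")
  then have "opair R (num (length is)) \<in> V" using trans[of L "opair R (num (length is))"] by (simp add: has_arity_def)
  then show ?case by auto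
qed (auto simp del: num.simps)

lemma lit_val:
  assumes M: "M = opair Y I" "M \<in> V" and as: "set as \<subseteq> V" and L: "L \<in> V"
  shows "wf_literal L (length as) l \<Longrightarrow>
    lit_val (opair M (tup as)) (literal_set l) = (if lit_true M as l then num 1 else num 0)"
proof (induction l)
  case (LRel R "is")
  then show ?case
    unfolding lit_val_def by (subst recF) (simp add: sel_tup as holds_def M(1) del: num.simps)
next
  case (LEq i j)
  then show ?case
    unfolding lit_val_def by (subst recF) (simp add: fst0_drop_tup as del: num.simps)
next
  case (LNot l)
  have p: "opair M (tup as) \<in> V" and l: "literal_set l \<in> V" using M as literal_set_V[OF L] LNot(2) by auto
  have "literal_set l \<in> tc (literal_set (LNot l))"
    using code_tc(1)[of "literal_set l"] 
    by (metis tc_opair tc_trans literal_set.simps(3) tup.simps)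
  from memo_recF[OF lit_val_graph p _ this] have
    "lit_val (opair M (tup as)) (literal_set (LNot l)) =
      (if lit_val (opair M (tup as)) (literal_set l) = num 1 then num 0 else num 1)"
    using l unfolding lit_val_def[symmetric]
    by (subst lit_val_def, subst recF, subst lit_val_def[symmetric]) (simp del: num.simps)
  then show ?case using LNot by (simp del: num.simps)
qed

lemma lits_val:
  assumes M: "M = opair Y I" "M \<in> V" and as: "set as \<subseteq> V" and L: "L \<in> V"
  shows "\<forall>l\<in>set ls. wf_literal L (length as) l \<Longrightarrow>
    lits_val (opair M (tup as)) (tup (map literal_set ls)) = (if \<forall>l\<in>set ls. lit_true M as l then num 1 else num 0)"
proof (induction ls)
  case Nil
  show ?case unfolding lits_val_def tup.simps list.map by (subst lrec_Nil) (intro defin | simp del: num.simps)+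
next
  case (Cons l ls)
  have p: "opair M (tup as) \<in> V" using M as by simp
  have "set (map literal_set ls) \<subseteq> V" "literal_set l \<in> V" using Cons literal_set_V[OF L] by auto
  then have "lits_val (opair M (tup as)) (tup (map literal_set (l # ls))) = (if lit_val (opair M (tup as)) (literal_set l) = num 1
      then lits_val (opair M (tup as)) (tup (map literal_set ls)) else num 0)"
    unfolding lits_val_def tup.simps list.map using p by (subst lrec_Cons) (intro defin | simp del: num.simps)+
  then show ?case using Cons lit_val[OF M as L, of l] by (simp del: num.simps)
qed

lemma interp_neg: "p \<in> V \<Longrightarrow> \<delta> \<in> V \<Longrightarrow> interp p (code_neg \<delta>) = diff2 p (interp p \<delta>)"
proof -
  assume "p \<in> V" "\<delta> \<in> V"
  then have "app0 (memo (code_neg \<delta>) (interp p)) \<delta> = interp p \<delta>"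
    unfolding interp_def by (intro memo_recF[OF interp_graph] code_tc) auto
  then show ?thesis
    unfolding interp_def by (subst recF) (simp add: code_neg_def del: num.simps)
qed

lemma elts_interp_Or:
  assumes "p \<in> V" "\<Gamma> \<in> V"
  shows "elts (interp p (code_Or \<Gamma>)) = {M \<in> elts p. \<exists>\<delta>\<in>elts \<Gamma>. M \<in> elts (interp p \<delta>)}"
proof -
  have m: "app0 (memo (code_Or \<Gamma>) (interp p)) \<delta> = interp p \<delta>" if "\<delta> \<in> elts \<Gamma>" for \<delta>
    unfolding interp_def using that assms by (intro memo_recF[OF interp_graph] code_tc_elts) auto
  have "inV {M \<in> elts p. \<exists>\<delta>\<in>elts \<Gamma>. M \<in> elts (interp p \<delta>)}"
    by (rule inV_sep) (intro defin T_const assms)+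
  moreover have "interp p (code_Or \<Gamma>) = mk {M \<in> elts p. \<exists>\<delta>\<in>elts \<Gamma>. M \<in> elts (interp p \<delta>)}"
    using m unfolding interp_def by (subst recF) (simp add: code_Or_def del: num.simps cong: bex_cong)
  ultimately show ?thesis by (simp add: inV_D)
qed

lemma elts_interp_And:
  assumes "p \<in> V" "\<Gamma> \<in> V"
  shows "elts (interp p (code_And \<Gamma>)) = {M \<in> elts p. \<forall>\<delta>\<in>elts \<Gamma>. M \<in> elts (interp p \<delta>)}"
proof -
  have m: "app0 (memo (code_And \<Gamma>) (interp p)) \<delta> = interp p \<delta>" if "\<delta> \<in> elts \<Gamma>" for \<delta>
    unfolding interp_def using that assms by (intro memo_recF[OF interp_graph] code_tc_elts) auto
  have "inV {M \<in> elts p. \<forall>\<delta>\<in>elts \<Gamma>. M \<in> elts (interp p \<delta>)}"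
    by (rule inV_sep) (intro defin T_const assms)+
  moreover have "interp p (code_And \<Gamma>) = mk {M \<in> elts p. \<forall>\<delta>\<in>elts \<Gamma>. M \<in> elts (interp p \<delta>)}"
    using m unfolding interp_def by (subst recF) (simp add: code_And_def del: num.simps cong: ball_cong)
  ultimately show ?thesis by (simp add: inV_D)
qed

lemma interp_V [simp]: "p \<in> V \<Longrightarrow> q \<in> V \<Longrightarrow> interp p q \<in> V"
  using T_in[OF T_interp[OF T_const T_const], of p q "\<lambda>_. p"] by simp

lemma T_app0_const: "f \<in> V \<Longrightarrow> definable_op (\<lambda>s. app0 f (s 0))"
  by (intro defin T_const)

lemma inV_app_image: "f \<in> V \<Longrightarrow> is_function f A \<Longrightarrow> A \<in> V \<Longrightarrow> inV (app f ` elts A)"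
  using inV_image[OF T_app0_const, of f A] by (simp add: app_app0 cong: image_cong_simp)

end

text \<open>All atomic facts that could hold on \<open>X\<close>: interpretations on
  \<open>X\<close> are exactly the subsets of this set, which puts the space of structures of
  \<open>V\<close> into \<open>V\<close>.\<close>

definition atoms :: "'u::set_universe \<Rightarrow> 'u \<Rightarrow> 'u" where
  "atoms L X = Union1 (mk ((\<lambda>e. mk ((\<lambda>t. opair (fst0 e) t) ` elts (tuples X (snd0 e)))) ` elts L))"

section \<open>The space of structures and its measurable sets\<close>

locale structures_in_model = transitive_model V for V :: "'u::set_universe set" +
  fixes \<kappa> X L :: 'u
  assumes \<kappa>: "\<kappa> \<in> V" "is_ordinal \<kappa>" "infinite (elts \<kappa>)"
    and X: "X \<in> V" "infinite (elts X)"
    and L: "L \<in> V" "relational_language L"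
begin

lemma language: "e \<in> elts L \<Longrightarrow> \<exists>R n. e = opair R (num n)"
proof -
  assume e: "e \<in> elts L"
  obtain S where S: "is_function L S" "app L ` elts S \<subseteq> elts omega"
    using L(2) unfolding relational_language_def by blast
  then obtain R where "R \<in> elts S" "e = opair R (app L R)" using e elts_function[OF S(1)] by blast
  then show ?thesis using S(2) by auto
qed

lemma has_arity_V: "has_arity L R n \<Longrightarrow> R \<in> V"
  using trans[OF L(1), of "opair R (num n)"] by (simp add: has_arity_def)

lemma XV: "x \<in> elts X \<Longrightarrow> x \<in> V"
  using trans X by blast

lemma atoms: assumes "Y \<in> V"
  shows "atoms L Y \<in> V" "elts (atoms L Y) = {opair R (tup as) | R as. has_arity L R (length as) \<and> set as \<subseteq> elts Y}"
proof -
  have T1: "definable_op (\<lambda>s. mk ((\<lambda>t. opair (fst0 (s 0)) t) ` elts (tuples Y (snd0 (s 0)))))"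
    by (intro defin T_const assms)
  have e1: "elts (mk ((\<lambda>t. opair R t) ` elts (tuples Y (num n)))) = {opair R (tup as) | as. length as = n \<and> set as \<subseteq> elts Y}"
    if "R \<in> V" for R n
  proof -
    have "definable_op (\<lambda>s. opair R (s 0))" by (intro defin T_const that)
    moreover have "tuples Y (num n) \<in> V"
      using T_in[OF T_tuples[OF T_const T_num], of Y "\<lambda>_. Y"] assms by simp
    ultimately show ?thesis
      using elts_image[of "opair R" "tuples Y (num n)"] elts_tuples[OF assms] by auto
  qed
  show "atoms L Y \<in> V" unfolding atoms_def Union1_def by (intro inV_D(1)[OF inV_Union] image_V T1 L)
  have "elts (atoms L Y) = (\<Union>e\<in>elts L. elts (mk ((\<lambda>t. opair (fst0 e) t) ` elts (tuples Y (snd0 e)))))"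
    unfolding atoms_def elts_ops elts_image[OF T1 L(1)] by simp
  also have "\<dots> = {opair R (tup as) | R as. has_arity L R (length as) \<and> set as \<subseteq> elts Y}" (is "?A = ?B")
  proof (intro set_eqI iffI)
    fix z assume "z \<in> ?A"
    then obtain e where e: "e \<in> elts L" "z \<in> elts (mk ((\<lambda>t. opair (fst0 e) t) ` elts (tuples Y (snd0 e))))" by blast
    obtain R n where Rn: "e = opair R (num n)" using language[OF e(1)] by blast
    then have h: "has_arity L R n" using e(1) by (simp add: has_arity_def)
    show "z \<in> ?B" using e(2) h e1[OF has_arity_V[OF h], of n] unfolding Rn by auto
  next
    fix z assume "z \<in> ?B"
    then obtain R as where z: "z = opair R (tup as)" "has_arity L R (length as)" "set as \<subseteq> elts Y" by blast
    then show "z \<in> ?A"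
      using e1[OF has_arity_V[OF z(2)], of "length as"] by (intro UN_I[of "opair R (num (length as))"]) (auto simp: has_arity_def)
  qed
  finally show "elts (atoms L Y) = {opair R (tup as) | R as. has_arity L R (length as) \<and> set as \<subseteq> elts Y}" .
qed

definition S :: 'u where "S = mk ((\<lambda>I. opair X I) ` elts (pow (atoms L X)))"

lemma TX: "definable_op (\<lambda>s. opair X (s 0))"
  by (intro defin T_const X)

lemma pow_V [simp]: "a \<in> V \<Longrightarrow> pow a \<in> V"
  using T_in[OF T_pow[OF T_const], of a "\<lambda>_. a"] by simp

lemma S_V [simp]: "S \<in> V"
  unfolding S_def by (rule image_V[OF TX]) (simp add: atoms X)

lemma elts_S: "elts S = Str V L X"
proof -
  have "elts S = opair X ` elts (pow (atoms L X))"
    unfolding S_def by (rule elts_image[OF TX]) (simp add: atoms X)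
  also have "\<dots> = Str V L X"
    unfolding Str_def structures_on_def
    using elts_pow[OF atoms(1)[OF X(1)]] atoms(2)[OF X(1)] X(1) by auto
  finally show ?thesis .
qed

lemma S_struct: "M \<in> elts S \<Longrightarrow> M \<in> V \<and> (\<exists>I. M = opair X I)"
  unfolding elts_S Str_def structures_on_def by auto

text \<open>Strong induction. A membership-minimal \<open>x\<close> in \<open>\<kappa>\<close>
  outside \<open>num n\<close> has all its elements in \<open>num n\<close>. By transitivity it is
  an initial segment, hence some \<open>num i\<close> with \<open>i \<le> n\<close>, and
  \<open>i < n\<close> is excluded by the choice of \<open>x\<close>.\<close>

lemma omega_subset_kappa: "elts omega \<subseteq> elts \<kappa>"
proof -
  have tr: "x \<in> elts \<kappa> \<Longrightarrow> y \<in> elts x \<Longrightarrow> y \<in> elts \<kappa>" "x \<in> elts \<kappa> \<Longrightarrow> y \<in> elts x \<Longrightarrow> z \<in> elts y \<Longrightarrow> z \<in> elts x" for x y z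
    using \<kappa>(2) unfolding is_ordinal_def by blast+
  have "num n \<in> elts \<kappa>" for n
  proof (induction n rule: less_induct)
    case (less n)
    have "\<not> elts \<kappa> \<subseteq> elts (num n)" using \<kappa>(3) finite_subset[of "elts \<kappa>" "elts (num n)"] by (auto simp: elts_num)
    then obtain x0 where "x0 \<in> elts \<kappa> - elts (num n)" by blast
    from wfE_min[OF wf_mem this] obtain x where x: "x \<in> elts \<kappa>" "x \<notin> elts (num n)"
      "\<And>y. y \<in> elts x \<Longrightarrow> y \<notin> elts \<kappa> - elts (num n)" by (auto simp: mem_elts)
    have sub: "elts x \<subseteq> elts (num n)" using x tr(1) by blast
    show ?case
    proof (cases "elts (num n) \<subseteq> elts x")
      case True
      then have "x = num n" using sub elts_inject[of x "num n"] by simp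
      then show ?thesis using x by simp
    next
      case False
      then have "\<exists>i. num i \<notin> elts x \<and> i < n" by (auto simp: elts_num)
      then obtain i where i: "num i \<notin> elts x" "i < n" "\<And>j. j < i \<Longrightarrow> num j \<in> elts x"
        using exists_least_iff[of "\<lambda>i. num i \<notin> elts x \<and> i < n"] by (metis less_trans)
      have "elts x \<subseteq> elts (num i)"
      proof
        fix y assume y: "y \<in> elts x"
        then obtain j where j: "y = num j" "j < n" using sub by (auto simp: elts_num)
        have "\<not> i < j" using tr(2)[OF x(1) y, of "num i"] i(1) j(1) by auto
        moreover have "j \<noteq> i" using i(1) y j by auto
        ultimately show "y \<in> elts (num i)" using j by simp
      qed
      then have "x = num i" using i(3) elts_inject[of x "num i"] by (auto simp: elts_num)
      then show ?thesis using x(2) i(2) by simp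
    qed
  qed
  then show ?thesis by auto
qed

abbreviation \<Sigma> where "\<Sigma> \<equiv> measurable_sets V \<kappa> L X"

lemma S_lit_val:
  assumes "M \<in> elts S" "set as \<subseteq> V" "wf_literal L (length as) l"
  shows "lit_val (opair M (tup as)) (literal_set l) = num 1 \<longleftrightarrow> lit_true M as l"
proof -
  obtain I where "M = opair X I" "M \<in> V" using S_struct[OF assms(1)] by blast
  from lit_val[OF this assms(2) L(1) assms(3)] show ?thesis by (simp del: num.simps)
qed

lemma S_lits_val:
  assumes "M \<in> elts S" "set as \<subseteq> V" "\<forall>l\<in>set ls. wf_literal L (length as) l"
  shows "lits_val (opair M (tup as)) (tup (map literal_set ls)) = num 1 \<longleftrightarrow> (\<forall>l\<in>set ls. lit_true M as l)"
proof -
  obtain I where "M = opair X I" "M \<in> V" using S_struct[OF assms(1)] by blast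
  from lits_val[OF this assms(2) L(1) assms(3)] show ?thesis by (simp del: num.simps)
qed

lemma lit_set_V:
  assumes "set as \<subseteq> elts X" "wf_literal L (length as) l"
  shows "inV {M \<in> elts S. lit_true M as l}"
proof -
  have as: "set as \<subseteq> V" using assms XV by auto
  have "inV {M \<in> elts S. lit_val (opair M (tup as)) (literal_set l) = num 1}"
    by (rule inV_sep) (intro defin T_const | simp add: as literal_set_V[OF L(1) assms(2)] del: num.simps)+
  moreover have "{M \<in> elts S. lit_val (opair M (tup as)) (literal_set l) = num 1} = {M \<in> elts S. lit_true M as l}"
    using S_lit_val[OF _ as assms(2)] by blast
  ultimately show ?thesis by simp
qed

lemma \<Sigma>_lit:
  assumes "set as \<subseteq> elts X" "wf_literal L (length as) l" "elts A = {M \<in> elts S. lit_true M as l}"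
  shows "A \<in> \<Sigma>"
  using measurable_sets.basic[OF assms(1,2), of V \<kappa>] assms(3)
  unfolding elts_S[symmetric] by (metis mk_elts)

lemma \<Sigma>_V_subset: "A \<in> \<Sigma> \<Longrightarrow> A \<in> V \<and> elts A \<subseteq> elts S"
proof (induction rule: measurable_sets.induct)
  case (basic as l)
  then show ?case using inV_D[OF lit_set_V[OF basic]] by (auto simp: elts_S)
next
  case (complement A)
  then show ?case
    using inV_D(1)[OF inV_diff2, of S A] by (auto simp flip: elts_S diff2_def)
next
  case (union F)
  then show ?case
    using inV_D(1)[OF inV_Union, of F] by (auto simp flip: elts_S Union1_def)
qed

lemma \<Sigma>_compl: "A \<in> \<Sigma> \<Longrightarrow> elts B = elts S - elts A \<Longrightarrow> B \<in> \<Sigma>"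
  using measurable_sets.complement[of A V \<kappa> L X] by (metis elts_S mk_elts)

lemma \<Sigma>_UN:
  assumes f: "definable_op (\<lambda>s. f (s 0))" and a: "a \<in> V" "elts a \<subseteq> elts \<kappa>" "\<And>z. z \<in> elts a \<Longrightarrow> f z \<in> \<Sigma>"
    and B: "elts B = (\<Union>z\<in>elts a. elts (f z))"
  shows "B \<in> \<Sigma>"
proof -
  define F where "F = mk (f ` elts a)"
  have F: "F \<in> V" "elts F = f ` elts a" unfolding F_def using image_V[OF f a(1)] elts_image[OF f a(1)] by auto
  \<comment> \<open>The closure rule asks for an injection of the family itself into
    \<open>\<kappa>\<close>. Choosing in \<open>V\<close> an index for every member turns the
    indexing, which may repeat members, into one.\<close>
  have "definable (\<lambda>s. s 1 \<in> elts a \<and> f (s 1) = s 0)"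
    by (intro defin T_op1[OF f] T_const a)
  moreover have "\<exists>z\<in>V. z \<in> elts a \<and> f z = A" if "A \<in> elts F" for A
    using that F(2) trans[OF a(1)] by auto
  ultimately obtain j where j: "j \<in> V" "is_function j F" "\<forall>A\<in>elts F. app j A \<in> elts a \<and> f (app j A) = A"
    using choice[of "\<lambda>A z. z \<in> elts a \<and> f z = A" F] F(1) by blast
  have "size_le V F \<kappa>" unfolding size_le_def
    using j a(2) by (intro bexI[of _ j] conjI) (auto intro!: inj_onI, metis)
  moreover have "\<forall>A\<in>elts F. A \<in> \<Sigma>" using F(2) a(3) by auto
  ultimately have "mk (\<Union>A\<in>elts F. elts A) \<in> \<Sigma>" using F(1) by (intro measurable_sets.union)
  moreover have "(\<Union>A\<in>elts F. elts A) = elts B" using B F(2) by auto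
  ultimately show ?thesis by simp
qed

lemma \<Sigma>_empty: "mk {} \<in> \<Sigma>"
  by (rule \<Sigma>_UN[of "\<lambda>x. x" "mk {}"]) (auto intro: T_var)

lemma S_\<Sigma>: "S \<in> \<Sigma>"
  by (rule \<Sigma>_compl[OF \<Sigma>_empty]) simp

lemma \<Sigma>_Un: assumes "A \<in> \<Sigma>" "B \<in> \<Sigma>" "elts C = elts A \<union> elts B" shows "C \<in> \<Sigma>"
proof (rule \<Sigma>_UN[of "\<lambda>x. if x = mk {} then A else B" "num 2"])
  show "definable_op (\<lambda>s. if s 0 = mk {} then A else B)"
    using assms \<Sigma>_V_subset by (intro defin T_const) auto
  show "elts (num 2) \<subseteq> elts \<kappa>" using omega_subset_kappa by (auto simp: elts_num)
  have "elts (num 2 :: 'u) = {mk {}, num 1}"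
    by (auto simp: elts_num image_iff less_2_cases_iff numeral_2_eq_2 lessThan_Suc)
  moreover have "num 1 \<noteq> (mk {} :: 'u)" using num_Suc_nonempty[of 0] by simp
  ultimately show "elts C = (\<Union>z\<in>elts (num 2). elts (if z = (mk {} :: 'u) then A else B))"
    using assms by auto
qed (use assms in auto)

lemma \<Sigma>_Int: assumes "A \<in> \<Sigma>" "B \<in> \<Sigma>" "elts C = elts A \<inter> elts B" shows "C \<in> \<Sigma>"
proof -
  have "union2 (diff2 S A) (diff2 S B) \<in> \<Sigma>"
    using \<Sigma>_compl[OF assms(1), of "diff2 S A"] \<Sigma>_compl[OF assms(2), of "diff2 S B"]
    by (intro \<Sigma>_Un[of "diff2 S A" "diff2 S B" "union2 (diff2 S A) (diff2 S B)"]) simp_all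
  then show ?thesis
    by (rule \<Sigma>_compl) (use assms \<Sigma>_V_subset in auto)
qed

lemma \<Sigma>_Diff: assumes "A \<in> \<Sigma>" "B \<in> \<Sigma>" "elts C = elts A - elts B" shows "C \<in> \<Sigma>"
  by (rule \<Sigma>_Int[OF assms(1) \<Sigma>_compl[OF assms(2)], of "diff2 S B"]) (use assms \<Sigma>_V_subset in auto)

lemma \<Sigma>_INT:
  assumes f: "definable_op (\<lambda>s. f (s 0))" and a: "a \<in> V" "elts a \<subseteq> elts \<kappa>" "\<And>z. z \<in> elts a \<Longrightarrow> f z \<in> \<Sigma>"
    and B: "elts B = {M \<in> elts S. \<forall>z\<in>elts a. M \<in> elts (f z)}"
  shows "B \<in> \<Sigma>"
proof -
  have definable_op: "definable_op (\<lambda>s. diff2 S (f (s 0)))" by (intro defin T_op1[OF f] T_const S_V)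
  define U where "U = Union1 (mk ((\<lambda>z. diff2 S (f z)) ` elts a))"
  have U: "elts U = (\<Union>z\<in>elts a. elts (diff2 S (f z)))"
    unfolding U_def elts_ops elts_image[OF definable_op a(1)] by simp
  have "U \<in> \<Sigma>" by (rule \<Sigma>_UN[OF definable_op a(1,2) _ U]) (rule \<Sigma>_compl[OF a(3)], auto)
  then show ?thesis by (rule \<Sigma>_compl) (use U B in auto)
qed

abbreviation codes where "codes \<equiv> borel_codes V \<kappa> L X"

abbreviation int where "int \<equiv> interp S"

text \<open>Bridge between the external interpretation, used by the definition of the forcing, and
  the definable one, used for dense sets in \<open>V\<close>.\<close>

lemma codes_interp: "q \<in> codes \<Longrightarrow> q \<in> V \<and> int q \<in> \<Sigma> \<and> elts (int q) = Interp (Str V L X) q"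
proof (induction rule: borel_codes.induct)
  case (basic as ls)
  have as: "set as \<subseteq> V" using basic XV by auto
  have lV: "set (map literal_set ls) \<subseteq> V" using basic literal_set_V[OF L(1)] by auto
  have q: "code_basic ls as \<in> V" using as lV by (simp add: code_basic_def del: num.simps)
  have "inV {M \<in> elts S. lits_val (opair M (tup as)) (tup (map literal_set ls)) = num 1}"
    by (rule inV_sep) (intro defin T_const | use as lV in \<open>simp del: num.simps\<close>)+
  moreover have "int (code_basic ls as) = mk {M \<in> elts S. lits_val (opair M (tup as)) (tup (map literal_set ls)) = num 1}"
    unfolding interp_def by (subst recF) (simp add: code_basic_def del: num.simps)
  moreover have "{M \<in> elts S. lits_val (opair M (tup as)) (tup (map literal_set ls)) = num 1} =
      {M \<in> elts S. \<forall>l\<in>set ls. lit_true M as l}"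
    using S_lits_val[OF _ as basic(2)] by blast
  ultimately have e: "elts (int (code_basic ls as)) = {M \<in> elts S. \<forall>l\<in>set ls. lit_true M as l}"
    by (simp add: inV_D)
  have "A \<in> \<Sigma>" if "elts A = {M \<in> elts S. \<forall>l\<in>set ls. lit_true M as l}" for A
    using basic(2) that
  proof (induction ls arbitrary: A)
    case Nil then show ?case using S_\<Sigma> elts_inject[of A S] by simp
  next
    case (Cons l ls)
    have i: "inV {M \<in> elts S. lit_true M as l}" using lit_set_V basic Cons by simp
    let ?A = "mk {M \<in> elts S. lit_true M as l}"
    have a: "?A \<in> \<Sigma>" by (rule \<Sigma>_lit[OF basic(1)]) (use Cons i in \<open>auto simp: inV_D\<close>)
    \<comment> \<open>Before the induction hypothesis can be applied to the remaining conjuncts, the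
      set they define must be known to be a set of the universe.\<close>
    have "\<exists>B. elts B = {M \<in> elts S. \<forall>l\<in>set ls. lit_true M as l}"
    proof -
      have "set (map literal_set ls) \<subseteq> V" using Cons literal_set_V[OF L(1)] by auto
      then have "inV {M \<in> elts S. lits_val (opair M (tup as)) (tup (map literal_set ls)) = num 1}"
        by (intro inV_sep) (intro defin T_const | use as in \<open>simp del: num.simps\<close>)+
      moreover have "{M \<in> elts S. lits_val (opair M (tup as)) (tup (map literal_set ls)) = num 1} =
          {M \<in> elts S. \<forall>l\<in>set ls. lit_true M as l}"
        using S_lits_val[OF _ as, of _ ls] Cons(2) by auto
      ultimately show ?thesis unfolding inV_def by auto
    qed
    then obtain B where B: "elts B = {M \<in> elts S. \<forall>l\<in>set ls. lit_true M as l}" by blast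
    show ?case by (rule \<Sigma>_Int[OF a Cons.IH[OF _ B]]) (use Cons B i in \<open>auto simp: inV_D\<close>)
  qed
  then show ?case using q e by (simp add: elts_S)
next
  case (neg \<gamma>)
  then show ?case using \<Sigma>_compl[of "int \<gamma>"] by (simp add: interp_neg elts_S)
next
  case (Or f)
  have \<Gamma>: "mk (app f ` elts \<kappa>) \<in> V" "elts (mk (app f ` elts \<kappa>)) = app f ` elts \<kappa>"
    using inV_D[OF inV_app_image[OF Or(1,2) \<kappa>(1)]] by auto
  have e: "elts (int (code_Or (mk (app f ` elts \<kappa>)))) = (\<Union>z\<in>elts \<kappa>. elts (int (app0 f z)))"
    unfolding elts_interp_Or[OF S_V \<Gamma>(1)] \<Gamma>(2)
    using Or(3) \<Sigma>_V_subset app_app0[OF Or(2)] by (fastforce simp: elts_S)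
  have "int (code_Or (mk (app f ` elts \<kappa>))) \<in> \<Sigma>"
    by (rule \<Sigma>_UN[OF _ \<kappa>(1) order_refl _ e])
      (use Or app_app0[OF Or(2)] in \<open>auto intro!: T_interp T_app0_const T_const\<close>)
  then show ?case using \<Gamma> Or(3) by (auto simp: elts_interp_Or elts_S)
next
  case (And f)
  have \<Gamma>: "mk (app f ` elts \<kappa>) \<in> V" "elts (mk (app f ` elts \<kappa>)) = app f ` elts \<kappa>"
    using inV_D[OF inV_app_image[OF And(1,2) \<kappa>(1)]] by auto
  have e: "elts (int (code_And (mk (app f ` elts \<kappa>)))) = {M \<in> elts S. \<forall>z\<in>elts \<kappa>. M \<in> elts (int (app0 f z))}"
    unfolding elts_interp_And[OF S_V \<Gamma>(1)] \<Gamma>(2)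
    using app_app0[OF And(2)] by auto
  have "int (code_And (mk (app f ` elts \<kappa>))) \<in> \<Sigma>"
    by (rule \<Sigma>_INT[OF _ \<kappa>(1) order_refl _ e])
      (use And app_app0[OF And(2)] in \<open>auto intro!: T_interp T_app0_const T_const\<close>)
  then show ?case using \<Gamma> And(3) by (auto simp: elts_interp_And elts_S)
qed

end

section \<open>Codes for all measurable sets\<close>

text \<open>Recursion on numerals naturally lists the smaller numbers downwards. The reversal is
  compensated in \<open>simple_code_literal\<close> by reversing the tuple.\<close>

definition descending :: "'u::set_universe \<Rightarrow> 'u" where
  "descending = nrec (\<lambda>p. mk {}) (\<lambda>p n r. opair n r) (mk {})"

context transitive_model
begin

lemma T_descending [defin]: "definable_op t \<Longrightarrow> definable_op (\<lambda>s. descending (t s))"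
  unfolding descending_def by (rule T_nrec) (intro defin | assumption)+

lemma descending: "descending (num n :: 'u) = tup (map num (rev [0..<n]))"
proof (induction n)
  case 0
  have "descending (mk {}) = (mk {} :: 'u)" unfolding descending_def by (rule nrec_0) (intro defin)+
  then show ?case by simp
next
  case (Suc n)
  have "descending (num (Suc n) :: 'u) = opair (num n) (descending (num n))"
    unfolding descending_def by (rule nrec_Suc) (intro defin mk_empty_V)+
  then show ?case using Suc by simp
qed

end

context structures_in_model
begin

text \<open>Codes are formed from families indexed by all of \<open>\<kappa>\<close>; a nonempty
  shorter family is padded by repeating one of its members.\<close>

lemma codes_family:
  assumes f: "definable_op (\<lambda>s. f (s 0))" and a: "a \<in> V" "elts a \<subseteq> elts \<kappa>" "elts a \<noteq> {}"
    and c: "\<And>z. z \<in> elts a \<Longrightarrow> f z \<in> codes"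
  shows "code_Or (mk (f ` elts a)) \<in> codes" "code_And (mk (f ` elts a)) \<in> codes"
proof -
  obtain i where i: "i \<in> elts a" using a by blast
  then have iV: "i \<in> V" using trans a by blast
  let ?g = "\<lambda>z. if z \<in> elts a then f z else f i"
  have Tg: "definable_op (\<lambda>s. ?g (s 0))" by (intro defin T_op1[OF f] T_const a iV)
  note l = lam[OF Tg \<kappa>(1)]
  have "app (lam \<kappa> ?g) ` elts \<kappa> = ?g ` elts \<kappa>" by (rule image_cong) (simp_all add: l(4))
  also have "\<dots> = f ` elts a" using a(2) i by auto
  finally have e: "app (lam \<kappa> ?g) ` elts \<kappa> = f ` elts a" .
  have "\<forall>z\<in>elts \<kappa>. app (lam \<kappa> ?g) z \<in> codes" using c i by (simp add: l(4))
  then show "code_Or (mk (f ` elts a)) \<in> codes" "code_And (mk (f ` elts a)) \<in> codes"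
    using borel_codes.Or[OF l(1,3)] borel_codes.And[OF l(1,3)] unfolding e by auto
qed

definition atom_code :: "'u \<Rightarrow> 'u \<Rightarrow> 'u" where
  "atom_code e t = tup [num 0, tup [tup [num 0, fst0 e, descending (snd0 e)]], t]"

text \<open>The empty conjunction is added as a code of the whole space. Equality of two fixed
  parameters does not depend on the structure, so it is coded by this or by its negation.\<close>

definition atom_codes :: 'u where
  "atom_codes = (union2 (upair (code_basic [] []) (code_basic [] []))
    (Union1 (mk ((\<lambda>e. mk ((\<lambda>t. atom_code e t) ` elts (tuples X (snd0 e)))) ` elts L))))"

lemma T_atom_code [defin]: "definable_op t \<Longrightarrow> definable_op u \<Longrightarrow> definable_op (\<lambda>s. atom_code (t s) (u s))"
  unfolding atom_code_def tup.simps by (intro defin)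

lemma atom_code: "atom_code (opair R (num n)) (tup as) = code_basic [LRel R (rev [0..<n])] as"
  by (simp add: atom_code_def code_basic_def descending del: num.simps)

lemma atom_codes_V: "atom_codes \<in> V"
  and elts_atom_codes: "elts atom_codes = insert (code_basic [] [])
    {code_basic [LRel R (rev [0..<length as])] as | R as. has_arity L R (length as) \<and> set as \<subseteq> elts X}"
proof -
  have T1: "definable_op (\<lambda>s. mk ((\<lambda>t. atom_code (s 0) t) ` elts (tuples X (snd0 (s 0)))))"
    by (intro defin T_const X)
  have e1: "elts (mk ((\<lambda>t. atom_code (opair R (num n)) t) ` elts (tuples X (num n)))) =
      {code_basic [LRel R (rev [0..<n])] as | as. length as = n \<and> set as \<subseteq> elts X}"
    if "R \<in> V" for R n
  proof -
    have "definable_op (\<lambda>s. atom_code (opair R (num n)) (s 0))" by (intro defin T_const that)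
    moreover have "tuples X (num n) \<in> V"
      using T_in[OF T_tuples[OF T_const T_num], of X "\<lambda>_. X"] X by simp
    ultimately have "elts (mk ((\<lambda>t. atom_code (opair R (num n)) t) ` elts (tuples X (num n)))) =
       (\<lambda>t. atom_code (opair R (num n)) t) ` elts (tuples X (num n))"
      by (rule elts_image)
    then show ?thesis using elts_tuples[OF X(1)] by (simp add: setcompr_eq_image image_image atom_code)
  qed
  have 1: "code_basic [] [] \<in> V" by (simp add: code_basic_def del: num.simps)
  show "atom_codes \<in> V"
    unfolding atom_codes_def union2_def
    by (intro inV_D(1)[OF inV_union2]) (use inV_D(1)[OF inV_pair[OF 1 1]] in \<open>simp_all add: upair_def Union1_def inV_D inV_Union image_V[OF T1 L(1)]\<close>)
  have "elts atom_codes = insert (code_basic [] [])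
      (\<Union>e\<in>elts L. elts (mk ((\<lambda>t. atom_code e t) ` elts (tuples X (snd0 e)))))" (is "_ = insert _ ?A")
    unfolding atom_codes_def elts_ops elts_image[OF T1 L(1)] by simp
  also have "?A = {code_basic [LRel R (rev [0..<length as])] as | R as. has_arity L R (length as) \<and> set as \<subseteq> elts X}" (is "_ = ?B")
  proof (intro set_eqI iffI)
    fix z assume "z \<in> ?A"
    then obtain e where e: "e \<in> elts L" "z \<in> elts (mk ((\<lambda>t. atom_code e t) ` elts (tuples X (snd0 e))))" by blast
    obtain R n where Rn: "e = opair R (num n)" using language[OF e(1)] by blast
    then have h: "has_arity L R n" using e(1) by (simp add: has_arity_def)
    show "z \<in> ?B" using e(2) h e1[OF has_arity_V[OF h], of n] unfolding Rn by auto
  next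
    fix z assume "z \<in> ?B"
    then obtain R as where z: "z = code_basic [LRel R (rev [0..<length as])] as" "has_arity L R (length as)" "set as \<subseteq> elts X" by blast
    then show "z \<in> ?A"
      using e1[OF has_arity_V[OF z(2)], of "length as"] by (intro UN_I[of "opair R (num (length as))"]) (auto simp: has_arity_def)
  qed
  finally show "elts atom_codes = insert (code_basic [] []) ?B" .
qed

lemma atom_codes_codes: "\<gamma> \<in> elts atom_codes \<Longrightarrow> \<gamma> \<in> codes"
  unfolding elts_atom_codes by (auto intro!: borel_codes.basic)

text \<open>Membership in the class of codes generated by \<open>atom_codes\<close>, negations and disjunctions. This class
  is definable over \<open>V\<close>, and it suffices to code all measurable sets.\<close>

definition simple_val :: "'u \<Rightarrow> 'u" where
  "simple_val = recF (\<lambda>p g h. if g \<in> elts atom_codes then num 1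
    else if g = code_neg (fst0 (snd0 g)) then app0 h (fst0 (snd0 g))
    else if g = code_Or (fst0 (snd0 g)) \<and> (\<exists>f\<in>V. fst0 (snd0 g) = mk ((\<lambda>i. app0 f i) ` elts \<kappa>)) \<and>
      (\<forall>d\<in>elts (fst0 (snd0 g)). app0 h d = num 1) then num 1 else num 0) (mk {})"

abbreviation simple_code :: "'u \<Rightarrow> bool" where "simple_code \<gamma> \<equiv> simple_val \<gamma> = num 1"

lemma simple_graph: "definable_op (\<lambda>s. if s 1 \<in> elts atom_codes then num 1
    else if s 1 = code_neg (fst0 (snd0 (s 1))) then app0 (s 2) (fst0 (snd0 (s 1)))
    else if s 1 = code_Or (fst0 (snd0 (s 1))) \<and> (\<exists>f\<in>V. fst0 (snd0 (s 1)) = mk ((\<lambda>i. app0 f i) ` elts \<kappa>)) \<and>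
      (\<forall>d\<in>elts (fst0 (snd0 (s 1))). app0 (s 2) d = num 1) then num 1 else num 0)"
  by (intro defin T_const atom_codes_V \<kappa>)

lemma T_simple_val [defin]: "definable_op t \<Longrightarrow> definable_op (\<lambda>s. simple_val (t s))"
  unfolding simple_val_def by (rule T_recF[OF simple_graph]) (intro defin)

lemma code_args [simp]: "fst0 (snd0 (code_neg \<delta>)) = \<delta>" "fst0 (snd0 (code_Or \<delta>)) = \<delta>"
  by (simp_all add: code_neg_def code_Or_def)

lemma simple_atom: "\<gamma> \<in> elts atom_codes \<Longrightarrow> simple_code \<gamma>"
  unfolding simple_val_def by (subst recF) simp

lemma atom_codes_neg_Or: "code_neg \<delta> \<notin> elts atom_codes" "code_Or \<delta> \<notin> elts atom_codes"
  unfolding elts_atom_codes by auto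

lemma simple_neg: "\<delta> \<in> V \<Longrightarrow> simple_val (code_neg \<delta>) = simple_val \<delta>"
proof -
  assume "\<delta> \<in> V"
  then have "app0 (memo (code_neg \<delta>) simple_val) \<delta> = simple_val \<delta>"
    unfolding simple_val_def by (intro memo_recF[OF simple_graph] code_tc) auto
  then show ?thesis unfolding simple_val_def by (subst recF) (simp add: atom_codes_neg_Or)
qed

lemma simple_Or: "\<Gamma> \<in> V \<Longrightarrow> simple_code (code_Or \<Gamma>) \<longleftrightarrow>
  (\<exists>f\<in>V. \<Gamma> = mk ((\<lambda>i. app0 f i) ` elts \<kappa>)) \<and> (\<forall>d\<in>elts \<Gamma>. simple_code d)"
proof -
  assume \<Gamma>: "\<Gamma> \<in> V"
  have *: "app0 (memo (code_Or \<Gamma>) simple_val) \<delta> = simple_val \<delta>" if "\<delta> \<in> elts \<Gamma>" for \<delta>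
    unfolding simple_val_def using that \<Gamma> by (intro memo_recF[OF simple_graph] code_tc_elts) auto
  have "num 1 \<noteq> (num 0 :: 'u)" unfolding num_inject by simp
  moreover have "simple_val (code_Or \<Gamma>) = (if (\<exists>f\<in>V. \<Gamma> = mk ((\<lambda>i. app0 f i) ` elts \<kappa>)) \<and>
      (\<forall>d\<in>elts \<Gamma>. app0 (memo (code_Or \<Gamma>) simple_val) d = num 1) then num 1 else num 0)"
    unfolding simple_val_def by (subst recF) (simp add: atom_codes_neg_Or)
  ultimately show ?thesis using * by (simp cong: ball_cong del: num.simps num_inject)
qed

lemma simple_codes: "\<gamma> \<in> V \<Longrightarrow> simple_code \<gamma> \<Longrightarrow> \<gamma> \<in> codes"
proof (induction \<gamma> rule: tc_induct)
  case (tc \<gamma>)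
  have one: "num 0 \<noteq> (num 1 :: 'u)" unfolding num_inject by simp
  have "\<gamma> \<in> elts atom_codes \<or> \<gamma> = code_neg (fst0 (snd0 \<gamma>)) \<or> \<gamma> = code_Or (fst0 (snd0 \<gamma>))"
    using tc(3) one unfolding simple_val_def
    by (subst (asm) recF) (auto simp del: num.simps num_inject split: if_splits)
  then consider "\<gamma> \<in> elts atom_codes" | \<delta> where "\<gamma> = code_neg \<delta>" | \<Gamma> where "\<gamma> = code_Or \<Gamma>" by blast
  then show ?case
  proof cases
    case 1 then show ?thesis by (rule atom_codes_codes)
  next
    case 2
    then show ?thesis using tc code_tc(1)[of \<delta>] simple_neg[of \<delta>] by (auto intro: borel_codes.neg)
  next
    case 3
    then have \<Gamma>V: "\<Gamma> \<in> V" using tc(2) by simp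
    then obtain f where f: "f \<in> V" "\<Gamma> = mk ((\<lambda>i. app0 f i) ` elts \<kappa>)" "\<forall>d\<in>elts \<Gamma>. simple_code d"
      using simple_Or[OF \<Gamma>V] tc(3) 3 by blast
    have Tf: "definable_op (\<lambda>s. app0 f (s 0))" by (intro T_app0_const f)
    have e: "elts \<Gamma> = (\<lambda>i. app0 f i) ` elts \<kappa>" unfolding f(2) by (rule elts_image[OF Tf \<kappa>(1)])
    have "d \<in> codes" if d: "d \<in> elts \<Gamma>" for d
      using tc(1)[of d] code_tc_elts(1)[OF d] f(3) d trans[OF \<Gamma>V d] 3 by simp
    then have "code_Or (mk ((\<lambda>i. app0 f i) ` elts \<kappa>)) \<in> codes"
      using \<kappa>(3) by (intro codes_family[OF Tf \<kappa>(1)]) (auto simp: e)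
    then show ?thesis using 3 f(2) by simp
  qed
qed

lemma int_true: "int (code_basic [] []) = S"
  using codes_interp[OF borel_codes.basic[of "[]" X "[]" L V \<kappa>]] elts_S by (simp add: elts_inject[symmetric])

lemma simple_code_literal:
  assumes "set as \<subseteq> elts X" "wf_literal L (length as) l"
  shows "\<exists>\<gamma>\<in>V. simple_code \<gamma> \<and> elts (int \<gamma>) = {M \<in> elts S. lit_true M as l}"
  using assms(2)
proof (induction l)
  case (LRel R "is")
  \<comment> \<open>Repetitions and permutations of variables are absorbed into the parameters, so
    that one fixed atomic formula for each symbol is enough.\<close>
  define bs where "bs = rev (map (nth as) is)"
  let ?c = "code_basic [LRel R (rev [0..<length bs])] bs"
  have bs: "set bs \<subseteq> elts X" "has_arity L R (length bs)" using LRel assms(1) by (auto simp: bs_def)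
  then have c: "?c \<in> elts atom_codes" unfolding elts_atom_codes by blast
  have "map (nth bs) (rev [0..<length bs]) = map (nth as) is"
    by (simp only: rev_map[symmetric] map_nth) (simp add: bs_def)
  then have "elts (int ?c) = {M \<in> elts S. lit_true M as (LRel R is)}"
    using codes_interp[OF atom_codes_codes[OF c]] by (simp add: elts_S)
  then show ?case using simple_atom[OF c] trans[OF atom_codes_V c] by blast
next
  case (LEq i j)
  let ?t = "code_basic [] []"
  have t: "?t \<in> elts atom_codes" unfolding elts_atom_codes by simp
  have tV: "?t \<in> V" using trans[OF atom_codes_V t] .
  show ?case
  proof (cases "as ! i = as ! j")
    case True
    then show ?thesis using simple_atom[OF t] tV int_true by (intro bexI[of _ ?t]) auto
  next
    case False
    then show ?thesis
      using simple_atom[OF t] tV int_true simple_neg[OF tV] interp_neg[OF S_V tV]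
      by (intro bexI[of _ "code_neg ?t"]) auto
  qed
next
  case (LNot l)
  then obtain \<gamma> where "\<gamma> \<in> V" "simple_code \<gamma>" "elts (int \<gamma>) = {M \<in> elts S. lit_true M as l}" by auto
  then show ?case
    using simple_neg interp_neg[OF S_V] by (intro bexI[of _ "code_neg \<gamma>"]) auto
qed

text \<open>In the union step codes for all members must be chosen at once by a function in
  \<open>V\<close>. Here it matters that being a simple code is definable over
  \<open>V\<close>.\<close>

lemma simple_code_measurable: "A \<in> \<Sigma> \<Longrightarrow> \<exists>\<gamma>\<in>V. simple_code \<gamma> \<and> int \<gamma> = A"
proof (induction rule: measurable_sets.induct)
  case (basic as l)
  then show ?case
    using simple_code_literal[OF basic] unfolding elts_S[symmetric] by (metis mk_elts)
next
  case (complement A)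
  then obtain \<gamma> where "\<gamma> \<in> V" "simple_code \<gamma>" "int \<gamma> = A" by blast
  then show ?case
    using simple_neg interp_neg[OF S_V] unfolding elts_S[symmetric]
    by (intro bexI[of _ "code_neg \<gamma>"]) (auto simp: diff2_def)
next
  case (union F)
  obtain j where j: "j \<in> V" "is_function j F" "app j ` elts F \<subseteq> elts \<kappa>" "inj_on (app j) (elts F)"
    using union(2) unfolding size_le_def by blast
  have j0: "app j A = app0 j A" if "A \<in> elts F" for A using app_app0[OF j(2) that] .
  \<comment> \<open>A code of the empty set, to be used at the indices in \<open>\<kappa>\<close>
    outside the range of the injection \<open>j\<close>.\<close>
  obtain z where z: "z \<in> V" "simple_code z" "elts (int z) = {}"
  proof
    let ?t = "code_basic [] []"
    have t: "?t \<in> elts atom_codes" unfolding elts_atom_codes by simp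
    have tV: "?t \<in> V" using trans[OF atom_codes_V t] .
    show "code_neg ?t \<in> V" "simple_code (code_neg ?t)" "elts (int (code_neg ?t)) = {}"
      using simple_atom[OF t] tV int_true simple_neg[OF tV] interp_neg[OF S_V tV] by auto
  qed
  define R where "R i \<gamma> \<longleftrightarrow> simple_code \<gamma> \<and>
    ((\<exists>A\<in>elts F. app0 j A = i \<and> int \<gamma> = A) \<or> (\<not> (\<exists>A\<in>elts F. app0 j A = i) \<and> \<gamma> = z))" for i \<gamma>
  have "definable (\<lambda>s. R (s 0) (s 1))"
    unfolding R_def by (intro defin T_const j z union S_V)
  moreover have "\<exists>\<gamma>\<in>V. R i \<gamma>" for i
    unfolding R_def using union(3) z by metis
  ultimately obtain f where f: "f \<in> V" "is_function f \<kappa>" "\<forall>i\<in>elts \<kappa>. app f i \<in> V \<and> R i (app f i)"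
    using choice[of R \<kappa>] \<kappa>(1) by blast
  have Tf: "definable_op (\<lambda>s. app0 f (s 0))" by (intro T_app0_const f)
  define \<Gamma> where "\<Gamma> = mk ((\<lambda>i. app0 f i) ` elts \<kappa>)"
  have \<Gamma>: "\<Gamma> \<in> V" "elts \<Gamma> = (\<lambda>i. app0 f i) ` elts \<kappa>"
    unfolding \<Gamma>_def by (rule image_V[OF Tf \<kappa>(1)], rule elts_image[OF Tf \<kappa>(1)])
  have fR: "R i (app0 f i)" if "i \<in> elts \<kappa>" for i
    using bspec[OF f(3) that] app_app0[OF f(2) that] by simp
  have "simple_code (code_Or \<Gamma>)"
    unfolding simple_Or[OF \<Gamma>(1)] using f(1) fR \<Gamma>(2) by (auto simp: \<Gamma>_def R_def)
  moreover have "elts (int (code_Or \<Gamma>)) = (\<Union>A\<in>elts F. elts A)"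
  proof (intro set_eqI iffI)
    fix M assume "M \<in> elts (int (code_Or \<Gamma>))"
    then obtain i where "i \<in> elts \<kappa>" "M \<in> elts (int (app0 f i))"
      unfolding elts_interp_Or[OF S_V \<Gamma>(1)] \<Gamma>(2) by blast
    then show "M \<in> (\<Union>A\<in>elts F. elts A)" using fR[of i] z(3) unfolding R_def by auto
  next
    fix M assume "M \<in> (\<Union>A\<in>elts F. elts A)"
    then obtain A where A: "A \<in> elts F" "M \<in> elts A" by blast
    have i: "app0 j A \<in> elts \<kappa>" using j(3) j0 A by auto
    \<comment> \<open>By injectivity of \<open>j\<close>, no other member of \<open>F\<close> can
      have been coded at the index of \<open>A\<close>.\<close>
    have "int (app0 f (app0 j A)) = A"
    proof -
      obtain B where "B \<in> elts F" "app0 j B = app0 j A" "int (app0 f (app0 j A)) = B"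
        using fR[OF i] A(1) unfolding R_def by blast
      then show ?thesis using j(4) j0 A(1) by (metis inj_onD)
    qed
    then show "M \<in> elts (int (code_Or \<Gamma>))"
      unfolding elts_interp_Or[OF S_V \<Gamma>(1)] \<Gamma>(2) using A i \<Sigma>_V_subset[of A] union(3)
      by (auto intro!: bexI[of _ "app0 j A"])
  qed
  moreover have "code_Or \<Gamma> \<in> V" using \<Gamma> by simp
  ultimately show ?case by (metis mk_elts)
qed

end

section \<open>Invariant measures\<close>

lemma represents_real_iff:
  assumes "represents_real c r" shows "opair (num a) (num b) \<in> elts c \<longleftrightarrow> real a < real b * r"
proof -
  have "elts c = {opair (num m) (num n) | m n. real m < real n * r}"
    using assms by (simp add: represents_real_def)
  then show ?thesis by (simp del: num.simps)
qed

lemma represents_real_unique: "represents_real c r \<Longrightarrow> represents_real c r' \<Longrightarrow> r = r'"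
proof (induction r r' rule: linorder_wlog)
  case (le r r')
  show ?case
  proof (rule ccontr)
    assume "r \<noteq> r'"
    then have "r < r'" using le(1) by simp
    then obtain q where q: "q \<in> \<rat>" "r < q" "q < r'" using Rats_dense_in_real by blast
    have "0 \<le> r" using le(2) by (simp add: represents_real_def)
    then obtain m n where mn: "n \<noteq> 0" "\<bar>q\<bar> = real m / real n" using q(1) by (metis Rats_abs_nat_div_natE)
    then have "q = real m / real n" using q(2) \<open>0 \<le> r\<close> by simp
    then have "real m < real n * r'" "\<not> real m < real n * r"
      using mult_strict_right_mono[OF q(2), of "real n"] mult_strict_right_mono[OF q(3), of "real n"] mn(1)
      by (auto simp: mult.commute)
    then show False using represents_real_iff[OF le(2), of m n] represents_real_iff[OF le(3), of m n] by simp
  qed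
qed auto

locale measured_structures = structures_in_model V \<kappa> X L for V :: "'u::set_universe set" and \<kappa> X L +
  fixes \<nu> :: 'u
  assumes \<nu>: "\<nu> \<in> V" "invariant_measure V \<kappa> L X \<nu>"
begin

abbreviation m :: "'u \<Rightarrow> real" where "m \<equiv> meas \<nu>"

lemma prob: "probability_measure V \<kappa> L X \<nu>"
  using \<nu>(2) by (simp add: invariant_measure_def)

text \<open>The domain of a function in \<open>V\<close> is in \<open>V\<close>, so
  \<open>\<nu>\<close> itself witnesses that the measurable sets form an element of
  \<open>V\<close>.\<close>

lemma measurable_set: "\<exists>\<Omega>\<in>V. elts \<Omega> = \<Sigma> \<and> is_function \<nu> \<Omega>"
proof -
  obtain \<Omega> where \<Omega>: "elts \<Omega> = \<Sigma>" "is_function \<nu> \<Omega>" using prob unfolding probability_measure_def by blast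
  have "definable_op (\<lambda>s. fst0 (s 0))" by (intro defin)
  from image_V[OF this \<nu>(1)] have "mk (fst0 ` elts \<nu>) \<in> V" .
  moreover have "fst0 ` elts \<nu> = elts \<Omega>" using elts_function[OF \<Omega>(2)] by (simp add: image_image)
  ultimately have "\<Omega> \<in> V" by simp
  then show ?thesis using \<Omega> by blast
qed

lemma m_represents: "A \<in> \<Sigma> \<Longrightarrow> represents_real (app \<nu> A) (m A)"
proof -
  assume A: "A \<in> \<Sigma>"
  obtain r where r: "represents_real (app \<nu> A) r" using prob A unfolding probability_measure_def by blast
  have "m A = r" unfolding meas_def by (rule the_equality) (rule r, rule represents_real_unique[OF _ r])
  then show ?thesis using r by simp
qed

lemma m_nonneg: "A \<in> \<Sigma> \<Longrightarrow> 0 \<le> m A"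
  using m_represents[of A] by (simp add: represents_real_def)

text \<open>Comparison of a measure with a rational becomes a membership statement about
  \<open>\<nu>\<close>, hence definable over \<open>V\<close>, although \<open>m\<close> takes real
  values outside.\<close>

lemma m_cut: "A \<in> \<Sigma> \<Longrightarrow> opair (num a) (num b) \<in> elts (app0 \<nu> A) \<longleftrightarrow> real a < real b * m A"
proof -
  assume A: "A \<in> \<Sigma>"
  obtain \<Omega> where \<Omega>: "elts \<Omega> = \<Sigma>" "is_function \<nu> \<Omega>" using measurable_set by blast
  show ?thesis using m_represents[OF A] app_app0[OF \<Omega>(2), of A] A \<Omega>(1) represents_real_iff by fastforce
qed

lemma m_empty: "m (mk {}) = 0" and m_S: "m S = 1"
  using prob elts_S mk_elts[of S] unfolding probability_measure_def by metis+

lemma m_sums: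
  assumes f: "definable_op (\<lambda>s. f (s 0))" "\<And>n. f (num n) \<in> \<Sigma>"
    and disj: "\<And>i j. i \<noteq> j \<Longrightarrow> elts (f (num i)) \<inter> elts (f (num j)) = {}"
    and B: "elts B = (\<Union>n. elts (f (num n)))"
  shows "(\<lambda>n. m (f (num n))) sums m B"
proof -
  note l = lam[OF f(1) omega_V]
  have a: "app (lam omega f) z = f z" if "z \<in> elts omega" for z by (rule l(4)[OF that])
  have "(\<Union>i\<in>elts omega. elts (app (lam omega f) i)) = elts B" using B a by auto
  moreover have "additive_over V \<Sigma> omega \<nu>" using prob by (simp add: probability_measure_def)
  moreover have "app (lam omega f) ` elts omega \<subseteq> \<Sigma>" using a f(2) by auto
  moreover have "\<forall>i\<in>elts omega. \<forall>j\<in>elts omega. i \<noteq> j \<longrightarrow> elts (app (lam omega f) i) \<inter> elts (app (lam omega f) j) = {}"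
    using a disj by auto
  ultimately have "((\<lambda>i. m (app (lam omega f) i)) has_sum m B) (elts omega)"
    using l(1,3) unfolding additive_over_def by (metis mk_elts)
  then have "((\<lambda>i. m (f i)) has_sum m B) (range num)"
    by (subst has_sum_cong[of "range num" _ "\<lambda>i. m (app (lam omega f) i)"]) (simp_all add: a)
  then have "((\<lambda>n. m (f (num n))) has_sum m B) UNIV"
    by (subst (asm) has_sum_reindex) (simp_all add: inj_def comp_def)
  then show ?thesis by (rule has_sum_imp_sums)
qed

lemma m_Un: assumes "A \<in> \<Sigma>" "B \<in> \<Sigma>" "elts A \<inter> elts B = {}" "elts C = elts A \<union> elts B"
  shows "m C = m A + m B"
proof -
  let ?f = "\<lambda>z::'u. if z = num 0 then A else if z = num 1 then B else mk {}"
  have f: "?f (num n) = (if n = 0 then A else if n = 1 then B else mk {})" for n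
    unfolding num_inject by simp
  have "(\<lambda>n. m (?f (num n))) sums m C"
  proof (rule m_sums[where f = ?f])
    show "definable_op (\<lambda>s. ?f (s 0))" using assms \<Sigma>_V_subset by (intro defin T_const) auto
    show "elts C = (\<Union>n. elts (?f (num n)))"
    proof -
      let ?U = "\<Union>n. elts (?f (num n))"
      have "elts A \<subseteq> ?U" using UN_upper[of 0 UNIV "\<lambda>n. elts (?f (num n))"] unfolding f by simp
      moreover have "elts B \<subseteq> ?U" using UN_upper[of 1 UNIV "\<lambda>n. elts (?f (num n))"] unfolding f by simp
      moreover have "?U \<subseteq> elts A \<union> elts B" unfolding f by (auto split: if_splits)
      ultimately show ?thesis using assms(4) by blast
    qed
  qed (unfold f, use assms \<Sigma>_empty in auto)
  moreover have "(\<lambda>n. m (?f (num n))) sums (\<Sum>n\<in>{0, 1}. m (?f (num n)))"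
    by (rule sums_finite) (unfold f, auto simp: m_empty)
  ultimately have "m C = (\<Sum>n\<in>{0, 1}. m (?f (num n)))" by (rule sums_unique2)
  then show ?thesis unfolding f by simp
qed

lemma m_diff: assumes "A \<in> \<Sigma>" "B \<in> \<Sigma>" "elts B \<subseteq> elts A" "elts C = elts A - elts B"
  shows "m C = m A - m B"
proof -
  have "C \<in> \<Sigma>" by (rule \<Sigma>_Diff[OF assms(1,2,4)])
  then have "m A = m C + m B" by (rule m_Un) (use assms in auto)
  then show ?thesis by simp
qed

lemma m_mono: assumes "A \<in> \<Sigma>" "B \<in> \<Sigma>" "elts B \<subseteq> elts A" shows "m B \<le> m A"
proof -
  have "diff2 A B \<in> \<Sigma>" by (rule \<Sigma>_Diff[OF assms(1,2)]) simp
  then show ?thesis using m_diff[OF assms, of "diff2 A B"] m_nonneg[of "diff2 A B"] by simp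
qed

lemma num_subset_kappa: "elts (num n) \<subseteq> elts \<kappa>"
  using omega_subset_kappa by (auto simp: elts_num)

lemma m_subadditive:
  assumes f: "definable_op (\<lambda>s. f (s 0))" "\<And>n. f (num n) \<in> \<Sigma>"
    and B: "elts B = (\<Union>n. elts (f (num n)))"
    and b: "\<And>n. m (f (num n)) \<le> b n" "b sums s"
  shows "m B \<le> s"
proof -
  \<comment> \<open>The sets are made disjoint by removing from each the union \<open>u\<close> of
    its predecessors. This is done by definable operations because additivity covers only sequences
    in \<open>V\<close>.\<close>
  define u where "u z = Union1 (mk (f ` elts z))" for z
  define g where "g z = diff2 (f z) (u z)" for z
  have Tu: "definable_op (\<lambda>s. u (s 0))" unfolding u_def by (intro defin T_op1[OF f(1)])
  have Tg: "definable_op (\<lambda>s. g (s 0))" unfolding g_def by (intro defin T_op1[OF Tu] T_op1[OF f(1)])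
  have eu: "elts (u (num n)) = (\<Union>i<n. elts (f (num i)))" for n
    unfolding u_def elts_ops elts_image[OF f(1) num_V] by (simp add: elts_num)
  have u: "u (num n) \<in> \<Sigma>" for n
    by (rule \<Sigma>_UN[OF f(1) num_V num_subset_kappa]) (auto simp: eu elts_num f(2))
  have eg: "elts (g (num n)) = elts (f (num n)) - (\<Union>i<n. elts (f (num i)))" for n
    by (simp add: g_def eu)
  have g: "g (num n) \<in> \<Sigma>" for n unfolding g_def by (rule \<Sigma>_Diff[OF f(2) u]) simp
  have s: "(\<lambda>n. m (g (num n))) sums m B"
  proof (rule m_sums[OF Tg g])
    show "elts (g (num i)) \<inter> elts (g (num j)) = {}" if "i \<noteq> j" for i j
      using that unfolding eg by (cases i j rule: linorder_cases) auto
    show "elts B = (\<Union>n. elts (g (num n)))"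
      unfolding eg B 
      using UN_disjointed_eq[of "\<lambda>n. elts (f (num n))"] by (simp add: disjointed_def atLeast0LessThan)
  qed
  have "m (g (num n)) \<le> b n" for n
    using m_mono[OF f(2)[of n] g[of n]] b(1)[of n] by (auto simp: eg)
  then show ?thesis using s b(2) by (rule sums_le)
qed

text \<open>The successive differences are disjoint with union \<open>f 0\<close> minus
  \<open>B\<close>, and their measures telescope.\<close>

lemma m_continuous:
  assumes f: "definable_op (\<lambda>s. f (s 0))" "\<And>n. f (num n) \<in> \<Sigma>" "\<And>n. elts (f (num (Suc n))) \<subseteq> elts (f (num n))"
    and B: "B \<in> \<Sigma>" "elts B = (\<Inter>n. elts (f (num n)))"
  shows "(\<lambda>n. m (f (num n))) \<longlonglongrightarrow> m B"
proof -
  define g where "g z = diff2 (f z) (f (succ z))" for z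
  have Tg: "definable_op (\<lambda>s. g (s 0))" unfolding g_def by (intro defin T_op1[OF f(1)])
  have eg: "elts (g (num n)) = elts (f (num n)) - elts (f (num (Suc n)))" for n
    by (simp add: g_def num_Suc)
  have g: "g (num n) \<in> \<Sigma>" for n by (rule \<Sigma>_Diff[OF f(2) f(2) eg])
  have mg: "m (g (num n)) = m (f (num n)) - m (f (num (Suc n)))" for n
    by (rule m_diff[OF f(2) f(2) f(3) eg])
  have dec: "elts (f (num j)) \<subseteq> elts (f (num i))" if "i \<le> j" for i j
    using that f(3) by (rule lift_Suc_antimono_le[rotated])
  define C where "C = diff2 (f (num 0)) B"
  have C: "elts C = elts (f (num 0)) - elts B" by (simp add: C_def)
  have "(\<lambda>n. m (g (num n))) sums m C"
  proof (rule m_sums[OF Tg g])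
    show "elts (g (num i)) \<inter> elts (g (num j)) = {}" if "i \<noteq> j" for i j
    proof -
      have "elts (g (num i)) \<inter> elts (g (num j)) = {}" if "i < j" for i j
        using dec[of "Suc i" j] that unfolding eg by auto
      then show ?thesis using that by (metis Int_commute linorder_neqE_nat)
    qed
    show "elts C = (\<Union>n. elts (g (num n)))"
    proof (intro set_eqI iffI)
      fix M assume M: "M \<in> elts C"
      then have "\<exists>n. M \<notin> elts (f (num n))" using C B(2) by auto
      then obtain n where n: "M \<notin> elts (f (num n))" "\<And>k. k < n \<Longrightarrow> M \<in> elts (f (num k))"
        using exists_least_iff[of "\<lambda>n. M \<notin> elts (f (num n))"] by auto
      have "n \<noteq> 0" using n(1) M C by (cases n) (auto simp del: num.simps)
      then obtain k where "n = Suc k" by (cases n) auto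
      then show "M \<in> (\<Union>n. elts (g (num n)))" using n unfolding eg by auto
    next
      fix M assume "M \<in> (\<Union>n. elts (g (num n)))"
      then obtain n where n: "M \<in> elts (f (num n))" "M \<notin> elts (f (num (Suc n)))" unfolding eg by auto
      have "M \<notin> elts B" using n(2) B(2) by blast
      then show "M \<in> elts C" using dec[of 0 n] n(1) C by auto
    qed
  qed
  moreover have "m C = m (f (num 0)) - m B"
    by (rule m_diff[OF f(2) B(1) _ C]) (use B in blast)
  ultimately have "(\<lambda>n. \<Sum>i<n. m (f (num i)) - m (f (num (Suc i)))) \<longlonglongrightarrow> m (f (num 0)) - m B"
    unfolding sums_def mg by simp
  then have "(\<lambda>n. m (f (num 0)) - m (f (num n))) \<longlonglongrightarrow> m (f (num 0)) - m B"
    by (simp only: sum_lessThan_telescope'[of "\<lambda>i. m (f (num i))"])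
  from tendsto_diff[OF tendsto_const[of "m (f (num 0))"] this] show ?thesis by simp
qed

lemma code_meas: "q \<in> codes \<Longrightarrow> code_meas V L X \<nu> q = m (int q)"
  unfolding code_meas_def using codes_interp[of q] by (metis mk_elts)

end

section \<open>Transport of structures and exchangeability\<close>

definition transport :: "'u::set_universe \<Rightarrow> 'u \<Rightarrow> 'u" where
  "transport g I = mk ((\<lambda>e. opair (fst0 e) (map_tup g (snd0 e))) ` elts I)"

context transitive_model
begin

lemma transport:
  assumes g: "g \<in> V" "is_function g Y" and I: "I \<in> V"
    "elts I \<subseteq> {opair R (tup as) | R as. has_arity L R (length as) \<and> set as \<subseteq> elts Y}"
  shows "transport g I \<in> V"
    "elts (transport g I) = {opair R (tup (map (app g) as)) | R as. opair R (tup as) \<in> elts I}"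
proof -
  have T1: "definable_op (\<lambda>s. opair (fst0 (s 0)) (map_tup g (snd0 (s 0))))" by (intro defin T_const g)
  show "transport g I \<in> V" unfolding transport_def by (rule image_V[OF T1 I(1)])
  have *: "map_tup g (tup as) = tup (map (app g) as)" if "opair R (tup as) \<in> elts I" for R as
  proof -
    have "set as \<subseteq> elts Y" using subsetD[OF I(2) that] by simp
    then have "map (app0 g) as = map (app g) as" using app_app0[OF g(2)] by auto
    moreover have "set as \<subseteq> V" using trans[OF I(1) that] by simp
    ultimately show ?thesis using map_tup[OF g(1)] by simp
  qed
  have "elts (transport g I) = (\<lambda>e. opair (fst0 e) (map_tup g (snd0 e))) ` elts I"
    unfolding transport_def by (rule elts_image[OF T1 I(1)])
  also have "\<dots> = {opair R (tup (map (app g) as)) | R as. opair R (tup as) \<in> elts I}" (is "?A = ?B")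
  proof (intro set_eqI iffI)
    fix z assume "z \<in> ?A"
    then obtain e where e: "e \<in> elts I" "z = opair (fst0 e) (map_tup g (snd0 e))" by blast
    then obtain R as where "e = opair R (tup as)" using I(2) by auto
    then show "z \<in> ?B" using e * by auto
  next
    fix z assume "z \<in> ?B"
    then obtain R as where "z = opair R (tup (map (app g) as))" "opair R (tup as) \<in> elts I" by blast
    then show "z \<in> ?A" using * by (intro image_eqI[of _ _ "opair R (tup as)"]) auto
  qed
  finally show "elts (transport g I) = ?B" .
qed

text \<open>Such a function is the union of a restricted identity, obtained by replacement, and a
  finite set of pairs.\<close>

lemma finite_modification_V:
  assumes Y: "Y \<in> V" and Q: "finite Q" "\<And>x. x \<in> elts Y \<Longrightarrow> f x \<in> V" "\<And>x. x \<in> elts Y - Q \<Longrightarrow> f x = x"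
  obtains g where "g \<in> V" "is_function g Y" "\<And>x. x \<in> elts Y \<Longrightarrow> app g x = f x"
proof -
  have fin: "inV (elts Y \<inter> Q)" using trans[OF Y] Q(1) by (intro inV_finite) auto
  have d: "mk (elts Y \<inter> Q) \<in> V" "elts (mk (elts Y \<inter> Q)) = elts Y \<inter> Q" using inV_D[OF fin] by auto
  have c: "diff2 Y (mk (elts Y \<inter> Q)) \<in> V" unfolding diff2_def by (intro inV_D inV_diff2 Y d)
  have T1: "definable_op (\<lambda>s. opair (s 0) (s 0))" by (intro defin)
  have 1: "inV ((\<lambda>x. opair x x) ` elts (diff2 Y (mk (elts Y \<inter> Q))))" by (rule inV_image[OF T1 c])
  have 2: "inV ((\<lambda>x. opair x (f x)) ` (elts Y \<inter> Q))"
    using trans[OF Y] Q by (intro inV_finite) auto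
  have "inV ((\<lambda>x. opair x x) ` elts (diff2 Y (mk (elts Y \<inter> Q))) \<union> (\<lambda>x. opair x (f x)) ` (elts Y \<inter> Q))"
    using inV_union2[OF inV_D(1)[OF 1] inV_D(1)[OF 2]] by (simp only: inV_D(2)[OF 1] inV_D(2)[OF 2])
  moreover have "(\<lambda>x. opair x x) ` elts (diff2 Y (mk (elts Y \<inter> Q))) \<union> (\<lambda>x. opair x (f x)) ` (elts Y \<inter> Q)
      = (\<lambda>x. opair x (f x)) ` elts Y"
    using Q(3) d(2) by (auto simp: image_iff)
  ultimately have "inV ((\<lambda>x. opair x (f x)) ` elts Y)" by simp
  then obtain g where g: "g \<in> V" "elts g = (\<lambda>x. opair x (f x)) ` elts Y" unfolding inV_def by blast
  have fg: "is_function g Y" unfolding is_function_def g(2) by auto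
  have "app g x = f x" if "x \<in> elts Y" for x
    using is_function_app[OF fg that, of "f x"] g(2) that by auto
  then show ?thesis using that g(1) fg by blast
qed

end

lemma extend_to_permutation:
  assumes "finite F" "F \<subseteq> Y" "inj_on \<sigma> F" "\<sigma> ` F \<subseteq> Y"
  obtains p D where "finite D" "bij_betw p Y Y" "\<And>x. x \<in> F \<Longrightarrow> p x = \<sigma> x" "\<And>x. x \<in> Y - D \<Longrightarrow> p x = x"
    "D \<subseteq> Y" "p ` D = D"
proof -
  let ?D = "F \<union> \<sigma> ` F"
  have "card (\<sigma> ` F - F) = card (F - \<sigma> ` F)"
    using card_image[OF assms(3)] assms(1)
    by (simp add: card_Diff_subset_Int Int_commute)
  then obtain \<tau> where \<tau>: "bij_betw \<tau> (\<sigma> ` F - F) (F - \<sigma> ` F)"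
    using finite_same_card_bij[of "\<sigma> ` F - F" "F - \<sigma> ` F"] assms(1) by auto
  define p where "p x = (if x \<in> F then \<sigma> x else if x \<in> ?D then \<tau> x else x)" for x
  have "bij_betw p F (\<sigma> ` F)"
    unfolding p_def using assms(3) by (auto simp: bij_betw_def inj_on_def)
  moreover have "bij_betw p (\<sigma> ` F - F) (F - \<sigma> ` F)"
    by (rule bij_betw_cong[THEN iffD1, OF _ \<tau>]) (auto simp: p_def)
  ultimately have "bij_betw p (F \<union> (\<sigma> ` F - F)) (\<sigma> ` F \<union> (F - \<sigma> ` F))"
    by (rule bij_betw_combine) blast
  moreover have "F \<union> (\<sigma> ` F - F) = ?D" "\<sigma> ` F \<union> (F - \<sigma> ` F) = ?D" by auto
  ultimately have D: "bij_betw p ?D ?D" by simp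
  moreover have "bij_betw p (Y - ?D) (Y - ?D)"
    by (rule bij_betw_cong[THEN iffD1, OF _ bij_betw_id]) (auto simp: p_def)
  ultimately have "bij_betw p (?D \<union> (Y - ?D)) (?D \<union> (Y - ?D))"
    by (rule bij_betw_combine) blast
  moreover have "?D \<union> (Y - ?D) = Y" using assms by auto
  ultimately have "bij_betw p Y Y" by simp
  moreover have "p ` ?D = ?D" using D by (simp add: bij_betw_def)
  ultimately show ?thesis
    using that[of ?D p] assms by (auto simp: p_def)
qed

context structures_in_model
begin

text \<open>Invariance speaks of permutations in \<open>V\<close> only. One with finite support is
  in \<open>V\<close>, and so is its inverse \<open>g'\<close>, which \<open>act_image\<close> needs
  to pull structures back.\<close>

lemma permutation_V:
  assumes "finite F" "F \<subseteq> elts X" "inj_on \<sigma> F" "\<sigma> ` F \<subseteq> elts X"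
  obtains g g' where "g \<in> V" "is_function g X" "bij_betw (app g) (elts X) (elts X)" "\<And>x. x \<in> F \<Longrightarrow> app g x = \<sigma> x"
    "g' \<in> V" "is_function g' X" "\<And>x. x \<in> elts X \<Longrightarrow> app g' x \<in> elts X"
    "\<And>x. x \<in> elts X \<Longrightarrow> app g (app g' x) = x"
proof -
  obtain p Q where p: "finite Q" "bij_betw p (elts X) (elts X)" "\<And>x. x \<in> F \<Longrightarrow> p x = \<sigma> x"
    "\<And>x. x \<in> elts X - Q \<Longrightarrow> p x = x" "Q \<subseteq> elts X" "p ` Q = Q"
    using extend_to_permutation[OF assms] by metis
  let ?q = "inv_into (elts X) p"
  have q: "bij_betw ?q (elts X) (elts X)" using p(2) by (rule bij_betw_inv_into)
  have qid: "?q x = x" if "x \<in> elts X - Q" for x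
    using p(4)[OF that] that p(2) by (metis DiffD1 bij_betw_def inv_into_f_f)
  have pX: "p x \<in> elts X" and qX: "?q x \<in> elts X" if "x \<in> elts X" for x
    using that p(2) q by (auto simp: bij_betw_def)
  obtain g where g: "g \<in> V" "is_function g X" "\<And>x. x \<in> elts X \<Longrightarrow> app g x = p x"
    by (rule finite_modification_V[OF X(1) p(1), of p]) (use pX XV p(4) in auto)
  obtain g' where g': "g' \<in> V" "is_function g' X" "\<And>x. x \<in> elts X \<Longrightarrow> app g' x = ?q x"
    by (rule finite_modification_V[OF X(1) p(1), of ?q]) (use qX XV qid in auto)
  have "bij_betw (app g) (elts X) (elts X)"
    by (rule bij_betw_cong[THEN iffD1, OF _ p(2)]) (simp add: g(3))
  moreover have "app g x = \<sigma> x" if "x \<in> F" for x using that p(3) g(3) assms(2) by auto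
  moreover have "app g' x \<in> elts X" "app g (app g' x) = x" if "x \<in> elts X" for x
    using that g'(3) g(3) qX p(2) by (auto simp: bij_betw_def f_inv_into_f)
  ultimately show ?thesis using that g(1,2) g'(1,2) by blast
qed

lemma act:
  assumes g: "g \<in> V" "is_function g X" "\<And>x. x \<in> elts X \<Longrightarrow> app g x \<in> elts X" and M: "M \<in> elts S"
  shows "act g M \<in> elts S"
    "elts (psnd (act g M)) = {opair R (tup (map (app g) as)) | R as. opair R (tup as) \<in> elts (psnd M)}"
proof -
  obtain I where I: "M = opair X I"
    "elts I \<subseteq> {opair R (tup as) | R as. has_arity L R (length as) \<and> set as \<subseteq> elts X}" "M \<in> V"
    using M unfolding elts_S Str_def structures_on_def by blast
  have IV: "I \<in> V" using I by simp
  note t = transport[OF g(1,2) IV I(2)]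
  have "{opair R (tup (map (app g) as)) | R as. set as \<subseteq> elts (pfst M) \<and> holds M R as} = elts (transport g I)"
    unfolding t(2) using I(2) by (fastforce simp: I(1) holds_def)
  then have a: "act g M = opair X (transport g I)"
    unfolding act_def I(1) by simp
  show "elts (psnd (act g M)) = {opair R (tup (map (app g) as)) | R as. opair R (tup as) \<in> elts (psnd M)}"
    unfolding a using t(2) I(1) by simp
  have "elts (transport g I) \<subseteq> {opair R (tup as) | R as. has_arity L R (length as) \<and> set as \<subseteq> elts X}"
  proof
    fix z assume "z \<in> elts (transport g I)"
    then obtain R as where z: "z = opair R (tup (map (app g) as))" "opair R (tup as) \<in> elts I" unfolding t(2) by blast
    then have "has_arity L R (length as)" "set as \<subseteq> elts X" using subsetD[OF I(2) z(2)] by simp_all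
    then show "z \<in> {opair R (tup as) | R as. has_arity L R (length as) \<and> set as \<subseteq> elts X}"
      using z(1) g(3) by (intro CollectI exI[of _ R] exI[of _ "map (app g) as"]) auto
  qed
  then show "act g M \<in> elts S" unfolding a elts_S Str_def structures_on_def using t(1) X by auto
qed

text \<open>For the inclusion from right to left, \<open>act g' M\<close> is the structure in the
  left-hand set that \<open>act g\<close> sends to \<open>M\<close>.\<close>

lemma act_image:
  assumes g: "g \<in> V" "is_function g X" "bij_betw (app g) (elts X) (elts X)"
    and g': "g' \<in> V" "is_function g' X" "\<And>x. x \<in> elts X \<Longrightarrow> app g' x \<in> elts X"
      "\<And>x. x \<in> elts X \<Longrightarrow> app g (app g' x) = x"
    and W: "\<And>w. w \<in> W \<Longrightarrow> set w \<subseteq> elts X"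
  shows "act g ` {M \<in> elts S. \<forall>w\<in>W. holds M R w} = {M \<in> elts S. \<forall>w\<in>W. holds M R (map (app g) w)}"
proof (intro set_eqI iffI)
  have gX: "app g x \<in> elts X" if "x \<in> elts X" for x using g(3) that by (auto simp: bij_betw_def)
  have a: "act g M \<in> elts S"
      "elts (psnd (act g M)) = {opair R (tup (map (app g) as)) | R as. opair R (tup as) \<in> elts (psnd M)}"
    if "M \<in> elts S" for M
    using act[OF g(1,2) _ that] gX by blast+
  have a': "act g' M \<in> elts S"
      "elts (psnd (act g' M)) = {opair R (tup (map (app g') as)) | R as. opair R (tup as) \<in> elts (psnd M)}"
    if "M \<in> elts S" for M
    using act[OF g'(1,2) _ that] g'(3) by blast+
  have id: "app g' (app g x) = x" if "x \<in> elts X" for x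
    using g(3) g'(3,4) gX that by (metis bij_betw_def inj_onD)
  have Xs: "set as \<subseteq> elts X" if M: "M \<in> elts S" and as: "opair R (tup as) \<in> elts (psnd M)" for M R as
  proof -
    obtain I where I: "M = opair X I"
      "elts I \<subseteq> {opair R (tup as) | R as. has_arity L R (length as) \<and> set as \<subseteq> elts X}"
      using M unfolding elts_S Str_def structures_on_def by blast
    show ?thesis using subsetD[OF I(2), of "opair R (tup as)"] as I(1) by simp
  qed
  have ids: "map (app g') (map (app g) as) = as" "map (app g) (map (app g') as) = as" if "set as \<subseteq> elts X" for as
    using that id g'(4) by (auto simp: map_idI subset_iff)
  fix M
  show "M \<in> {M \<in> elts S. \<forall>w\<in>W. holds M R (map (app g) w)}" if M: "M \<in> act g ` {M \<in> elts S. \<forall>w\<in>W. holds M R w}"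
  proof -
    obtain N where N: "M = act g N" "N \<in> elts S" "\<And>w. w \<in> W \<Longrightarrow> holds N R w" using M by blast
    have "holds M R (map (app g) w)" if "w \<in> W" for w
      using N(3)[OF that] a(2)[OF N(2)] unfolding N(1) holds_def by blast
    then show ?thesis using a(1)[OF N(2)] N(1) by simp
  qed
  assume "M \<in> {M \<in> elts S. \<forall>w\<in>W. holds M R (map (app g) w)}"
  then have M: "M \<in> elts S" "\<And>w. w \<in> W \<Longrightarrow> holds M R (map (app g) w)" by auto
  define N where "N = act g' M"
  have N: "N \<in> elts S" "elts (psnd N) = {opair R (tup (map (app g') as)) | R as. opair R (tup as) \<in> elts (psnd M)}"
    unfolding N_def using a' M(1) by auto
  have "holds N R w" if w: "w \<in> W" for w
  proof -
    have "opair R (tup (map (app g') (map (app g) w))) \<in> elts (psnd N)"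
      unfolding N(2) using M(2)[OF w] unfolding holds_def by blast
    then show ?thesis unfolding ids(1)[OF W[OF w]] holds_def .
  qed
  moreover have "act g N = M"
  proof -
    have "elts (psnd (act g N)) = {opair R (tup (map (app g) (map (app g') as))) | R as. opair R (tup as) \<in> elts (psnd M)}"
      unfolding a(2)[OF N(1)] N(2) by (auto simp del: map_map)
    also have "\<dots> = {opair R (tup as) | R as. opair R (tup as) \<in> elts (psnd M)}"
      using ids(2) Xs[OF M(1)] by (metis (no_types, lifting))
    also have "\<dots> = elts (psnd M)"
      using M(1) unfolding elts_S Str_def structures_on_def by auto
    finally have "psnd (act g N) = psnd M" by (simp add: elts_inject)
    then show ?thesis using S_struct[OF M(1)] S_struct[OF a(1)[OF N(1)]] by auto
  qed
  ultimately show "M \<in> act g ` {M \<in> elts S. \<forall>w\<in>W. holds M R w}" using N(1) by blast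
qed

end

text \<open>Only finitely many points are mentioned, so \<open>\<sigma>\<close> extends to a
  permutation in \<open>V\<close>, which carries the first event onto the second.\<close>

lemma (in measured_structures) exchangeable:
  assumes "finite F" "F \<subseteq> elts X" "inj_on \<sigma> F" "\<sigma> ` F \<subseteq> elts X"
    and W: "\<And>w. w \<in> W \<Longrightarrow> set w \<subseteq> F"
    and A: "A \<in> \<Sigma>" "elts A = {M \<in> elts S. \<forall>w\<in>W. holds M R w}"
    and B: "elts B = {M \<in> elts S. \<forall>w\<in>W. holds M R (map \<sigma> w)}"
  shows "m B = m A"
proof -
  obtain g g' where g: "g \<in> V" "is_function g X" "bij_betw (app g) (elts X) (elts X)" "\<And>x. x \<in> F \<Longrightarrow> app g x = \<sigma> x"
    and g': "g' \<in> V" "is_function g' X" "\<And>x. x \<in> elts X \<Longrightarrow> app g' x \<in> elts X"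
    "\<And>x. x \<in> elts X \<Longrightarrow> app g (app g' x) = x"
    using permutation_V[OF assms(1-4)] by metis
  have "map (app g) w = map \<sigma> w" if "w \<in> W" for w
    using W[OF that] g(4) by auto
  then have "elts B = {M \<in> elts S. \<forall>w\<in>W. holds M R (map (app g) w)}"
    unfolding B by (intro Collect_cong conj_cong ball_cong refl) (simp only:)
  moreover have "set w \<subseteq> elts X" if "w \<in> W" for w using W[OF that] assms(2) by blast
  ultimately have "act g ` elts A = elts B"
    unfolding A(2) using act_image[OF g(1-3) g', of W R] by simp
  then show ?thesis using \<nu>(2) g(1-3) A(1) unfolding invariant_measure_def by (metis mk_elts)
qed

section \<open>A sequence of disjoint tuples\<close>

context structures_in_model
begin

text \<open>Choice in \<open>V\<close> assigns to each proper subset of \<open>X\<close> a point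
  outside it, and recursion applies this to the set of points found so far. Since \<open>X\<close>
  is infinite, that finite set is always proper.\<close>

lemma injective_sequence:
  obtains f where "definable_op (\<lambda>s. f (s 0))" "\<And>n. f (num n) \<in> elts X" "inj (\<lambda>n. f (num n))"
proof -
  define P where "P = mk {y \<in> elts (pow X). \<exists>z\<in>elts X. z \<notin> elts y}"
  have iP: "inV {y \<in> elts (pow X). \<exists>z\<in>elts X. z \<notin> elts y}"
    by (rule inV_sep) (intro defin T_const X pow_V)+
  have P: "P \<in> V" "elts P = {y \<in> V. elts y \<subset> elts X}"
    unfolding P_def inV_D(2)[OF iP] using inV_D[OF iP] elts_pow[OF X(1)] by auto
  have "definable (\<lambda>s. s 1 \<in> elts X \<and> s 1 \<notin> elts (s 0))" by (intro defin T_const X)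
  moreover have "\<exists>z\<in>V. z \<in> elts X \<and> z \<notin> elts y" if "y \<in> elts P" for y
    using that P(2) XV by blast
  ultimately obtain c where c: "c \<in> V" "is_function c P" "\<forall>y\<in>elts P. app c y \<in> V \<and> app c y \<in> elts X \<and> app c y \<notin> elts y"
    using choice[of "\<lambda>y z. z \<in> elts X \<and> z \<notin> elts y" P] P(1) by blast
  define f where "f = recF (\<lambda>p x h. app0 c (mk ((\<lambda>y. app0 h y) ` elts x))) (mk {})"
  have G: "definable_op (\<lambda>s. app0 c (mk ((\<lambda>y. app0 (s 2) y) ` elts (s 1))))" by (intro defin T_const c)
  have Tf: "definable_op (\<lambda>s. f (s 0))" unfolding f_def by (rule T_recF[OF G]) (intro defin)+
  have f: "f x = app0 c (mk (f ` elts x))" if "x \<in> V" for x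
  proof -
    have "(\<lambda>y. app0 (memo x f) y) ` elts x = f ` elts x"
      unfolding f_def by (rule image_cong) (simp_all add: memo_recF[OF G] that elts_tc)
    then show ?thesis unfolding f_def by (subst recF) simp
  qed
  have fn: "f (num n) \<in> elts X \<and> (\<forall>i<n. f (num n) \<noteq> f (num i))" for n
  proof (induction n rule: less_induct)
    case (less n)
    have e: "elts (mk (f ` elts (num n))) = f ` elts (num n)" by (rule elts_image[OF Tf]) simp
    have sub: "f ` elts (num n) \<subseteq> elts X" using less by (auto simp: elts_num)
    have "finite (f ` elts (num n))" by (simp add: elts_num)
    then have "f ` elts (num n) \<noteq> elts X" using X(2) by metis
    then have "mk (f ` elts (num n)) \<in> elts P"
      using e sub image_V[OF Tf num_V] unfolding P(2) by auto
    then have "f (num n) \<in> elts X \<and> f (num n) \<notin> f ` elts (num n)"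
      using c(3) app_app0[OF c(2)] f[OF num_V, of n] e by auto
    then show ?case by (auto simp: elts_num)
  qed
  have "inj (\<lambda>n. f (num n))"
    by (rule injI) (metis fn linorder_neqE_nat)
  then show ?thesis using that Tf fn by blast
qed

end

section \<open>Arithmetic of numerals in the model\<close>

definition times_num :: "nat \<Rightarrow> 'u::set_universe \<Rightarrow> 'u" where
  "times_num l = nrec (\<lambda>p. num 0) (\<lambda>p n r. (succ ^^ l) r) (mk {})"

context transitive_model
begin

lemma T_succ_pow [defin]: "definable_op t \<Longrightarrow> definable_op (\<lambda>s. (succ ^^ l) (t s))"
  by (induction l) (auto intro: T_succ)

lemma succ_pow: "(succ ^^ l) (num n) = num (n + l)"
  by (induction l) (auto simp: num_Suc)

lemma T_times_num [defin]: "definable_op t \<Longrightarrow> definable_op (\<lambda>s. times_num l (t s))"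
  unfolding times_num_def by (rule T_nrec) (intro defin | assumption)+

lemma times_num: "times_num l (num n :: 'u) = num (l * n)"
proof (induction n)
  case 0
  have "times_num l (mk {} :: 'u) = num 0" unfolding times_num_def by (rule nrec_0) (intro defin)+
  then show ?case by simp
next
  case (Suc n)
  have "times_num l (num (Suc n) :: 'u) = (succ ^^ l) (times_num l (num n))"
    unfolding times_num_def by (rule nrec_Suc) (intro defin mk_empty_V)+
  then show ?case using Suc by (simp add: succ_pow add.commute)
qed

lemma T_tup_map: "(\<And>j. definable_op (f j)) \<Longrightarrow> definable_op (\<lambda>s. tup (map (\<lambda>j. f j s) js))"
  by (induction js) (auto intro: T_mk_empty T_opair)

text \<open>Produces the denominators of the tolerances \<open>1 / (j * 2 ^ k)\<close>, so that they
  can be mentioned in a definition over \<open>V\<close>.\<close>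

definition doubling :: "nat \<Rightarrow> 'u \<Rightarrow> 'u" where
  "doubling j = nrec (\<lambda>p. num j) (\<lambda>p n r. times_num 2 r) (mk {})"

lemma T_doubling [defin]: "definable_op t \<Longrightarrow> definable_op (\<lambda>s. doubling l (t s))"
  unfolding doubling_def by (rule T_nrec) (intro defin | assumption)+

lemma doubling: "doubling j (num n) = num (j * 2 ^ n)"
proof (induction n)
  case 0
  have "doubling j (mk {} :: 'u) = num j" unfolding doubling_def by (rule nrec_0) (intro defin)+
  then show ?case by simp
next
  case (Suc n)
  have "doubling j (num (Suc n) :: 'u) = times_num 2 (doubling j (num n))"
    unfolding doubling_def by (rule nrec_Suc) (intro defin mk_empty_V)+
  then show ?case using Suc by (simp add: times_num mult.left_commute)
qed

end

text \<open>The tuples coded by \<open>u i\<close> are pairwise disjoint; the event \<open>i\<close> says that \<open>R\<close> holds of the entries of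
  the \<open>i\<close>-th tuple selected by \<open>pat\<close>.\<close>

locale events = structures_in_model V \<kappa> X L for V :: "'u::set_universe set" and \<kappa> X L +
  fixes R :: 'u and l :: nat and pat :: "nat list" and x :: "nat \<Rightarrow> 'u" and u :: "'u \<Rightarrow> 'u"
  assumes R: "has_arity L R (length pat)" and pat: "\<And>j. j \<in> set pat \<Longrightarrow> j < l"
    and x: "\<And>n. x n \<in> elts X" "inj x"
    and u: "definable_op (\<lambda>s. u (s 0))" "\<And>i. u (num i) = tup (map (\<lambda>j. x (l * i + j)) [0..<l])"

lemma (in structures_in_model) events_exist:
  assumes "has_arity L R (length pat)" "\<And>j. j \<in> set pat \<Longrightarrow> j < l"
  obtains x u where "events V \<kappa> X L R l pat x u"
proof -
  obtain f where f: "definable_op (\<lambda>s. f (s 0))" "\<And>n. f (num n) \<in> elts X" "inj (\<lambda>n. f (num n))"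
    using injective_sequence by blast
  let ?u = "\<lambda>i. tup (map (\<lambda>j. f ((succ ^^ j) (times_num l i))) [0..<l])"
  have "events V \<kappa> X L R l pat (\<lambda>n. f (num n)) ?u"
  proof unfold_locales
    show "definable_op (\<lambda>s. ?u (s 0))" by (intro T_tup_map T_op1[OF f(1)] defin)
    show "?u (num i) = tup (map (\<lambda>j. f (num (l * i + j))) [0..<l])" for i
      by (simp add: times_num succ_pow)
  qed (use assms f in auto)
  then show ?thesis by (rule that)
qed

section \<open>Codes for events and blocks of events\<close>

context events
begin

definition U :: "nat \<Rightarrow> 'u list" where "U i = map (\<lambda>j. x (l * i + j)) [0..<l]"

definition w :: "nat \<Rightarrow> 'u list" where "w i = map (\<lambda>j. x (l * i + j)) pat"

definition event :: "'u \<Rightarrow> 'u" where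
  "event i = tup [num 0, tup [literal_set (LRel R pat)], u i]"

text \<open>For numerals the index set \<open>diff2 (succ n) k\<close> is the closed block from
  \<open>k\<close> to \<open>n\<close> (\<open>conj_index\<close>).\<close>

definition conj_events :: "'u \<Rightarrow> 'u \<Rightarrow> 'u" where
  "conj_events k n = code_And (mk (event ` elts (diff2 (succ n) k)))"

definition all_events :: 'u where
  "all_events = code_And (mk (event ` elts omega))"

definition sparse_events :: "'u \<Rightarrow> 'u" where
  "sparse_events g = code_And (mk ((\<lambda>k. code_neg (conj_events k (app0 g k))) ` elts omega))"

lemma literal_wf: "wf_literal L l (LRel R pat)"
  using R pat by simp

lemma T_event [defin]: "definable_op t \<Longrightarrow> definable_op (\<lambda>s. event (t s))"
  unfolding event_def tup.simps
  by (intro defin T_const literal_set_V[OF L(1) literal_wf] T_op1[OF u(1)])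

lemma T_conj_events [defin]: "definable_op t \<Longrightarrow> definable_op t' \<Longrightarrow> definable_op (\<lambda>s. conj_events (t s) (t' s))"
  by (rule T_op2[where f = conj_events]) (unfold conj_events_def, intro defin, assumption)

lemma T_sparse_events [defin]: "definable_op t \<Longrightarrow> definable_op (\<lambda>s. sparse_events (t s))"
  by (rule T_op1[where f = sparse_events]) (unfold sparse_events_def, intro defin T_const omega_V, assumption)

lemma event_num: "event (num i) = code_basic [LRel R pat] (U i)"
  by (simp add: event_def code_basic_def u(2) U_def)

lemma event_codes: "event (num i) \<in> codes"
  unfolding event_num using x(1) literal_wf by (intro borel_codes.basic) (auto simp: U_def)

text \<open>The set \<open>Z\<close> of structures is arbitrary, so the same computation serves for
  \<open>V\<close>, where measures are taken, and for the generic extension, where \<open>M\<close>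
  lives.\<close>

lemma Interp_event: "Interp Z (event (num i)) = {M \<in> Z. holds M R (w i)}"
proof -
  have "map (nth (U i)) pat = w i" using pat by (auto simp: U_def w_def)
  then show ?thesis by (simp add: event_num)
qed

lemma conj_index: "elts (diff2 (succ (num n)) (num k)) = (num ` {k..n} :: 'u set)"
proof -
  have "inj (num :: nat \<Rightarrow> 'u)" by (simp add: inj_def)
  then have "num ` {..<Suc n} - num ` {..<k} = (num ` ({..<Suc n} - {..<k}) :: 'u set)"
    by (rule image_set_diff[symmetric])
  moreover have "{..<Suc n} - {..<k} = {k..n}" by auto
  ultimately show ?thesis by (simp only: elts_num elts_ops(3) num_Suc[symmetric])
qed

lemma conj_index_V: "diff2 (succ (num n)) (num k) \<in> V"
  using T_in[OF T_diff2[OF T_succ[OF T_num] T_num], of "\<lambda>_. num 0" n k] by simp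

lemma conj_codes: "k \<le> n \<Longrightarrow> conj_events (num k) (num n) \<in> codes"
  unfolding conj_events_def
proof (rule codes_family(2)[OF _ conj_index_V], unfold conj_index)
  show "definable_op (\<lambda>s. event (s 0))" by (intro defin)
qed (use omega_subset_kappa event_codes in auto)

lemma elts_conj: "elts (mk (event ` elts (diff2 (succ (num n)) (num k)))) = (\<lambda>i. event (num i)) ` {k..n}"
  by (subst elts_image[OF _ conj_index_V]) (intro defin | simp only: conj_index image_image)+

lemma Interp_conj: "Interp Z (conj_events (num k) (num n)) = {M \<in> Z. \<forall>i\<in>{k..n}. holds M R (w i)}"
  unfolding conj_events_def Interp_simps elts_conj by (auto simp: Interp_event)

lemma elts_all: "elts (mk (event ` elts omega)) = range (\<lambda>i. event (num i))"
  by (subst elts_image[OF _ omega_V]) (intro defin | simp only: elts_omega image_image)+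

lemma all_codes: "all_events \<in> codes"
  unfolding all_events_def using omega_subset_kappa
  by (intro codes_family omega_V) (intro defin | auto simp: event_codes)+

lemma Interp_all: "Interp Z all_events = {M \<in> Z. \<forall>i. holds M R (w i)}"
  unfolding all_events_def Interp_simps elts_all by (auto simp: Interp_event)

text \<open>On numerals the inclusion says \<open>k \<le> g k\<close>. This keeps every block
  nonempty, as \<open>codes_family\<close> requires.\<close>

definition good :: "'u \<Rightarrow> bool" where
  "good g \<longleftrightarrow> (\<forall>k\<in>elts omega. app0 g k \<in> elts omega \<and> elts k \<subseteq> elts (app0 g k))"

lemma good_num: "good g \<Longrightarrow> \<exists>n\<ge>k. app0 g (num k) = num n"
proof -
  assume "good g"
  then have "app0 g (num k) \<in> elts omega" "elts (num k) \<subseteq> elts (app0 g (num k))"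
    unfolding good_def using num_omega by blast+
  then obtain n where n: "app0 g (num k) = num n" "elts (num k :: 'u) \<subseteq> elts (num n)" by auto
  have "k \<le> n"
  proof (rule ccontr)
    assume "\<not> k \<le> n"
    then have "num n \<in> elts (num k :: 'u)" by simp
    then have "num n \<in> elts (num n :: 'u)" by (rule subsetD[OF n(2)])
    then show False by simp
  qed
  then show ?thesis using n by blast
qed

context
  fixes g assumes g: "g \<in> V" "good g"
begin

lemma T_neg_conj: "definable_op (\<lambda>s. code_neg (conj_events (s 0) (app0 g (s 0))))"
  by (intro defin T_const g)

lemma elts_sparse: "elts (mk ((\<lambda>k. code_neg (conj_events k (app0 g k))) ` elts omega)) =
    range (\<lambda>k. code_neg (conj_events (num k) (app0 g (num k))))"
  by (subst elts_image[OF T_neg_conj omega_V]) (simp only: elts_omega image_image)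

lemma sparse_codes: "sparse_events g \<in> codes"
  unfolding sparse_events_def using omega_subset_kappa
proof (intro codes_family(2)[OF T_neg_conj omega_V])
  fix z :: 'u assume "z \<in> elts omega"
  then obtain k where "z = num k" by auto
  then show "code_neg (conj_events z (app0 g z)) \<in> codes"
    using good_num[OF g(2), of k] conj_codes by (auto intro: borel_codes.neg)
qed auto

lemma Interp_sparse: "Interp Z (sparse_events g) = {M \<in> Z. \<forall>k. M \<notin> Interp Z (conj_events (num k) (app0 g (num k)))}"
  unfolding sparse_events_def Interp_simps elts_sparse by auto

end

end

section \<open>Measures of blocks under an invariant measure\<close>

locale measured_events = events V \<kappa> X L R l pat x u + measured_structures V \<kappa> X L \<nu>
  for V :: "'u::set_universe set" and \<kappa> X L R l pat x u \<nu>
begin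

lemma int_conj: "k \<le> n \<Longrightarrow> elts (int (conj_events (num k) (num n))) = {M \<in> elts S. \<forall>i\<in>{k..n}. holds M R (w i)}"
  using codes_interp[OF conj_codes] by (simp add: Interp_conj elts_S)

lemma int_all: "elts (int all_events) = {M \<in> elts S. \<forall>i. holds M R (w i)}"
  using codes_interp[OF all_codes] by (simp add: Interp_all elts_S)

lemma int_\<Sigma>: "q \<in> codes \<Longrightarrow> int q \<in> \<Sigma>"
  using codes_interp by blast

text \<open>Moving the points of the sequence down by \<open>l * k\<close> carries the block from
  \<open>k\<close> to \<open>n\<close> onto the one from 0 to \<open>n - k\<close>. Only the finite
  set \<open>F\<close> of points in the block is moved, so \<open>exchangeable\<close>
  applies.\<close>

lemma m_conj_shift:
  assumes "k \<le> n" shows "m (int (conj_events (num k) (num n))) = m (int (conj_events (num 0) (num (n - k))))"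
proof -
  define F where "F = x ` {l * k..<l * Suc n}"
  define \<sigma> where "\<sigma> y = x (inv x y - l * k)" for y
  have \<sigma>: "\<sigma> (x i) = x (i - l * k)" for i using x(2) by (simp add: \<sigma>_def)
  have inj: "inj_on \<sigma> F"
  proof (rule inj_onI)
    fix a b assume "a \<in> F" "b \<in> F" "\<sigma> a = \<sigma> b"
    then obtain i j where "a = x i" "b = x j" "l * k \<le> i" "l * k \<le> j" "x (i - l * k) = x (j - l * k)"
      unfolding F_def by (auto simp: \<sigma>)
    then show "a = b" using injD[OF x(2), of "i - l * k" "j - l * k"] eq_diff_iff[of "l * k" i j] by auto
  qed
  let ?W = "w ` {k..n}"
  have wF: "set v \<subseteq> F" if v: "v \<in> ?W" for v
  proof
    fix y assume "y \<in> set v"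
    then obtain i j where ij: "k \<le> i" "i \<le> n" "j \<in> set pat" "y = x (l * i + j)"
      using v by (auto simp: w_def)
    note ij = ij(1,2,4) pat[OF ij(3)]
    have "l * k \<le> l * i" "l * i \<le> l * n" using ij by simp_all
    then have "l * i + j \<in> {l * k..<l * Suc n}" using ij(4) unfolding mult_Suc_right atLeastLessThan_iff by linarith
    then show "y \<in> F" unfolding F_def ij(3) by (rule imageI)
  qed
  have w\<sigma>: "map \<sigma> (w i) = w (i - k)" if "k \<le> i" for i
    using that by (auto simp: w_def \<sigma> diff_mult_distrib2 mult_le_mono2)
  have "m (int (conj_events (num 0) (num (n - k)))) = m (int (conj_events (num k) (num n)))"
  proof (rule exchangeable[of F \<sigma> ?W])
    show "elts (int (conj_events (num k) (num n))) = {M \<in> elts S. \<forall>w\<in>?W. holds M R w}"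
      using int_conj[OF assms] by simp
    have "(\<forall>i\<in>{0..n - k}. P (w i)) \<longleftrightarrow> (\<forall>v\<in>?W. P (map \<sigma> v))" for P
    proof safe
      fix i assume "\<forall>i\<in>{0..n - k}. P (w i)" "i \<in> {k..n}"
      then show "P (map \<sigma> (w i))" using w\<sigma>[of i] by auto
    next
      fix i assume *: "\<forall>v\<in>?W. P (map \<sigma> v)" "i \<in> {0..n - k}"
      then have "P (map \<sigma> (w (i + k)))" using assms by auto
      then show "P (w i)" using w\<sigma>[of "i + k"] by simp
    qed
    from this[of "holds _ R"] show "elts (int (conj_events (num 0) (num (n - k)))) = {M \<in> elts S. \<forall>w\<in>?W. holds M R (map \<sigma> w)}"
      using int_conj[of 0 "n - k"] by simp
  qed (use wF inj x(1) conj_codes[OF assms] int_\<Sigma> in \<open>auto simp: F_def \<sigma>\<close>)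
  then show ?thesis by simp
qed

lemma m_conj_limit: "(\<lambda>n. m (int (conj_events (num 0) (num n)))) \<longlonglongrightarrow> m (int all_events)"
proof (rule m_continuous[where f = "\<lambda>z. int (conj_events (num 0) z)"])
  show "definable_op (\<lambda>s. int (conj_events (num 0) (s 0)))" by (intro defin T_const S_V)
  show "elts (int all_events) = (\<Inter>n. elts (int (conj_events (num 0) (num n))))"
    unfolding int_all int_conj[OF le0] by (auto, metis atLeastAtMost_iff le0 order_refl)
  show "elts (int (conj_events (num 0) (num (Suc n)))) \<subseteq> elts (int (conj_events (num 0) (num n)))" for n
    unfolding int_conj[OF le0] by auto
qed (intro int_\<Sigma> conj_codes all_codes le0)+

text \<open>The initial blocks decrease to \<open>all_events\<close>, so a long one has nearly its
  measure; the translate by \<open>k\<close> has the same measure and still includes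
  \<open>all_events\<close>.\<close>

lemma small_block:
  assumes "0 < \<delta>" obtains n where "k \<le> n" "m (diff2 (int (conj_events (num k) (num n))) (int all_events)) \<le> \<delta>"
proof -
  have "\<forall>\<^sub>F n in sequentially. m (int (conj_events (num 0) (num n))) < m (int all_events) + \<delta>"
    using order_tendstoD(2)[OF m_conj_limit] assms by simp
  then obtain n where n: "m (int (conj_events (num 0) (num n))) < m (int all_events) + \<delta>"
    by (auto simp: eventually_sequentially)
  have kn: "k \<le> n + k" by simp
  have "m (diff2 (int (conj_events (num k) (num (n + k)))) (int all_events)) =
      m (int (conj_events (num k) (num (n + k)))) - m (int all_events)"
    by (rule m_diff) (auto intro!: int_\<Sigma> conj_codes all_codes simp: int_all int_conj[OF kn])
  then show ?thesis using that[OF kn] n m_conj_shift[OF kn] by simp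
qed

text \<open>The two kinds of codes from which every Cohen condition can escape by an extension; the
  class is definable over \<open>V\<close>.\<close>

definition nowhere_dense :: "'u \<Rightarrow> bool" where
  "nowhere_dense s \<longleftrightarrow> s = all_events \<or> (\<exists>g\<in>V. good g \<and> s = sparse_events g)"

lemma nowhere_dense_codes: "nowhere_dense s \<Longrightarrow> s \<in> codes"
  unfolding nowhere_dense_def using all_codes sparse_codes by blast

lemma D_nowhere_dense: "definable_op t \<Longrightarrow> definable (\<lambda>s. nowhere_dense (t s))"
proof (rule D_op1[of nowhere_dense])
  have "all_events \<in> V" using codes_interp[OF all_codes] by blast
  then show "definable (\<lambda>s. nowhere_dense (s 0))"
    unfolding nowhere_dense_def good_def by (intro defin T_const omega_V)
qed

text \<open>If \<open>A\<close> does not meet the intersection \<open>E\<close> of all events in positive measure, choose for each \<open>k\<close> a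
  block \<open>[k, g k]\<close> so long that its intersection exceeds \<open>E\<close> by at most \<open>1 / (j 2\<^sup>k)\<close>; this is possible since by
  exchangeability the measure of the intersection of a block depends only on its length.\<close>

lemma nowhere_dense_positive:
  assumes A: "A \<in> \<Sigma>" "0 < m A"
  shows "\<exists>s. nowhere_dense s \<and> (\<exists>B\<in>\<Sigma>. elts B \<subseteq> elts A \<and> elts B \<subseteq> elts (int s) \<and> 0 < m B)"
proof -
  let ?E = "int all_events"
  have E: "?E \<in> \<Sigma>" by (intro int_\<Sigma> all_codes)
  define A0 A1 where "A0 = diff2 A ?E" and "A1 = diff2 A A0"
  have A0: "A0 \<in> \<Sigma>" "elts A0 = elts A - elts ?E" unfolding A0_def using \<Sigma>_Diff[OF A(1) E] by auto
  have A1: "A1 \<in> \<Sigma>" "elts A1 = elts A \<inter> elts ?E" unfolding A1_def using \<Sigma>_Diff[OF A(1) A0(1)] A0(2) by auto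
  have mA: "m A = m A0 + m A1" by (rule m_Un[OF A0(1) A1(1)]) (auto simp: A0(2) A1(2))
  show ?thesis
  proof (cases "0 < m A1")
    case True
    then show ?thesis using A1 unfolding nowhere_dense_def by (intro exI[of _ all_events]) auto
  next
    case False
    then have pos: "0 < m A0" using mA A(2) by simp
    \<comment> \<open>The tolerances \<open>1 / (j * 2 ^ k)\<close> add up to \<open>2 / j\<close>,
      which has to stay below the measure of \<open>A0\<close>.\<close>
    obtain j where j: "0 < j" "2 / real j < m A0"
    proof -
      obtain j where "2 / m A0 < real j" using reals_Archimedean2 by blast
      then show ?thesis using that[of j] pos
        by (metis divide_less_eq less_divide_eq mult.commute of_nat_0_less_iff order_less_trans zero_less_divide_iff zero_less_numeral)
    qed
    \<comment> \<open>Nonmembership of \<open>(1, j * 2 ^ k)\<close> in the cut says that the excess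
      of the block over \<open>?E\<close> has measure at most
      \<open>1 / (j * 2 ^ k)\<close>.\<close>
    define h where "h k n \<longleftrightarrow> n \<in> elts omega \<and> elts k \<subseteq> elts n \<and>
      opair (num 1) (doubling j k) \<notin> elts (app0 \<nu> (diff2 (int (conj_events k n)) ?E))" for k n
    have Dh: "definable (\<lambda>s. h (s 0) (s 1))"
      unfolding h_def by (intro defin T_const omega_V \<nu> S_V) (use E \<Sigma>_V_subset in blast)
    have d\<Sigma>: "diff2 (int (conj_events (num k) (num n))) ?E \<in> \<Sigma>" if "k \<le> n" for k n
      by (rule \<Sigma>_Diff[OF int_\<Sigma>[OF conj_codes[OF that]] E]) simp
    have h_iff: "opair (num 1) (doubling j (num k)) \<notin> elts (app0 \<nu> (diff2 (int (conj_events (num k) (num n))) ?E)) \<longleftrightarrow>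
      m (diff2 (int (conj_events (num k) (num n))) ?E) \<le> 1 / real j * (1 / 2) ^ k" if "k \<le> n" for k n
      unfolding doubling m_cut[OF d\<Sigma>[OF that]] using j(1) by (simp add: field_simps not_less)
    have "\<exists>n\<in>V. h z n" if z: "z \<in> elts omega" for z
    proof -
      obtain k where k: "z = num k" using z by auto
      have "0 < 1 / real j * (1 / 2) ^ k" using j by simp
      then obtain n where n: "k \<le> n" "m (diff2 (int (conj_events (num k) (num n))) ?E) \<le> 1 / real j * (1 / 2) ^ k"
        by (rule small_block)
      have "elts (num k :: 'u) \<subseteq> elts (num n)" using n(1) by (auto simp: elts_num)
      then show ?thesis using n h_iff[OF n(1)] unfolding k h_def
        by (intro bexI[of _ "num n"] conjI num_omega num_V) auto
    qed
    from choice[OF Dh omega_V this] obtain g where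
      g: "g \<in> V" "is_function g omega" "\<forall>k\<in>elts omega. app g k \<in> V \<and> h k (app g k)" by blast
    have gh: "h k (app0 g k)" if "k \<in> elts omega" for k using bspec[OF g(3) that] app_app0[OF g(2) that] by simp
    have good: "good g" unfolding good_def using gh unfolding h_def by blast
    let ?f = "\<lambda>k. diff2 (int (conj_events k (app0 g k))) ?E"
    have Tf: "definable_op (\<lambda>s. ?f (s 0))" by (intro defin T_const g S_V) (use E \<Sigma>_V_subset in blast)
    have f: "?f (num k) \<in> \<Sigma>" "m (?f (num k)) \<le> 1 / real j * (1 / 2) ^ k" for k
    proof -
      obtain n where n: "k \<le> n" "app0 g (num k) = num n" using good_num[OF good] by blast
      show "?f (num k) \<in> \<Sigma>" "m (?f (num k)) \<le> 1 / real j * (1 / 2) ^ k"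
        using gh[OF num_omega, of k] h_iff[OF n(1)] d\<Sigma>[OF n(1)] unfolding n(2) h_def by auto
    qed
    \<comment> \<open>The union of all excesses: outside \<open>?E\<close>, a structure for which
      some block holds entirely lies in \<open>W\<close>.\<close>
    define W where "W = Union1 (mk (?f ` elts omega))"
    have W: "elts W = (\<Union>k. elts (?f (num k)))"
      unfolding W_def Union1_def[symmetric] elts_ops(4) elts_image[OF Tf omega_V] by simp
    have "W \<in> \<Sigma>"
      by (rule \<Sigma>_UN[OF Tf omega_V omega_subset_kappa]) (use f W in auto)
    have "(\<lambda>k. 1 / real j * (1 / 2) ^ k) sums (1 / real j * (1 / (1 - 1 / 2)))"
      by (intro sums_mult geometric_sums) simp
    then have "m W \<le> 1 / real j * (1 / (1 - 1 / 2))"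
      by (rule m_subadditive[OF Tf f(1) W f(2)])
    then have mW: "m W < m A0" using j(2) by simp
    define B where "B = diff2 A0 W"
    define C where "C = diff2 A0 B"
    have B: "B \<in> \<Sigma>" "elts B = elts A0 - elts W" unfolding B_def using \<Sigma>_Diff[OF A0(1) \<open>W \<in> \<Sigma>\<close>] by auto
    have C: "C \<in> \<Sigma>" "elts C = elts A0 \<inter> elts W" unfolding C_def using \<Sigma>_Diff[OF A0(1) B(1)] B(2) by auto
    have "m A0 = m B + m C" by (rule m_Un[OF B(1) C(1)]) (auto simp: B(2) C(2))
    moreover have "m C \<le> m W" by (rule m_mono[OF \<open>W \<in> \<Sigma>\<close> C(1)]) (simp add: C(2))
    ultimately have "0 < m B" using mW by simp
    \<comment> \<open>Structures in \<open>B\<close> are neither in \<open>?E\<close> nor in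
      \<open>W\<close>, so no block holds entirely.\<close>
    moreover have "elts B \<subseteq> elts (int (sparse_events g))"
    proof -
      have "elts (int (conj_events (num k) (app0 g (num k)))) = Interp (Str V L X) (conj_events (num k) (app0 g (num k)))" for k
        using good_num[OF good, of k] codes_interp[OF conj_codes] by auto
      then have "elts (int (sparse_events g)) = {M \<in> elts S. \<forall>k. M \<notin> elts (int (conj_events (num k) (app0 g (num k))))}"
        using codes_interp[OF sparse_codes[OF g(1) good]] Interp_sparse[OF g(1) good] by (simp add: elts_S)
      moreover have "elts A0 \<subseteq> elts S" using A0(1) \<Sigma>_V_subset by blast
      ultimately show ?thesis unfolding B(2) W using A0(2) by auto
    qed
    moreover have "elts B \<subseteq> elts A" using B(2) A0(2) by auto
    ultimately show ?thesis
      using B(1) g(1) good unfolding nowhere_dense_def by blast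
  qed
qed

end

section \<open>Random generic structures lie in a nowhere dense set\<close>

context measured_events
begin

lemma code_meas_disjoint:
  assumes "Interp (Str V L X) d \<subseteq> Interp (Str V L X) q"
  shows "random_le V L X \<nu> d q"
proof -
  have "Interp (Str V L X) (code_And (mk {d, code_neg q})) = {}" using assms by auto
  then show ?thesis unfolding random_le_def code_meas_def by (simp only: m_empty)
qed

text \<open>The dense set in \<open>V\<close> is not formed from all codes but from one chosen
  simple code for each measurable set of positive measure inside some nowhere dense one; density is
  \<open>nowhere_dense_positive\<close>.\<close>

lemma random_generic_nowhere_dense:
  assumes "random_generic V \<kappa> L X \<nu> M"
  obtains s Z where "nowhere_dense s" "M \<in> Interp Z s"
proof -
  obtain G where G: "generic_filter V (random_conditions V \<kappa> L X \<nu>) (random_le V L X \<nu>) G"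
    and M: "(\<Inter>\<gamma>\<in>elts G. Interp (Str (generic_extension V G) L X) \<gamma>) = {M}"
    using assms unfolding random_generic_def by blast
  obtain \<Omega> where \<Omega>: "\<Omega> \<in> V" "elts \<Omega> = \<Sigma>" using measurable_set by blast
  have "definable (\<lambda>s. simple_code (s 1) \<and> int (s 1) = s 0)" by (intro defin T_const S_V)
  moreover have "\<exists>\<gamma>\<in>V. simple_code \<gamma> \<and> int \<gamma> = A" if "A \<in> elts \<Omega>" for A
    using simple_code_measurable that \<Omega>(2) by blast
  ultimately obtain c where c: "c \<in> V" "is_function c \<Omega>"
    "\<forall>A\<in>elts \<Omega>. app c A \<in> V \<and> simple_code (app c A) \<and> int (app c A) = A"
    using choice[of "\<lambda>A \<gamma>. simple_code \<gamma> \<and> int \<gamma> = A" \<Omega>] \<Omega>(1) by blast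
  have c_code: "app0 c A \<in> codes" "int (app0 c A) = A" if "A \<in> \<Sigma>" for A
  proof -
    have A: "A \<in> elts \<Omega>" using that \<Omega>(2) by simp
    then show "app0 c A \<in> codes" "int (app0 c A) = A"
      using bspec[OF c(3) A] simple_codes app_app0[OF c(2) A] by simp_all
  qed
  \<comment> \<open>Membership of \<open>(0, 1)\<close> in the cut expresses positive
    measure.\<close>
  define N where "N = mk {A \<in> elts \<Omega>. opair (num 0) (num 1) \<in> elts (app0 \<nu> A) \<and>
    (\<exists>s\<in>V. nowhere_dense s \<and> elts A \<subseteq> elts (int s))}"
  have "inV {A \<in> elts \<Omega>. opair (num 0) (num 1) \<in> elts (app0 \<nu> A) \<and>
    (\<exists>s\<in>V. nowhere_dense s \<and> elts A \<subseteq> elts (int s))}"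
    by (rule inV_sep) (intro defin T_const D_nowhere_dense \<nu> S_V \<Omega>)+
  note iN = inV_D[OF this, folded N_def]
  have N: "A \<in> elts N \<longleftrightarrow> A \<in> \<Sigma> \<and> 0 < m A \<and> (\<exists>s. nowhere_dense s \<and> elts A \<subseteq> elts (int s))" for A
  proof -
    have "nowhere_dense s \<Longrightarrow> s \<in> V" for s using codes_interp[OF nowhere_dense_codes] by blast
    then show ?thesis unfolding iN(2) \<Omega>(2) using m_cut[of A 0 1] by auto
  qed
  define E where "E = mk ((\<lambda>A. app0 c A) ` elts N)"
  have TE: "definable_op (\<lambda>s. app0 c (s 0))" by (intro T_app0_const c)
  have E: "E \<in> V" "elts E = (\<lambda>A. app0 c A) ` elts N"
    unfolding E_def using image_V[OF TE iN(1)] elts_image[OF TE iN(1)] by auto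
  have "dense_in (random_conditions V \<kappa> L X \<nu>) (random_le V L X \<nu>) (elts E)"
    unfolding dense_in_def
  proof (intro conjI ballI subsetI)
    show "d \<in> random_conditions V \<kappa> L X \<nu>" if "d \<in> elts E" for d
      using that N c_code unfolding E(2) random_conditions_def by (auto simp: code_meas)
    fix q assume "q \<in> random_conditions V \<kappa> L X \<nu>"
    then have q: "q \<in> codes" "0 < m (int q)" unfolding random_conditions_def by (auto simp: code_meas)
    obtain s B where B: "nowhere_dense s" "B \<in> \<Sigma>" "elts B \<subseteq> elts (int q)" "elts B \<subseteq> elts (int s)" "0 < m B"
      using nowhere_dense_positive[OF int_\<Sigma>[OF q(1)] q(2)] by blast
    have "random_le V L X \<nu> (app0 c B) q"
      using codes_interp[OF c_code(1)[OF B(2)]] codes_interp[OF q(1)] B(3) c_code(2)[OF B(2)]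
      by (intro code_meas_disjoint) auto
    moreover have "app0 c B \<in> elts E" unfolding E(2) using B N by blast
    ultimately show "\<exists>d\<in>elts E. random_le V L X \<nu> d q" by blast
  qed
  then obtain d where d: "d \<in> elts G" "d \<in> elts E" using G E(1) unfolding generic_filter_def by blast
  then obtain A s where A: "d = app0 c A" "A \<in> \<Sigma>" "0 < m A" "nowhere_dense s" "elts A \<subseteq> elts (int s)"
    unfolding E(2) using N by auto
  have s: "s \<in> codes" using A(4) by (rule nowhere_dense_codes)
  \<comment> \<open>Genericity provides only a code \<open>d\<close> below \<open>s\<close>; since
    \<open>s\<close> too has positive measure, upward closure of the filter brings \<open>s\<close>
    itself into \<open>G\<close>.\<close>
  have "random_le V L X \<nu> d s"
    using codes_interp[OF c_code(1)[OF A(2)]] codes_interp[OF s] A(5) c_code(2)[OF A(2)]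
    unfolding A(1) by (intro code_meas_disjoint) auto
  moreover have "s \<in> random_conditions V \<kappa> L X \<nu>"
    using m_mono[OF int_\<Sigma>[OF s] A(2,5)] A(3) s unfolding random_conditions_def by (simp add: code_meas)
  ultimately have "s \<in> elts G" using d(1) G unfolding generic_filter_def filter_on_def by blast
  then have "M \<in> Interp (Str (generic_extension V G) L X) s" using M by blast
  then show ?thesis using A(4) that by blast
qed

end

section \<open>Cohen generic structures avoid nowhere dense sets\<close>

text \<open>The union of the interpretations must exist as a set for \<open>mk\<close> to have the
  intended elements; replacement and union in the universe give this.\<close>

lemma union_structure_holds:
  assumes "\<And>A. A \<in> elts G \<Longrightarrow> \<exists>Y I. A = opair Y I"
  shows "holds (union_structure (elts G)) R as \<longleftrightarrow> (\<exists>A\<in>elts G. holds A R as)"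
proof -
  interpret U: transitive_model "UNIV :: 'a set" by (rule model_UNIV)
  have "elts (mk (snd0 ` elts G)) = snd0 ` elts G"
    by (rule U.elts_image) (intro U.T_snd0 U.T_var UNIV_I)+
  then have "elts (Union1 (mk (snd0 ` elts G))) = (\<Union>A\<in>elts G. elts (snd0 A))" by simp
  also have "\<dots> = (\<Union>A\<in>elts G. elts (psnd A))"
    by (rule SUP_cong[OF refl]) (use assms in fastforce)
  finally have "elts (mk (\<Union>A\<in>elts G. elts (psnd A))) = (\<Union>A\<in>elts G. elts (psnd A))" by (metis mk_elts)
  then show ?thesis by (simp add: union_structure_def holds_def)
qed

context structures_in_model
begin

lemma D_class: assumes "class_of V K" shows "definable (\<lambda>s. s 0 \<in> K)"
proof -
  obtain \<phi> c where K: "env c" "K = {x \<in> V. fsat mem V (c(0 := x)) \<phi>}"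
    using assms unfolding class_of_def by blast
  define f where "f i = (if i = 0 then 0 else Suc (2 * i))" for i :: nat
  have inj: "inj f" by (auto simp: inj_def f_def)
  have f: "interleave s c \<circ> f = c(0 := s 0)" for s
    by (auto simp: fun_eq_iff f_def interleave_def)
  show ?thesis unfolding definable_def
    by (rule exI[of _ "rename f \<phi>"], rule exI[of _ c]) (simp add: fsat_rename[OF inj] f K)
qed

lemma finite_structureD:
  assumes "M \<in> finite_structures V L"
  shows "M = opair (pfst M) (psnd M) \<and> pfst M \<in> V \<and> psnd M \<in> V \<and> finite (elts (pfst M)) \<and>
    elts (psnd M) \<subseteq> {opair R (tup as) | R as. has_arity L R (length as) \<and> set as \<subseteq> elts (pfst M)}"
proof -
  have M: "M \<in> V" "M \<in> structures_on L (pfst M)" "finite (elts (pfst M))"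
    using assms by (auto simp: finite_structures_def)
  from M(2) obtain I where I: "M = opair (pfst M) I"
    "elts I \<subseteq> {opair R (tup as) | R as. has_arity L R (length as) \<and> set as \<subseteq> elts (pfst M)}"
    unfolding structures_on_def by blast
  then have "psnd M = I" by (metis psnd_opair)
  moreover have "pfst M \<in> V" "I \<in> V" using M(1) I(1) by (metis opair_V)+
  ultimately show ?thesis using I M(3) by simp
qed

lemma finite_structureI:
  assumes "Y \<in> V" "I \<in> V" "finite (elts Y)"
    "elts I \<subseteq> {opair R (tup as) | R as. has_arity L R (length as) \<and> set as \<subseteq> elts Y}"
  shows "opair Y I \<in> finite_structures V L"
  using assms unfolding finite_structures_def structures_on_def by auto

lemma finite_structure_holds:
  assumes "M \<in> finite_structures V L" "holds M R as"
  shows "has_arity L R (length as)" "set as \<subseteq> elts (pfst M)"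
proof -
  obtain Y I where I: "M = opair Y I"
    "elts I \<subseteq> {opair R (tup as) | R as. has_arity L R (length as) \<and> set as \<subseteq> elts Y}"
    using finite_structureD[OF assms(1)] by (elim conjE) (rule that, assumption+)
  show "has_arity L R (length as)" "set as \<subseteq> elts (pfst M)"
    using subsetD[OF I(2), of "opair R (tup as)"] assms(2) I(1) by (simp_all add: holds_def)
qed

end

section \<open>Amalgamation and Cohen conditions\<close>

locale strong_class = structures_in_model V \<kappa> X L for V :: "'u::set_universe set" and \<kappa> X L +
  fixes K :: "'u set"
  assumes K: "strong_Fraisse_class V L K"
begin

lemma K_finite: assumes "A \<in> K" shows "A \<in> finite_structures V L"
proof -
  have "K \<subseteq> finite_structures V L" using K unfolding strong_Fraisse_class_def by (elim conjE)
  then show ?thesis using assms by blast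
qed

lemma K_iso: assumes "A \<in> K" "B \<in> finite_structures V L" "isomorphic A B" shows "B \<in> K"
proof -
  have "\<forall>M\<in>K. \<forall>N\<in>finite_structures V L. isomorphic M N \<longrightarrow> N \<in> K"
    using K unfolding strong_Fraisse_class_def by (elim conjE)
  then show ?thesis using assms by blast
qed

lemma K_HP: assumes "A \<in> K" "B \<in> finite_structures V L" "substructure B A" shows "B \<in> K"
proof -
  have "\<forall>M\<in>K. \<forall>N\<in>finite_structures V L. substructure N M \<longrightarrow> N \<in> K"
    using K unfolding strong_Fraisse_class_def by (elim conjE)
  then show ?thesis using assms by blast
qed

lemma K_JEP: "A \<in> K \<Longrightarrow> B \<in> K \<Longrightarrow> \<exists>N\<in>K. (\<exists>j. embedding j A N) \<and> (\<exists>j. embedding j B N)"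
  using K unfolding strong_Fraisse_class_def by blast

lemma K_SAP:
  assumes "M0 \<in> K" "M1 \<in> K" "M2 \<in> K" "embedding i1 M0 M1" "embedding i2 M0 M2"
  obtains M3 j1 j2 where "M3 \<in> K" "embedding j1 M1 M3" "embedding j2 M2 M3"
    "j1 ` elts (pfst M1) \<inter> j2 ` elts (pfst M2) = j1 ` i1 ` elts (pfst M0)"
proof -
  have "\<exists>M3\<in>K. \<exists>j1 j2. embedding j1 M1 M3 \<and> embedding j2 M2 M3 \<and>
        (\<forall>x\<in>elts (pfst M0). j1 (i1 x) = j2 (i2 x)) \<and>
        j1 ` elts (pfst M1) \<inter> j2 ` elts (pfst M2) = j1 ` i1 ` elts (pfst M0)"
    using K assms unfolding strong_Fraisse_class_def by metis
  then show ?thesis using that by blast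
qed

text \<open>Strong amalgamation over the structure with empty universe; by JEP all members of \<open>K\<close> agree on
  the nullary relations.\<close>

lemma disjoint_amalgam:
  assumes A: "A \<in> K" and B: "B \<in> K"
  obtains N i j where "N \<in> K" "embedding i A N" "embedding j B N" "i ` elts (pfst A) \<inter> j ` elts (pfst B) = {}"
proof -
  obtain Y I where I: "A = opair Y I" "Y \<in> V" "I \<in> V"
    "elts I \<subseteq> {opair R (tup as) | R as. has_arity L R (length as) \<and> set as \<subseteq> elts Y}"
    using finite_structureD[OF K_finite[OF A]] by (elim conjE) (rule that, assumption+)
  \<comment> \<open>The nullary facts of \<open>A\<close> are those whose coded tuple is empty; they
    are all that the empty substructure retains.\<close>
  have "inV {e \<in> elts I. snd0 e = mk {}}" by (rule inV_sep) (intro defin I)+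
  then obtain J where J: "J \<in> V" "elts J = {e \<in> elts I. snd0 e = mk {}}" unfolding inV_def by blast
  define Z where "Z = opair (mk {}) J"
  have hZ: "holds Z R [] \<longleftrightarrow> holds A R []" for R
    by (simp add: holds_def Z_def J I(1))
  have "Z \<in> finite_structures V L"
    unfolding Z_def
  proof (rule finite_structureI)
    show "elts J \<subseteq> {opair R (tup as) |R as. has_arity L R (length as) \<and> set as \<subseteq> elts (mk {})}"
    proof
      fix e assume e: "e \<in> elts J"
      then obtain R as where Ra: "e = opair R (tup as)" "has_arity L R (length as)" using I(4) J(2) by auto
      then have "tup as = tup []" using e J(2) by simp
      then have "as = []" by (simp only: tup_inject)
      then show "e \<in> {opair R (tup as) |R as. has_arity L R (length as) \<and> set as \<subseteq> elts (mk {})}"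
        using Ra by force
    qed
  qed (use J in auto)
  moreover have ZA: "embedding id Z A"
    unfolding embedding_def using hZ by (auto simp: Z_def)
  moreover have "elts (pfst Z) \<subseteq> elts (pfst A)" by (simp add: Z_def)
  ultimately have Z: "Z \<in> K" using K_HP[OF A] unfolding substructure_def by blast
  obtain N j1 j2 where N: "embedding j1 A N" "embedding j2 B N" using K_JEP[OF A B] by blast
  have "holds A R [] \<longleftrightarrow> holds B R []" for R
    using N unfolding embedding_def by (metis empty_subsetI list.map_disc_iff list.set(1))
  then have ZB: "embedding id Z B"
    unfolding embedding_def using hZ by (auto simp: Z_def)
  obtain N i j where "N \<in> K" "embedding i A N" "embedding j B N"
    "i ` elts (pfst A) \<inter> j ` elts (pfst B) = i ` id ` elts (pfst Z)"
    using K_SAP[OF Z A B ZA ZB] by metis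
  then show ?thesis using that[of N i j] by (simp add: Z_def)
qed

text \<open>The class is closed under isomorphic copies that lie in \<open>V\<close>. The copy along
  \<open>\<psi>\<close> does, because only finitely many points are renamed.\<close>

lemma transport_structure:
  assumes M: "M \<in> K" and \<psi>: "inj_on \<psi> (elts (pfst M))" "\<psi> ` elts (pfst M) \<subseteq> V"
  obtains Q where "Q \<in> K" "elts (pfst Q) = \<psi> ` elts (pfst M)" "embedding \<psi> M Q"
proof -
  obtain Y I where I: "M = opair Y I" "Y \<in> V" "I \<in> V" "finite (elts Y)"
    "elts I \<subseteq> {opair R (tup as) | R as. has_arity L R (length as) \<and> set as \<subseteq> elts Y}"
    using finite_structureD[OF K_finite[OF M]] by (elim conjE) (rule that, assumption+)
  have Y: "elts (pfst M) = elts Y" by (simp add: I(1))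
  obtain g where g: "g \<in> V" "is_function g Y" "\<And>y. y \<in> elts Y \<Longrightarrow> app g y = \<psi> y"
    using finite_modification_V[OF I(2,4), of \<psi>] \<psi>(2) unfolding Y by blast
  note t = transport[OF g(1,2) I(3,5)]
  have g\<psi>: "map (app g) as = map \<psi> as" if "set as \<subseteq> elts Y" for as using g(3) that by auto
  have sub: "has_arity L R (length as)" "set as \<subseteq> elts Y" if "opair R (tup as) \<in> elts I" for R as
    using subsetD[OF I(5) that] by simp_all
  have e: "elts (transport g I) = {opair R (tup (map \<psi> as)) | R as. opair R (tup as) \<in> elts I}"
    unfolding t(2) using g\<psi> sub(2) by (metis (no_types, lifting))
  have i: "inV (\<psi> ` elts Y)" using I(4) \<psi>(2) unfolding Y by (intro inV_finite) auto
  define Q where "Q = opair (mk (\<psi> ` elts Y)) (transport g I)"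
  have pQ: "elts (pfst Q) = \<psi> ` elts Y" by (simp add: Q_def inV_D(2)[OF i])
  have "Q \<in> finite_structures V L"
    unfolding Q_def
  proof (rule finite_structureI[OF inV_D(1)[OF i] t(1)], unfold inV_D(2)[OF i])
    show "elts (transport g I) \<subseteq> {opair R (tup as) |R as. has_arity L R (length as) \<and> set as \<subseteq> \<psi> ` elts Y}"
    proof
      fix z assume "z \<in> elts (transport g I)"
      then obtain R as where z: "z = opair R (tup (map \<psi> as))" "opair R (tup as) \<in> elts I" unfolding e by blast
      then show "z \<in> {opair R (tup as) |R as. has_arity L R (length as) \<and> set as \<subseteq> \<psi> ` elts Y}"
        using sub[OF z(2)] by (intro CollectI exI[of _ R] exI[of _ "map \<psi> as"]) auto
    qed
  qed (use I(4) in simp)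
  moreover have emb: "embedding \<psi> M Q"
    unfolding embedding_def Y
  proof (intro conjI allI impI)
    show "inj_on \<psi> (elts Y)" using \<psi>(1) Y by simp
    show "\<psi> ` elts Y \<subseteq> elts (pfst Q)" by (simp add: pQ)
    fix R as assume as: "set as \<subseteq> elts Y"
    show "holds M R as \<longleftrightarrow> holds Q R (map \<psi> as)"
    proof
      show "holds M R as \<Longrightarrow> holds Q R (map \<psi> as)" unfolding holds_def Q_def psnd_opair e I(1) by blast
      assume "holds Q R (map \<psi> as)"
      then obtain bs where bs: "map \<psi> as = map \<psi> bs" "opair R (tup bs) \<in> elts I"
        unfolding holds_def Q_def psnd_opair e by auto
      have "inj_on \<psi> (set as \<union> set bs)"
        by (rule inj_on_subset[OF \<psi>(1)]) (use as sub(2)[OF bs(2)] Y in auto)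
      then have "as = bs" using bs(1) by (simp add: inj_on_map_eq_map)
      then show "holds M R as" using bs(2) by (simp add: holds_def I(1))
    qed
  qed
  ultimately have "Q \<in> K" using K_iso[OF M, of Q] unfolding isomorphic_def by (auto simp: Y pQ)
  then show ?thesis using that emb pQ Y by simp
qed

abbreviation C where "C \<equiv> cohen_conditions K X"

text \<open>A condition can be extended by a copy of any member of \<open>K\<close> on prescribed new points; the
  further points needed are chosen outside the finite set \<open>F\<close>.\<close>

lemma extend_condition:
  assumes P: "P \<in> C" and B: "B \<in> K" and F: "finite F"
    and \<sigma>: "inj_on \<sigma> (elts (pfst B))" "\<sigma> ` elts (pfst B) \<subseteq> elts X" "\<sigma> ` elts (pfst B) \<inter> elts (pfst P) = {}"
  obtains Q where "Q \<in> C" "cohen_le Q P" "embedding \<sigma> B Q" "elts (pfst Q) \<inter> F \<subseteq> elts (pfst P) \<union> \<sigma> ` elts (pfst B)"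
proof -
  have PK: "P \<in> K" "elts (pfst P) \<subseteq> elts X" using P unfolding cohen_conditions_def by auto
  obtain N i j where N: "N \<in> K" "embedding i P N" "embedding j B N" "i ` elts (pfst P) \<inter> j ` elts (pfst B) = {}"
    using disjoint_amalgam[OF PK(1) B] by metis
  let ?p = "elts (pfst P)" and ?b = "elts (pfst B)" and ?n = "elts (pfst N)"
  have fin: "finite ?p" "finite ?b" "finite ?n"
    using PK(1) B N(1) K_finite unfolding finite_structures_def by auto
  have i: "inj_on i ?p" "i ` ?p \<subseteq> ?n" and j: "inj_on j ?b" "j ` ?b \<subseteq> ?n"
    using N(2,3) unfolding embedding_def by auto
  define rest where "rest = ?n - i ` ?p - j ` ?b"
  \<comment> \<open>Amalgamation may create points beyond the two given structures. They are placed
    off \<open>F\<close>, so that tuples reserved for later remain untouched.\<close>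
  have "infinite (elts X - F - ?p - \<sigma> ` ?b)" using X(2) F fin by simp
  then obtain T' where T': "finite T'" "card T' = card rest" "T' \<subseteq> elts X - F - ?p - \<sigma> ` ?b"
    using infinite_arbitrarily_large by blast
  then obtain \<rho> where \<rho>: "bij_betw \<rho> rest T'"
    using finite_same_card_bij[of rest T'] fin by (auto simp: rest_def)
  \<comment> \<open>Names the points of the amalgam by elements of \<open>X\<close>: those of
    \<open>P\<close> keep their names, those of \<open>B\<close> follow \<open>\<sigma>\<close>, the
    additional ones go to the fresh set \<open>T'\<close>.\<close>
  define \<psi> where "\<psi> y = (if y \<in> i ` ?p then inv_into ?p i y else if y \<in> j ` ?b then \<sigma> (inv_into ?b j y) else \<rho> y)" for y
  have \<psi>i: "\<psi> (i y) = y" if "y \<in> ?p" for y using that i(1) by (simp add: \<psi>_def)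
  have \<psi>j: "\<psi> (j y) = \<sigma> y" if "y \<in> ?b" for y
    using that j(1) N(4) by (auto simp: \<psi>_def)
  have b1: "bij_betw \<psi> (i ` ?p) ?p"
    by (rule bij_betw_imageI) (auto simp: inj_on_def \<psi>i image_image)
  have b2: "bij_betw \<psi> (j ` ?b) (\<sigma> ` ?b)"
    using \<sigma>(1) by (intro bij_betw_imageI) (auto simp: inj_on_def \<psi>j image_image)
  have b3: "bij_betw \<psi> rest T'"
    by (rule bij_betw_cong[THEN iffD1, OF _ \<rho>]) (auto simp: rest_def \<psi>_def)
  have "bij_betw \<psi> (i ` ?p \<union> j ` ?b) (?p \<union> \<sigma> ` ?b)"
    using b1 b2 \<sigma>(3) by (intro bij_betw_combine) auto
  then have "bij_betw \<psi> (i ` ?p \<union> j ` ?b \<union> rest) (?p \<union> \<sigma> ` ?b \<union> T')"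
    using T'(3) by (intro bij_betw_combine[OF _ b3]) auto
  moreover have "i ` ?p \<union> j ` ?b \<union> rest = ?n" using i j by (auto simp: rest_def)
  ultimately have \<psi>: "inj_on \<psi> ?n" "\<psi> ` ?n = ?p \<union> \<sigma> ` ?b \<union> T'" by (auto simp: bij_betw_def)
  have img: "\<psi> ` ?n \<subseteq> elts X" using \<psi>(2) PK(2) \<sigma>(2) T'(3) by auto
  have "\<psi> ` ?n \<subseteq> V" using img XV by blast
  then obtain Q where Q: "Q \<in> K" "elts (pfst Q) = \<psi> ` ?n" "embedding \<psi> N Q"
    by (rule transport_structure[OF N(1) \<psi>(1)])
  have comp: "holds A R as \<longleftrightarrow> holds Q R (map (\<psi> \<circ> f) as)"
    if "embedding f A N" "set as \<subseteq> elts (pfst A)" for f A R as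
  proof -
    have "holds A R as \<longleftrightarrow> holds N R (map f as)" "set (map f as) \<subseteq> ?n"
      using that unfolding embedding_def by auto
    then show ?thesis using Q(3) unfolding embedding_def by simp
  qed
  have "map (\<psi> \<circ> i) as = as" if "set as \<subseteq> ?p" for as
    using that \<psi>i by (auto intro!: map_idI)
  then have "cohen_le Q P"
    unfolding cohen_le_def substructure_def embedding_def
    using comp[OF N(2)] Q(2) \<psi>(2) by (simp add: le_supI1)
  moreover have "holds B R as \<longleftrightarrow> holds Q R (map \<sigma> as)" if as: "set as \<subseteq> ?b" for R as
  proof -
    have e: "map (\<psi> \<circ> j) as = map \<sigma> as" using as \<psi>j by auto
    show ?thesis using comp[OF N(3) as] unfolding e .
  qed
  then have "embedding \<sigma> B Q"
    unfolding embedding_def using Q(2) \<psi>(2) \<sigma>(1) by auto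
  moreover have "Q \<in> C" using Q(1,2) img unfolding cohen_conditions_def by simp
  moreover have "elts (pfst Q) \<inter> F \<subseteq> ?p \<union> \<sigma> ` ?b" using Q(2) \<psi>(2) T'(3) by auto
  ultimately show ?thesis using that by blast
qed

text \<open>The class \<open>K\<close> need not be a set of \<open>V\<close>, but structures on
  subsets of \<open>X\<close> are bounded by the power sets of \<open>X\<close> and of its atoms;
  definability of \<open>K\<close> then allows separation.\<close>

lemma conditions_V: "inV C"
proof -
  have "inV {A \<in> elts (prodset (pow X) (pow (atoms L X))). A \<in> K}"
  proof (rule inV_sep[OF D_class])
    show "class_of V K" using K unfolding strong_Fraisse_class_def by blast
    show "prodset (pow X) (pow (atoms L X)) \<in> V"
      using T_in[OF T_prodset[OF T_const T_const], of "pow X" "pow (atoms L X)" "\<lambda>_. X"] X(1) atoms(1)[OF X(1)]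
      by simp
  qed
  moreover have "{A \<in> elts (prodset (pow X) (pow (atoms L X))). A \<in> K} = C"
  proof (intro set_eqI iffI)
    fix A assume "A \<in> {A \<in> elts (prodset (pow X) (pow (atoms L X))). A \<in> K}"
    then show "A \<in> C" unfolding cohen_conditions_def by (auto simp: elts_pow X(1))
  next
    fix A assume A: "A \<in> C"
    then have AK: "A \<in> K" "elts (pfst A) \<subseteq> elts X" unfolding cohen_conditions_def by auto
    obtain Y I where I: "A = opair Y I" "Y \<in> V" "I \<in> V"
      "elts I \<subseteq> {opair R (tup as) | R as. has_arity L R (length as) \<and> set as \<subseteq> elts Y}"
      using finite_structureD[OF K_finite[OF AK(1)]] by (elim conjE) (rule that, assumption+)
    have Y: "elts Y \<subseteq> elts X" using AK(2) I(1) by simp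
    have "elts I \<subseteq> elts (atoms L X)"
    proof
      fix e assume "e \<in> elts I"
      then obtain R as where "e = opair R (tup as)" "has_arity L R (length as)" "set as \<subseteq> elts Y"
        using subsetD[OF I(4)] by blast
      then show "e \<in> elts (atoms L X)" unfolding atoms(2)[OF X(1)] using Y by blast
    qed
    then show "A \<in> {A \<in> elts (prodset (pow X) (pow (atoms L X))). A \<in> K}"
      using I Y AK(1) by (auto simp: elts_pow X(1) atoms(1))
  qed
  ultimately show ?thesis by simp
qed

lemma cohen_le_trans: "cohen_le Q P \<Longrightarrow> cohen_le P' Q \<Longrightarrow> cohen_le P' P"
  unfolding cohen_le_def substructure_def embedding_def by simp (meson subset_trans)

lemma cohen_le_holds: "cohen_le Q P \<Longrightarrow> set as \<subseteq> elts (pfst P) \<Longrightarrow> holds Q R as \<longleftrightarrow> holds P R as"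
  unfolding cohen_le_def substructure_def embedding_def by simp

text \<open>A condition in the filter decides all facts about its own points: any other condition in
  the filter has a common extension with it, and both are substructures of that extension.\<close>

lemma generic_holds:
  assumes G: "generic_filter V C cohen_le G" and A: "A \<in> elts G" "set as \<subseteq> elts (pfst A)"
  shows "holds (union_structure (elts G)) R as \<longleftrightarrow> holds A R as"
proof -
  have GK: "B \<in> finite_structures V L" if "B \<in> elts G" for B
    using G that K_finite unfolding generic_filter_def filter_on_def cohen_conditions_def by blast
  have "\<exists>Y I. B = opair Y I" if "B \<in> elts G" for B using finite_structureD[OF GK[OF that]] by blast
  then have u: "holds (union_structure (elts G)) R as \<longleftrightarrow> (\<exists>A\<in>elts G. holds A R as)"
    by (rule union_structure_holds)
  have "holds A R as" if B: "B \<in> elts G" "holds B R as" for B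
  proof -
    obtain Q where Q: "cohen_le Q A" "cohen_le Q B"
      using G A(1) B(1) unfolding generic_filter_def filter_on_def by blast
    have "set as \<subseteq> elts (pfst B)" by (rule finite_structure_holds(2)[OF GK[OF B(1)] B(2)])
    then show ?thesis using cohen_le_holds[OF Q(2)] cohen_le_holds[OF Q(1) A(2)] B(2) by simp
  qed
  then show ?thesis unfolding u using A(1) by auto
qed

end

section \<open>Density arguments for Cohen generic structures\<close>

locale cohen_events = events V \<kappa> X L R l pat x u + strong_class V \<kappa> X L K
  for V :: "'u::set_universe set" and \<kappa> X L R l pat x u K +
  fixes A B :: 'u and al bl :: "'u list"
  assumes A: "A \<in> K" "distinct al" "set al = elts (pfst A)" "length al = l" "holds A R (map (nth al) pat)"
    and B: "B \<in> K" "distinct bl" "set bl = elts (pfst B)" "length bl = l" "\<not> holds B R (map (nth bl) pat)"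
begin

lemma U_disjoint: assumes "i \<noteq> j" shows "set (U i) \<inter> set (U j) = {}"
proof (rule ccontr)
  assume "set (U i) \<inter> set (U j) \<noteq> {}"
  then obtain a b where ab: "a < l" "b < l" "x (l * i + a) = x (l * j + b)" by (auto simp: U_def)
  then have "l * i + a = l * j + b" using injD[OF x(2)] by blast
  then have "(l * i + a) div l = (l * j + b) div l" by simp
  then show False using ab(1,2) assms by simp
qed

text \<open>The sequence \<open>x\<close> is injective, so it enters \<open>F\<close> only finitely
  often; a tuple with a point in \<open>F\<close> has \<open>l > 0\<close>, hence its points have
  positions at least \<open>i\<close>.\<close>

lemma U_finite_meet: assumes "finite F" obtains k where "\<And>i. k \<le> i \<Longrightarrow> set (U i) \<inter> F = {}"
proof -
  have "finite {n. x n \<in> F}" using finite_vimageI[OF assms x(2)] by (simp add: vimage_def)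
  then obtain k where k: "\<And>n. x n \<in> F \<Longrightarrow> n < k" by (metis finite_nat_set_iff_bounded mem_Collect_eq)
  have "set (U i) \<inter> F = {}" if "k \<le> i" for i
  proof (rule ccontr)
    assume "set (U i) \<inter> F \<noteq> {}"
    then obtain j where j: "j < l" "x (l * i + j) \<in> F" by (auto simp: U_def)
    then have "l * i + j < i" using k that by fastforce
    moreover have "i \<le> l * i" using j(1) by simp
    ultimately show False by linarith
  qed
  then show ?thesis using that by blast
qed

lemma U_length: "length (U i) = l" and U_distinct: "distinct (U i)" and U_X: "set (U i) \<subseteq> elts X"
  using x(1) by (auto simp: U_def distinct_map inj_on_def inj_eq[OF x(2)])

lemma w_U: "w i = map (nth (U i)) pat"
  using pat by (auto simp: U_def w_def)

lemma w_subset: "set (w i) \<subseteq> set (U i)"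
  using pat U_length by (auto simp: w_U)

text \<open>Matches the enumeration \<open>nl\<close> with the points of \<open>U i\<close> and
  places a copy of \<open>N\<close> there. Used with the two structures \<open>A\<close> and
  \<open>B\<close> to decide the event either way, without spending other points of
  \<open>F\<close>.\<close>

lemma extend_at:
  assumes P: "P \<in> C" "set (U i) \<inter> elts (pfst P) = {}" and F: "finite F"
    and N: "N \<in> K" "distinct nl" "set nl = elts (pfst N)" "length nl = l"
  obtains Q where "Q \<in> C" "cohen_le Q P" "set (U i) \<subseteq> elts (pfst Q)"
    "holds Q R (w i) \<longleftrightarrow> holds N R (map (nth nl) pat)"
    "elts (pfst Q) \<inter> F \<subseteq> elts (pfst P) \<union> set (U i)"
proof -
  define \<sigma> where "\<sigma> y = U i ! (inv_into {..<l} (nth nl) y)" for y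
  have inj: "inj_on (nth nl) {..<l}" using N(2,4) by (simp add: inj_on_nth)
  have \<sigma>: "\<sigma> (nl ! k) = U i ! k" if "k < l" for k using inj that by (simp add: \<sigma>_def)
  have nl: "elts (pfst N) = nth nl ` {..<l}" using N(3,4) by (auto simp: set_conv_nth)
  have im: "\<sigma> ` elts (pfst N) = set (U i)"
    unfolding nl image_image using \<sigma> U_length by (auto simp: set_conv_nth)
  have "inj_on \<sigma> (elts (pfst N))"
    unfolding nl using \<sigma> U_distinct[of i] U_length by (auto simp: inj_on_def nth_eq_iff_index_eq)
  then obtain Q where Q: "Q \<in> C" "cohen_le Q P" "embedding \<sigma> N Q" "elts (pfst Q) \<inter> F \<subseteq> elts (pfst P) \<union> set (U i)"
    using extend_condition[OF P(1) N(1) F, of \<sigma>] P(2) U_X unfolding im by metis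
  have "set (U i) \<subseteq> elts (pfst Q)" using Q(3) im unfolding embedding_def by blast
  moreover have "map \<sigma> (map (nth nl) pat) = w i" using \<sigma> pat by (simp add: w_U)
  then have "holds Q R (w i) \<longleftrightarrow> holds N R (map (nth nl) pat)"
    using Q(3) pat N(3,4) unfolding embedding_def
    by (metis (no_types, lifting) image_subsetI list.set_map nth_mem)
  ultimately show ?thesis using that Q by blast
qed

lemma condition_finite: "P \<in> C \<Longrightarrow> finite (elts (pfst P))"
  using K_finite unfolding cohen_conditions_def finite_structures_def by blast

text \<open>The left-hand sides are the forms that are visibly definable over \<open>V\<close>, as
  needed for the dense sets in \<open>meets\<close>.\<close>

lemma condition_tuple: assumes "P \<in> C"
  shows "u (num i) \<in> elts (tuples (fst0 P) (num l)) \<longleftrightarrow> set (U i) \<subseteq> elts (pfst P)"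
    "opair R (sel_tup (u (num i)) (tup (map num pat))) \<in> elts (snd0 P) \<longleftrightarrow> holds P R (w i)"
proof -
  have "P \<in> finite_structures V L" using assms K_finite unfolding cohen_conditions_def by blast
  then obtain Y I where I: "P = opair Y I" "Y \<in> V" using finite_structureD by blast
  have u': "u (num i) = tup (U i)" by (simp add: u(2) U_def)
  show "u (num i) \<in> elts (tuples (fst0 P) (num l)) \<longleftrightarrow> set (U i) \<subseteq> elts (pfst P)"
    using elts_tuples[OF I(2), of l] U_length by (auto simp: I(1) u')
  have "set (U i) \<subseteq> V" using U_X XV by blast
  then have "sel_tup (tup (U i)) (tup (map num pat)) = tup (w i)"
    using sel_tup[of "U i" pat] pat U_length by (simp add: w_U)
  then show "opair R (sel_tup (u (num i)) (tup (map num pat))) \<in> elts (snd0 P) \<longleftrightarrow> holds P R (w i)"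
    by (simp add: u' holds_def I(1))
qed

context
  fixes G M
  assumes G: "generic_filter V C cohen_le G" and M: "M = union_structure (elts G)"
begin

lemma pat_V: "tup (map num pat) \<in> V"
  by auto

lemma R_V: "R \<in> V"
  using has_arity_V[OF R] .

text \<open>Since the conditions form a set of \<open>V\<close>, separation puts every definable
  dense set into \<open>V\<close>.\<close>

lemma meets:
  assumes P: "definable (\<lambda>s. P (s 0))" and dense: "\<And>q. q \<in> C \<Longrightarrow> \<exists>d\<in>C. P d \<and> cohen_le d q"
  obtains d where "d \<in> elts G" "d \<in> C" "P d"
proof -
  have iE: "inV {d \<in> elts (mk C). P d}" by (rule inV_sep[OF P]) (rule inV_D(1)[OF conditions_V])
  note E = inV_D[OF iE]
  have eE: "elts (mk {d \<in> elts (mk C). P d}) = {d \<in> C. P d}"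
    using E(2) unfolding inV_D(2)[OF conditions_V] .
  have "dense_in C cohen_le (elts (mk {d \<in> elts (mk C). P d}))"
    unfolding dense_in_def eE using dense by blast
  then have "elts G \<inter> elts (mk {d \<in> elts (mk C). P d}) \<noteq> {}" using G E(1) unfolding generic_filter_def by blast
  then show ?thesis unfolding eE using that by blast
qed

text \<open>Density: a condition mentions finitely many points, so a copy of \<open>B\<close> fits
  on some later tuple and makes that event fail.\<close>

lemma not_all_events: "\<not> (\<forall>i. holds M R (w i))"
proof -
  let ?P = "\<lambda>d. \<exists>i\<in>elts omega. u i \<in> elts (tuples (fst0 d) (num l)) \<and>
    opair R (sel_tup (u i) (tup (map num pat))) \<notin> elts (snd0 d)"
  obtain d where d: "d \<in> elts G" "d \<in> C" "?P d"
  proof (rule meets)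
    show "definable (\<lambda>s. ?P (s 0))" by (intro defin T_const omega_V T_op1[OF u(1)] pat_V R_V)
    fix q assume q: "q \<in> C"
    obtain k where k: "\<And>i. k \<le> i \<Longrightarrow> set (U i) \<inter> elts (pfst q) = {}"
      using U_finite_meet[OF condition_finite[OF q]] by blast
    obtain Q where Q: "Q \<in> C" "cohen_le Q q" "set (U k) \<subseteq> elts (pfst Q)" "\<not> holds Q R (w k)"
      using extend_at[OF q k[OF order_refl] finite.emptyI B(1-4)] B(5) by metis
    have "?P Q"
      by (rule bexI[OF _ num_omega[of k]]) (use Q condition_tuple[OF Q(1), of k] in simp)
    then show "\<exists>d\<in>C. ?P d \<and> cohen_le d q" using Q by blast
  qed
  then obtain i where "set (U i) \<subseteq> elts (pfst d)" "\<not> holds d R (w i)"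
    using condition_tuple[OF d(2)] by auto
  then show ?thesis
    using generic_holds[OF G d(1), of "w i" R] w_subset[of i] unfolding M by blast
qed

text \<open>Density again: \<open>k\<close> is taken beyond the points of the condition, and copies
  of \<open>A\<close> are put on the tuples of the block \<open>[k, g k]\<close> one after
  another.\<close>

lemma sparse_block:
  assumes g: "g \<in> V" "good g"
  shows "\<exists>k n. app0 g (num k) = num n \<and> (\<forall>i\<in>{k..n}. holds M R (w i))"
proof -
  let ?P = "\<lambda>d. \<exists>k\<in>elts omega. \<forall>i\<in>elts (diff2 (succ (app0 g k)) k). u i \<in> elts (tuples (fst0 d) (num l)) \<and>
    opair R (sel_tup (u i) (tup (map num pat))) \<in> elts (snd0 d)"
  have P_iff: "?P d \<longleftrightarrow> (\<exists>k n. app0 g (num k) = num n \<and> (\<forall>i\<in>{k..n}. set (U i) \<subseteq> elts (pfst d) \<and> holds d R (w i)))"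
    if d: "d \<in> C" for d
  proof -
    have "(\<forall>i\<in>elts (diff2 (succ (app0 g (num k))) (num k)). u i \<in> elts (tuples (fst0 d) (num l)) \<and>
        opair R (sel_tup (u i) (tup (map num pat))) \<in> elts (snd0 d)) \<longleftrightarrow>
      (\<exists>n. app0 g (num k) = num n \<and> (\<forall>i\<in>{k..n}. set (U i) \<subseteq> elts (pfst d) \<and> holds d R (w i)))" for k
    proof -
      obtain n where n: "app0 g (num k) = num n" using good_num[OF g(2)] by blast
      show ?thesis unfolding n conj_index ball_simps(9) condition_tuple[OF d] num_inject by blast
    qed
    then show ?thesis unfolding elts_omega bex_simps(7) by blast
  qed
  obtain d where d: "d \<in> elts G" "d \<in> C" "?P d"
  proof (rule meets)
    show "definable (\<lambda>s. ?P (s 0))" by (intro defin T_const omega_V T_op1[OF u(1)] pat_V R_V g)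
    fix q assume q: "q \<in> C"
    obtain k where k: "\<And>i. k \<le> i \<Longrightarrow> set (U i) \<inter> elts (pfst q) = {}"
      using U_finite_meet[OF condition_finite[OF q]] by blast
    obtain n where n: "app0 g (num k) = num n" using good_num[OF g(2)] by blast
    \<comment> \<open>All points of the block. The invariant of the following induction is that the
      condition meets \<open>F\<close> only in the \<open>t\<close> tuples already treated, so that
      the next tuple is still free.\<close>
    define F where "F = (\<Union>i\<in>{k..n}. set (U i))"
    have "\<exists>Q\<in>C. cohen_le Q q \<and> (\<forall>i\<in>{k..<k + t}. set (U i) \<subseteq> elts (pfst Q) \<and> holds Q R (w i)) \<and>
        elts (pfst Q) \<inter> F \<subseteq> (\<Union>i\<in>{k..<k + t}. set (U i))" if "k + t \<le> Suc n" for t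
      using that
    proof (induction t)
      case 0
      have "cohen_le q q" unfolding cohen_le_def substructure_def embedding_def by auto
      moreover have "elts (pfst q) \<inter> F = {}" unfolding F_def using k by fastforce
      ultimately show ?case using q by auto
    next
      case (Suc t)
      then obtain Q where Q: "Q \<in> C" "cohen_le Q q" "\<forall>i\<in>{k..<k + t}. set (U i) \<subseteq> elts (pfst Q) \<and> holds Q R (w i)"
        "elts (pfst Q) \<inter> F \<subseteq> (\<Union>i\<in>{k..<k + t}. set (U i))" by auto
      have "set (U (k + t)) \<subseteq> F" unfolding F_def using Suc(2) by (intro UN_upper) simp
      moreover have "set (U (k + t)) \<inter> set (U i) = {}" if "i \<in> {k..<k + t}" for i
        using U_disjoint that by simp
      ultimately have "set (U (k + t)) \<inter> elts (pfst Q) = {}" using Q(4) by blast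
      moreover have "finite F" unfolding F_def by simp
      ultimately obtain Q' where Q': "Q' \<in> C" "cohen_le Q' Q" "set (U (k + t)) \<subseteq> elts (pfst Q')"
        "holds Q' R (w (k + t))" "elts (pfst Q') \<inter> F \<subseteq> elts (pfst Q) \<union> set (U (k + t))"
        using extend_at[OF Q(1) _ _ A(1-4)] A(5) by metis
      have old: "set (U i) \<subseteq> elts (pfst Q') \<and> holds Q' R (w i)" if "i \<in> {k..<k + t}" for i
      proof -
        have i: "set (U i) \<subseteq> elts (pfst Q)" "holds Q R (w i)" using Q(3) that by auto
        then show ?thesis
          using cohen_le_holds[OF Q'(2), of "w i" R] w_subset[of i] Q'(2)
          unfolding cohen_le_def substructure_def by blast
      qed
      have range: "{k..<k + Suc t} = insert (k + t) {k..<k + t}" by auto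
      have "\<forall>i\<in>{k..<k + Suc t}. set (U i) \<subseteq> elts (pfst Q') \<and> holds Q' R (w i)"
        unfolding range using old Q'(3,4) by blast
      moreover have "elts (pfst Q') \<inter> F \<subseteq> (\<Union>i\<in>{k..<k + Suc t}. set (U i))"
        unfolding range using Q'(5) Q(4) by auto
      ultimately show ?case using Q'(1) cohen_le_trans[OF Q(2) Q'(2)] by blast
    qed
    \<comment> \<open>With \<open>Suc n - k\<close> tuples treated, the closed block up to
      \<open>n\<close> is exhausted.\<close>
    from this[of "Suc n - k"] obtain Q where Q: "Q \<in> C" "cohen_le Q q"
      "\<forall>i\<in>{k..<k + (Suc n - k)}. set (U i) \<subseteq> elts (pfst Q) \<and> holds Q R (w i)"
    proof (cases "k \<le> Suc n")
      case True
      then show ?thesis using \<open>k + (Suc n - k) \<le> Suc n \<Longrightarrow> _\<close> that by auto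
    next
      case False
      have "cohen_le q q" unfolding cohen_le_def substructure_def embedding_def by auto
      then show ?thesis using that[of q] q False by auto
    qed
    have "?P Q" unfolding P_iff[OF Q(1)] using n Q(3) by (intro exI[of _ k] exI[of _ n]) auto
    then show "\<exists>d\<in>C. ?P d \<and> cohen_le d q" using Q by blast
  qed
  then obtain k n where kn: "app0 g (num k) = num n" "\<forall>i\<in>{k..n}. set (U i) \<subseteq> elts (pfst d) \<and> holds d R (w i)"
    using P_iff[OF d(2)] by blast
  have "holds M R (w i)" if "i \<in> {k..n}" for i
    using generic_holds[OF G d(1), of "w i" R] w_subset[of i] kn(2) that unfolding M by blast
  then show ?thesis using kn(1) by blast
qed

end

end

text \<open>Take two nonisomorphic members of equal size. Enumerations of them induce a bijection,
  which is no embedding, so some relation distinguishes a tuple from its image.\<close>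

lemma (in strong_class) not_highly_homogeneous:
  assumes "\<not> highly_homogeneous K"
  obtains A B al bl R pat where "A \<in> K" "distinct al" "set al = elts (pfst A)" "holds A R (map (nth al) pat)"
    "B \<in> K" "distinct bl" "set bl = elts (pfst B)" "length bl = length al" "\<not> holds B R (map (nth bl) pat)"
    "has_arity L R (length pat)" "\<forall>j\<in>set pat. j < length al"
proof -
  obtain A B where AB: "A \<in> K" "B \<in> K" "card (elts (pfst A)) = card (elts (pfst B))" "\<not> isomorphic A B"
    using assms unfolding highly_homogeneous_def by blast
  have fin: "finite (elts (pfst A))" "finite (elts (pfst B))"
    using AB K_finite unfolding finite_structures_def by auto
  obtain al bl where al: "distinct al" "set al = elts (pfst A)" and bl: "distinct bl" "set bl = elts (pfst B)"
    using finite_distinct_list fin by metis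
  have len: "length bl = length al" using distinct_card[OF al(1)] distinct_card[OF bl(1)] al bl AB(3) by simp
  define h where "h y = bl ! (inv_into {..<length al} (nth al) y)" for y
  have "inj_on (nth al) {..<length al}" using al(1) by (simp add: inj_on_nth)
  then have h: "h (al ! k) = bl ! k" if "k < length al" for k using that by (simp add: h_def)
  have A': "elts (pfst A) = nth al ` {..<length al}" using al(2) by (auto simp: set_conv_nth)
  have im: "h ` elts (pfst A) = elts (pfst B)"
    unfolding A' image_image bl(2)[symmetric] using h len by (auto simp: set_conv_nth)
  have inj: "inj_on h (elts (pfst A))"
    unfolding A' using h bl(1) len by (auto simp: inj_on_def nth_eq_iff_index_eq)
  have "\<not> embedding h A B" using AB(4) im unfolding isomorphic_def by blast
  then obtain R as where as: "set as \<subseteq> elts (pfst A)" "holds A R as \<noteq> holds B R (map h as)"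
    using inj im unfolding embedding_def by blast
  \<comment> \<open>The distinguishing tuple may repeat entries; \<open>pat\<close> lists its
    positions in the injective enumeration, and these are common to both structures.\<close>
  define pat where "pat = map (inv_into {..<length al} (nth al)) as"
  have pat: "j < length al" if "j \<in> set pat" for j
    using that as(1) inv_into_into[of _ "nth al" "{..<length al}"] unfolding pat_def A' by auto
  have as': "as = map (nth al) pat"
    using as(1) f_inv_into_f[of _ "nth al" "{..<length al}"] unfolding pat_def A' by (auto intro!: map_idI[symmetric])
  have has: "map h as = map (nth bl) pat" using h pat by (simp add: as')
  have ar: "has_arity L R (length pat)"
    using as(2) finite_structure_holds(1)[OF K_finite[OF AB(1)], of R as]
      finite_structure_holds(1)[OF K_finite[OF AB(2)], of R "map h as"] by (auto simp: pat_def)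
  show ?thesis
  proof (cases "holds A R as")
    case True
    then show ?thesis
      using as(2) unfolding has by (intro that[OF AB(1) al _ AB(2) bl len _ ar]) (simp_all add: pat flip: as')
  next
    \<comment> \<open>The relation holds in the second structure instead, so the two exchange
      roles.\<close>
    case False
    then show ?thesis
      using as(2) unfolding has by (intro that[OF AB(2) bl _ AB(1) al len[symmetric] _ ar])
        (simp_all add: len pat flip: as')
  qed
qed

text \<open>Both implications of the theorem state this one incompatibility, read in the two
  directions.\<close>

lemma cohen_not_random:
  assumes "model_of_set_theory V" "\<kappa> \<in> V" "is_ordinal \<kappa>" "infinite (elts \<kappa>)" "X \<in> V" "infinite (elts X)"
    "L \<in> V" "relational_language L"
    and C: "strong_Fraisse_class V L K" "\<not> highly_homogeneous K" "cohen_generic V K X M"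
    and \<nu>: "\<nu> \<in> V" "invariant_measure V \<kappa> L X \<nu>" "random_generic V \<kappa> L X \<nu> M"
  shows False
proof -
  interpret strong_class V \<kappa> X L K by unfold_locales (use assms in auto)
  obtain A B al bl R pat where AB: "A \<in> K" "distinct al" "set al = elts (pfst A)" "holds A R (map (nth al) pat)"
    "B \<in> K" "distinct bl" "set bl = elts (pfst B)" "length bl = length al" "\<not> holds B R (map (nth bl) pat)"
    "has_arity L R (length pat)" "\<forall>j\<in>set pat. j < length al"
    by (rule not_highly_homogeneous[OF C(2)])
  obtain x u where ev: "events V \<kappa> X L R (length al) pat x u" using events_exist[OF AB(10), of "length al"] AB(11) by blast
  interpret E: events V \<kappa> X L R "length al" pat x u by (rule ev)
  interpret C: cohen_events V \<kappa> X L R "length al" pat x u K A B al bl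
    by unfold_locales (use AB in auto)
  interpret N: measured_events V \<kappa> X L R "length al" pat x u \<nu>
    by unfold_locales (use \<nu> in auto)
  obtain G where G: "generic_filter V (cohen_conditions K X) cohen_le G" "M = union_structure (elts G)"
    using C(3) unfolding cohen_generic_def by blast
  obtain s Z where s: "N.nowhere_dense s" "M \<in> Interp Z s"
    by (rule N.random_generic_nowhere_dense[OF \<nu>(3)])
  consider "s = E.all_events" | g where "g \<in> V" "E.good g" "s = E.sparse_events g"
    using s(1) unfolding N.nowhere_dense_def by blast
  then show False
  proof cases
    case 1
    then show False using s(2) C.not_all_events[OF G] by (simp add: E.Interp_all)
  next
    case 2
    obtain k n where "app0 g (num k) = num n" "\<forall>i\<in>{k..n}. holds M R (E.w i)"
      using C.sparse_block[OF G 2(1,2)] by blast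
    \<comment> \<open>By \<open>sparse_block\<close> a whole block holds in \<open>M\<close>,
      whereas lying in the interpretation of \<open>sparse_events g\<close> excludes this for every
      block.\<close>
    then show False using s(2) unfolding 2(3) E.Interp_sparse[OF 2(1,2)]
      by (auto simp: E.Interp_conj dest: spec[of _ k])
  qed
qed

theorem corollary7p15:
  fixes V :: "'u::set_universe set" and \<kappa> X L M :: 'u
  assumes "model_of_set_theory V"
    and "\<kappa> \<in> V" and "is_ordinal \<kappa>" and "infinite (elts \<kappa>)"
    and "X \<in> V" and "infinite (elts X)"
    and "L \<in> V" and "relational_language L"
  shows "((\<exists>K. strong_Fraisse_class V L K \<and> \<not> highly_homogeneous K \<and> cohen_generic V K X M) \<longrightarrow>
            (\<forall>\<nu>\<in>V. invariant_measure V \<kappa> L X \<nu> \<longrightarrow> \<not> random_generic V \<kappa> L X \<nu> M)) \<and>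
         ((\<exists>\<nu>\<in>V. invariant_measure V \<kappa> L X \<nu> \<and> random_generic V \<kappa> L X \<nu> M) \<longrightarrow>
            (\<forall>K. strong_Fraisse_class V L K \<and> \<not> highly_homogeneous K \<longrightarrow> \<not> cohen_generic V K X M))"
  using cohen_not_random[OF assms] by blast

end
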